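(* The theories $\mathbf{CC}_{\mathsf{ML}}$ and $\mathbf{CC}^c_{\mathsf{ML}}$ are equiconsistent: $\mathbf{CC}_{\mathsf{ML}}$ is consistent if and only if $\mathbf{CC}^c_{\mathsf{ML}}$ is consistent.
   Context: $\mathbf{CC}_{\mathsf{ML}}$ is the Coquand–Huet Calculus of Constructions, with no universe of types other than the impredicative universe of propositions, extended with the inductive type constructors $\mathsf N_0,\mathsf N_1,+,\mathsf{List},\Sigma$ of the first-order fragment of Martin-Löf's intensional type theory. In detail: it is a dependent type theory with judgements for contexts, types, equality of types, terms, and equality of terms, with the usual structural, conversion and congruence rules (including the $\xi$-rule). There is a type $\mathsf{Prop}$; every term of $\mathsf{Prop}$ (a proposition) is also a type, whose terms are its proofs. If $A$ is a type and $B$ is a type in context $x\in A$, then $(\Pi x\in A)B$ is a type; if moreover $B$ is a proposition in context $x\in A$, then the product, also written $(\forall x\in A)B$, is a proposition (for $A$ an arbitrary type, including $\mathsf{Prop}$). Products have $\lambda$-abstraction, application and $\beta$-equality. For types $A,B$ (with $B$ in context $x\in A$ in the case of $\Sigma$) there are types $\mathsf N_0$, $\mathsf N_1$, $A+B$, $\mathsf{List}(A)$, $(\Sigma x\in A)B$, with the usual constructors ($\star$ for $\mathsf N_1$; $\mathsf{inl},\mathsf{inr}$; $\epsilon,\mathsf{cons}$; pairing), dependent eliminators towards arbitrary dependent types, and $\beta$-equalities. The logical constants are given by their impredicative encodings, in particular $\varphi\Rightarrow\psi:\equiv(\forall p\in\varphi)\psi$, $\bot:\equiv(\forall z\in\mathsf{Prop})z$,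 $\neg\varphi:\equiv\varphi\Rightarrow\bot$, $\varphi\vee\psi:\equiv(\forall z\in\mathsf{Prop})((\varphi\Rightarrow z)\Rightarrow((\psi\Rightarrow z)\Rightarrow z))$. $\mathbf{CC}^c_{\mathsf{ML}}$ is $\mathbf{CC}_{\mathsf{ML}}$ extended with a constant $\mathsf{lem}\in(\forall x\in\mathsf{Prop})(x\vee\neg x)$. A theory is consistent if it derives no term of type $\bot$ in the empty context. *)

theory Defs
  imports Main
begin

section \<open>Raw syntax\<close>

text \<open>
  Types and terms share one syntactic category of raw expressions, because every term of
  \<open>Prp\<close> is itself a type. Variables are de Bruijn indices. The following arguments are binders,
  the innermost variable having index 0:

  \<^item> \<open>Pi A B\<close>, \<open>Lam A b\<close>, \<open>Sig A B\<close>: the second argument binds a variable of type \<open>A\<close>;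
  \<^item> \<open>ElPlus d m n\<close>: \<open>m\<close> and \<open>n\<close> bind one variable each;
  \<^item> \<open>ElList l m n\<close>: \<open>n\<close> binds the head (2), the tail (1) and the recursive value (0);
  \<^item> \<open>ElSig d m\<close>: \<open>m\<close> binds the first (1) and the second component (0).

  Eliminators do not record their motive, which appears only in the typing rules.
  The expression \<open>Lem\<close> is a raw constant; only the classical theory has a rule for it.
\<close>

datatype expr =
    Var nat
  | Prp
  | Pi expr expr
  | Lam expr expr
  | App expr expr
  | N0
  | ElN0 expr
  | N1
  | Star
  | ElN1 expr expr
  | Plus expr expr
  | InL expr
  | InR expr
  | ElPlus expr expr expr
  | ListT expr
  | Eps
  | ConsT expr expr
  | ElList expr expr expr
  | Sig expr expr
  | PairT expr expr
  | ElSig expr expr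
  | Lem

definition scons :: "'a \<Rightarrow> (nat \<Rightarrow> 'a) \<Rightarrow> nat \<Rightarrow> 'a"  (infixr "\<cdot>" 65) where
  "a \<cdot> s = (\<lambda>n. case n of 0 \<Rightarrow> a | Suc m \<Rightarrow> s m)"

definition up_ren :: "(nat \<Rightarrow> nat) \<Rightarrow> nat \<Rightarrow> nat" where
  "up_ren r = 0 \<cdot> (\<lambda>n. Suc (r n))"

primrec rename :: "(nat \<Rightarrow> nat) \<Rightarrow> expr \<Rightarrow> expr" where
  "rename r (Var n) = Var (r n)"
| "rename r Prp = Prp"
| "rename r (Pi A B) = Pi (rename r A) (rename (up_ren r) B)"
| "rename r (Lam A b) = Lam (rename r A) (rename (up_ren r) b)"
| "rename r (App f a) = App (rename r f) (rename r a)"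
| "rename r N0 = N0"
| "rename r (ElN0 d) = ElN0 (rename r d)"
| "rename r N1 = N1"
| "rename r Star = Star"
| "rename r (ElN1 d m) = ElN1 (rename r d) (rename r m)"
| "rename r (Plus A B) = Plus (rename r A) (rename r B)"
| "rename r (InL a) = InL (rename r a)"
| "rename r (InR b) = InR (rename r b)"
| "rename r (ElPlus d m n) =
     ElPlus (rename r d) (rename (up_ren r) m) (rename (up_ren r) n)"
| "rename r (ListT A) = ListT (rename r A)"
| "rename r Eps = Eps"
| "rename r (ConsT a l) = ConsT (rename r a) (rename r l)"
| "rename r (ElList l m n) =
     ElList (rename r l) (rename r m) (rename (up_ren (up_ren (up_ren r))) n)"
| "rename r (Sig A B) = Sig (rename r A) (rename (up_ren r) B)"
| "rename r (PairT a b) = PairT (rename r a) (rename r b)"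
| "rename r (ElSig d m) = ElSig (rename r d) (rename (up_ren (up_ren r)) m)"
| "rename r Lem = Lem"

abbreviation lift :: "expr \<Rightarrow> expr" where
  "lift \<equiv> rename Suc"

definition up :: "(nat \<Rightarrow> expr) \<Rightarrow> nat \<Rightarrow> expr" where
  "up s = Var 0 \<cdot> (\<lambda>n. lift (s n))"

primrec subst :: "(nat \<Rightarrow> expr) \<Rightarrow> expr \<Rightarrow> expr" where
  "subst s (Var n) = s n"
| "subst s Prp = Prp"
| "subst s (Pi A B) = Pi (subst s A) (subst (up s) B)"
| "subst s (Lam A b) = Lam (subst s A) (subst (up s) b)"
| "subst s (App f a) = App (subst s f) (subst s a)"
| "subst s N0 = N0"
| "subst s (ElN0 d) = ElN0 (subst s d)"
| "subst s N1 = N1"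
| "subst s Star = Star"
| "subst s (ElN1 d m) = ElN1 (subst s d) (subst s m)"
| "subst s (Plus A B) = Plus (subst s A) (subst s B)"
| "subst s (InL a) = InL (subst s a)"
| "subst s (InR b) = InR (subst s b)"
| "subst s (ElPlus d m n) = ElPlus (subst s d) (subst (up s) m) (subst (up s) n)"
| "subst s (ListT A) = ListT (subst s A)"
| "subst s Eps = Eps"
| "subst s (ConsT a l) = ConsT (subst s a) (subst s l)"
| "subst s (ElList l m n) =
     ElList (subst s l) (subst s m) (subst (up (up (up s))) n)"
| "subst s (Sig A B) = Sig (subst s A) (subst (up s) B)"
| "subst s (PairT a b) = PairT (subst s a) (subst s b)"
| "subst s (ElSig d m) = ElSig (subst s d) (subst (up (up s)) m)"
| "subst s Lem = Lem"

text \<open>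
  \<open>inst k a C\<close> replaces variable 0 of \<open>C\<close> by \<open>a\<close>, where \<open>a\<close> lives in a context with \<open>k\<close> further
  variables: from \<open>C\<close> over \<open>\<Gamma>, z\<close> and \<open>a\<close> over \<open>\<Gamma>, x\<^sub>1, \<dots>, x\<^sub>k\<close> it yields
  \<open>C(a)\<close> over \<open>\<Gamma>, x\<^sub>1, \<dots>, x\<^sub>k\<close>. For \<open>k = 0\<close> this is ordinary substitution.
\<close>

definition inst :: "nat \<Rightarrow> expr \<Rightarrow> expr \<Rightarrow> expr" where
  "inst k a C = subst (a \<cdot> (\<lambda>n. Var (n + k))) C"

section \<open>Logical constants\<close>

definition Imp :: "expr \<Rightarrow> expr \<Rightarrow> expr" where
  "Imp P Q = Pi P (lift Q)"

definition Bot :: expr where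
  "Bot = Pi Prp (Var 0)"

definition Neg :: "expr \<Rightarrow> expr" where
  "Neg P = Imp P Bot"

definition Disj :: "expr \<Rightarrow> expr \<Rightarrow> expr" where
  "Disj P Q =
     Pi Prp (Imp (Imp (lift P) (Var 0)) (Imp (Imp (lift Q) (Var 0)) (Var 0)))"

definition LEM :: expr where
  "LEM = Pi Prp (Disj (Var 0) (Neg (Var 0)))"

section \<open>Judgements\<close>

datatype theory_name = CC_ML | CC_ML_c

text \<open>
  Contexts list their most recent declaration first; the entry at position \<open>n\<close> is
  expressed over the entries after it.
\<close>

type_synonym ctxt = "expr list"

definition lookup :: "ctxt \<Rightarrow> nat \<Rightarrow> expr" where
  "lookup \<Gamma> n = rename (\<lambda>m. m + Suc n) (\<Gamma> ! n)"

text \<open>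
  Weakening and (simultaneous) substitution are the rules \<open>ty_subst\<close>, \<open>tyeq_subst\<close>, \<open>tm_subst\<close>
  and \<open>tmeq_subst\<close>; substitution of equals for equals is \<open>ty_subst_eq\<close> and \<open>tm_subst_eq\<close>.
  Weakening is the instance in which the substitution is \<open>\<lambda>n. Var (Suc n)\<close>.
  Several rules carry presuppositions of their other premises as explicit premises.
\<close>

inductive
  is_ctxt :: "theory_name \<Rightarrow> ctxt \<Rightarrow> bool"
    ("(_ \<rhd>/ _ \<turnstile>/ Ctxt)" [51, 51] 50) and
  is_type :: "theory_name \<Rightarrow> ctxt \<Rightarrow> expr \<Rightarrow> bool"
    ("(_ \<rhd>/ _ \<turnstile>/ _ Type)" [51, 51, 51] 50) and
  type_eq :: "theory_name \<Rightarrow> ctxt \<Rightarrow> expr \<Rightarrow> expr \<Rightarrow> bool"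
    ("(_ \<rhd>/ _ \<turnstile>/ _ \<approx> _ Type)" [51, 51, 51, 51] 50) and
  has_type :: "theory_name \<Rightarrow> ctxt \<Rightarrow> expr \<Rightarrow> expr \<Rightarrow> bool"
    ("(_ \<rhd>/ _ \<turnstile>/ _ \<Colon> _)" [51, 51, 51, 51] 50) and
  term_eq :: "theory_name \<Rightarrow> ctxt \<Rightarrow> expr \<Rightarrow> expr \<Rightarrow> expr \<Rightarrow> bool"
    ("(_ \<rhd>/ _ \<turnstile>/ _ \<approx> _ \<Colon> _)" [51, 51, 51, 51, 51] 50)
  for T :: theory_name
where
  \<comment> \<open>contexts, variables, substitution\<close>
  ctxt_empty: "T \<rhd> [] \<turnstile> Ctxt"
| ctxt_ext: "T \<rhd> \<Gamma> \<turnstile> A Type \<Longrightarrow> T \<rhd> A # \<Gamma> \<turnstile> Ctxt"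
| var: "T \<rhd> \<Gamma> \<turnstile> Ctxt \<Longrightarrow> n < length \<Gamma> \<Longrightarrow> T \<rhd> \<Gamma> \<turnstile> Var n \<Colon> lookup \<Gamma> n"
| ty_subst:
    "T \<rhd> \<Gamma> \<turnstile> Ctxt \<Longrightarrow>
     (\<And>n. n < length \<Delta> \<Longrightarrow> T \<rhd> \<Gamma> \<turnstile> s n \<Colon> subst s (lookup \<Delta> n)) \<Longrightarrow>
     T \<rhd> \<Delta> \<turnstile> A Type \<Longrightarrow>
     T \<rhd> \<Gamma> \<turnstile> subst s A Type"
| tyeq_subst:
    "T \<rhd> \<Gamma> \<turnstile> Ctxt \<Longrightarrow>
     (\<And>n. n < length \<Delta> \<Longrightarrow> T \<rhd> \<Gamma> \<turnstile> s n \<Colon> subst s (lookup \<Delta> n)) \<Longrightarrow>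
     T \<rhd> \<Delta> \<turnstile> A \<approx> B Type \<Longrightarrow>
     T \<rhd> \<Gamma> \<turnstile> subst s A \<approx> subst s B Type"
| tm_subst:
    "T \<rhd> \<Gamma> \<turnstile> Ctxt \<Longrightarrow>
     (\<And>n. n < length \<Delta> \<Longrightarrow> T \<rhd> \<Gamma> \<turnstile> s n \<Colon> subst s (lookup \<Delta> n)) \<Longrightarrow>
     T \<rhd> \<Delta> \<turnstile> a \<Colon> A \<Longrightarrow>
     T \<rhd> \<Gamma> \<turnstile> subst s a \<Colon> subst s A"
| tmeq_subst:
    "T \<rhd> \<Gamma> \<turnstile> Ctxt \<Longrightarrow>
     (\<And>n. n < length \<Delta> \<Longrightarrow> T \<rhd> \<Gamma> \<turnstile> s n \<Colon> subst s (lookup \<Delta> n)) \<Longrightarrow>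
     T \<rhd> \<Delta> \<turnstile> a \<approx> b \<Colon> A \<Longrightarrow>
     T \<rhd> \<Gamma> \<turnstile> subst s a \<approx> subst s b \<Colon> subst s A"
| ty_subst_eq:
    "T \<rhd> \<Gamma> \<turnstile> Ctxt \<Longrightarrow>
     (\<And>n. n < length \<Delta> \<Longrightarrow> T \<rhd> \<Gamma> \<turnstile> s n \<Colon> subst s (lookup \<Delta> n)) \<Longrightarrow>
     (\<And>n. n < length \<Delta> \<Longrightarrow> T \<rhd> \<Gamma> \<turnstile> t n \<Colon> subst t (lookup \<Delta> n)) \<Longrightarrow>
     (\<And>n. n < length \<Delta> \<Longrightarrow> T \<rhd> \<Gamma> \<turnstile> s n \<approx> t n \<Colon> subst s (lookup \<Delta> n)) \<Longrightarrow>
     T \<rhd> \<Delta> \<turnstile> A Type \<Longrightarrow>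
     T \<rhd> \<Gamma> \<turnstile> subst s A \<approx> subst t A Type"
| tm_subst_eq:
    "T \<rhd> \<Gamma> \<turnstile> Ctxt \<Longrightarrow>
     (\<And>n. n < length \<Delta> \<Longrightarrow> T \<rhd> \<Gamma> \<turnstile> s n \<Colon> subst s (lookup \<Delta> n)) \<Longrightarrow>
     (\<And>n. n < length \<Delta> \<Longrightarrow> T \<rhd> \<Gamma> \<turnstile> t n \<Colon> subst t (lookup \<Delta> n)) \<Longrightarrow>
     (\<And>n. n < length \<Delta> \<Longrightarrow> T \<rhd> \<Gamma> \<turnstile> s n \<approx> t n \<Colon> subst s (lookup \<Delta> n)) \<Longrightarrow>
     T \<rhd> \<Delta> \<turnstile> a \<Colon> A \<Longrightarrow>
     T \<rhd> \<Gamma> \<turnstile> subst s a \<approx> subst t a \<Colon> subst s A"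

  \<comment> \<open>equivalence and conversion\<close>
| tyeq_refl: "T \<rhd> \<Gamma> \<turnstile> A Type \<Longrightarrow> T \<rhd> \<Gamma> \<turnstile> A \<approx> A Type"
| tyeq_sym: "T \<rhd> \<Gamma> \<turnstile> A \<approx> B Type \<Longrightarrow> T \<rhd> \<Gamma> \<turnstile> B \<approx> A Type"
| tyeq_trans:
    "T \<rhd> \<Gamma> \<turnstile> A \<approx> B Type \<Longrightarrow> T \<rhd> \<Gamma> \<turnstile> B \<approx> C Type \<Longrightarrow> T \<rhd> \<Gamma> \<turnstile> A \<approx> C Type"
| tmeq_refl: "T \<rhd> \<Gamma> \<turnstile> a \<Colon> A \<Longrightarrow> T \<rhd> \<Gamma> \<turnstile> a \<approx> a \<Colon> A"
| tmeq_sym: "T \<rhd> \<Gamma> \<turnstile> a \<approx> b \<Colon> A \<Longrightarrow> T \<rhd> \<Gamma> \<turnstile> b \<approx> a \<Colon> A"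
| tmeq_trans:
    "T \<rhd> \<Gamma> \<turnstile> a \<approx> b \<Colon> A \<Longrightarrow> T \<rhd> \<Gamma> \<turnstile> b \<approx> c \<Colon> A \<Longrightarrow> T \<rhd> \<Gamma> \<turnstile> a \<approx> c \<Colon> A"
| tm_conv:
    "T \<rhd> \<Gamma> \<turnstile> a \<Colon> A \<Longrightarrow> T \<rhd> \<Gamma> \<turnstile> A \<approx> B Type \<Longrightarrow> T \<rhd> \<Gamma> \<turnstile> a \<Colon> B"
| tmeq_conv:
    "T \<rhd> \<Gamma> \<turnstile> a \<approx> b \<Colon> A \<Longrightarrow> T \<rhd> \<Gamma> \<turnstile> A \<approx> B Type \<Longrightarrow> T \<rhd> \<Gamma> \<turnstile> a \<approx> b \<Colon> B"

  \<comment> \<open>propositions\<close>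
| Prp_form: "T \<rhd> \<Gamma> \<turnstile> Ctxt \<Longrightarrow> T \<rhd> \<Gamma> \<turnstile> Prp Type"
| Prp_type: "T \<rhd> \<Gamma> \<turnstile> P \<Colon> Prp \<Longrightarrow> T \<rhd> \<Gamma> \<turnstile> P Type"
| Prp_type_eq: "T \<rhd> \<Gamma> \<turnstile> P \<approx> Q \<Colon> Prp \<Longrightarrow> T \<rhd> \<Gamma> \<turnstile> P \<approx> Q Type"

  \<comment> \<open>dependent products and universal quantification\<close>
| Pi_form:
    "T \<rhd> \<Gamma> \<turnstile> A Type \<Longrightarrow> T \<rhd> A # \<Gamma> \<turnstile> B Type \<Longrightarrow> T \<rhd> \<Gamma> \<turnstile> Pi A B Type"
| Pi_form_eq:
    "T \<rhd> \<Gamma> \<turnstile> A \<approx> A' Type \<Longrightarrow> T \<rhd> A # \<Gamma> \<turnstile> B \<approx> B' Type \<Longrightarrow>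
     T \<rhd> \<Gamma> \<turnstile> Pi A B \<approx> Pi A' B' Type"
| All_form:
    "T \<rhd> \<Gamma> \<turnstile> A Type \<Longrightarrow> T \<rhd> A # \<Gamma> \<turnstile> P \<Colon> Prp \<Longrightarrow> T \<rhd> \<Gamma> \<turnstile> Pi A P \<Colon> Prp"
| All_form_eq:
    "T \<rhd> \<Gamma> \<turnstile> A \<approx> A' Type \<Longrightarrow> T \<rhd> A # \<Gamma> \<turnstile> P \<approx> P' \<Colon> Prp \<Longrightarrow>
     T \<rhd> \<Gamma> \<turnstile> Pi A P \<approx> Pi A' P' \<Colon> Prp"
| Pi_intro:
    "T \<rhd> \<Gamma> \<turnstile> A Type \<Longrightarrow> T \<rhd> A # \<Gamma> \<turnstile> b \<Colon> B \<Longrightarrow> T \<rhd> \<Gamma> \<turnstile> Lam A b \<Colon> Pi A B"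
| Pi_intro_eq:
    "T \<rhd> \<Gamma> \<turnstile> A \<approx> A' Type \<Longrightarrow> T \<rhd> A # \<Gamma> \<turnstile> b \<approx> b' \<Colon> B \<Longrightarrow>
     T \<rhd> \<Gamma> \<turnstile> Lam A b \<approx> Lam A' b' \<Colon> Pi A B"
| Pi_elim:
    "T \<rhd> \<Gamma> \<turnstile> A Type \<Longrightarrow> T \<rhd> A # \<Gamma> \<turnstile> B Type \<Longrightarrow>
     T \<rhd> \<Gamma> \<turnstile> f \<Colon> Pi A B \<Longrightarrow> T \<rhd> \<Gamma> \<turnstile> a \<Colon> A \<Longrightarrow>
     T \<rhd> \<Gamma> \<turnstile> App f a \<Colon> inst 0 a B"
| Pi_elim_eq:
    "T \<rhd> \<Gamma> \<turnstile> A Type \<Longrightarrow> T \<rhd> A # \<Gamma> \<turnstile> B Type \<Longrightarrow>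
     T \<rhd> \<Gamma> \<turnstile> f \<approx> f' \<Colon> Pi A B \<Longrightarrow> T \<rhd> \<Gamma> \<turnstile> a \<approx> a' \<Colon> A \<Longrightarrow>
     T \<rhd> \<Gamma> \<turnstile> App f a \<approx> App f' a' \<Colon> inst 0 a B"
| Pi_beta:
    "T \<rhd> \<Gamma> \<turnstile> A Type \<Longrightarrow> T \<rhd> A # \<Gamma> \<turnstile> b \<Colon> B \<Longrightarrow> T \<rhd> \<Gamma> \<turnstile> a \<Colon> A \<Longrightarrow>
     T \<rhd> \<Gamma> \<turnstile> App (Lam A b) a \<approx> inst 0 a b \<Colon> inst 0 a B"

  \<comment> \<open>empty type\<close>
| N0_form: "T \<rhd> \<Gamma> \<turnstile> Ctxt \<Longrightarrow> T \<rhd> \<Gamma> \<turnstile> N0 Type"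
| N0_elim:
    "T \<rhd> N0 # \<Gamma> \<turnstile> C Type \<Longrightarrow> T \<rhd> \<Gamma> \<turnstile> d \<Colon> N0 \<Longrightarrow> T \<rhd> \<Gamma> \<turnstile> ElN0 d \<Colon> inst 0 d C"
| N0_elim_eq:
    "T \<rhd> N0 # \<Gamma> \<turnstile> C Type \<Longrightarrow> T \<rhd> \<Gamma> \<turnstile> d \<approx> d' \<Colon> N0 \<Longrightarrow>
     T \<rhd> \<Gamma> \<turnstile> ElN0 d \<approx> ElN0 d' \<Colon> inst 0 d C"

  \<comment> \<open>singleton type\<close>
| N1_form: "T \<rhd> \<Gamma> \<turnstile> Ctxt \<Longrightarrow> T \<rhd> \<Gamma> \<turnstile> N1 Type"
| N1_intro: "T \<rhd> \<Gamma> \<turnstile> Ctxt \<Longrightarrow> T \<rhd> \<Gamma> \<turnstile> Star \<Colon> N1"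
| N1_elim:
    "T \<rhd> N1 # \<Gamma> \<turnstile> C Type \<Longrightarrow> T \<rhd> \<Gamma> \<turnstile> d \<Colon> N1 \<Longrightarrow> T \<rhd> \<Gamma> \<turnstile> m \<Colon> inst 0 Star C \<Longrightarrow>
     T \<rhd> \<Gamma> \<turnstile> ElN1 d m \<Colon> inst 0 d C"
| N1_elim_eq:
    "T \<rhd> N1 # \<Gamma> \<turnstile> C Type \<Longrightarrow> T \<rhd> \<Gamma> \<turnstile> d \<approx> d' \<Colon> N1 \<Longrightarrow>
     T \<rhd> \<Gamma> \<turnstile> m \<approx> m' \<Colon> inst 0 Star C \<Longrightarrow>
     T \<rhd> \<Gamma> \<turnstile> ElN1 d m \<approx> ElN1 d' m' \<Colon> inst 0 d C"
| N1_beta: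
    "T \<rhd> N1 # \<Gamma> \<turnstile> C Type \<Longrightarrow> T \<rhd> \<Gamma> \<turnstile> m \<Colon> inst 0 Star C \<Longrightarrow>
     T \<rhd> \<Gamma> \<turnstile> ElN1 Star m \<approx> m \<Colon> inst 0 Star C"

  \<comment> \<open>disjoint sums\<close>
| Plus_form:
    "T \<rhd> \<Gamma> \<turnstile> A Type \<Longrightarrow> T \<rhd> \<Gamma> \<turnstile> B Type \<Longrightarrow> T \<rhd> \<Gamma> \<turnstile> Plus A B Type"
| Plus_form_eq:
    "T \<rhd> \<Gamma> \<turnstile> A \<approx> A' Type \<Longrightarrow> T \<rhd> \<Gamma> \<turnstile> B \<approx> B' Type \<Longrightarrow>
     T \<rhd> \<Gamma> \<turnstile> Plus A B \<approx> Plus A' B' Type"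
| InL_intro:
    "T \<rhd> \<Gamma> \<turnstile> A Type \<Longrightarrow> T \<rhd> \<Gamma> \<turnstile> B Type \<Longrightarrow> T \<rhd> \<Gamma> \<turnstile> a \<Colon> A \<Longrightarrow>
     T \<rhd> \<Gamma> \<turnstile> InL a \<Colon> Plus A B"
| InL_intro_eq:
    "T \<rhd> \<Gamma> \<turnstile> A Type \<Longrightarrow> T \<rhd> \<Gamma> \<turnstile> B Type \<Longrightarrow> T \<rhd> \<Gamma> \<turnstile> a \<approx> a' \<Colon> A \<Longrightarrow>
     T \<rhd> \<Gamma> \<turnstile> InL a \<approx> InL a' \<Colon> Plus A B"
| InR_intro:
    "T \<rhd> \<Gamma> \<turnstile> A Type \<Longrightarrow> T \<rhd> \<Gamma> \<turnstile> B Type \<Longrightarrow> T \<rhd> \<Gamma> \<turnstile> b \<Colon> B \<Longrightarrow>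
     T \<rhd> \<Gamma> \<turnstile> InR b \<Colon> Plus A B"
| InR_intro_eq:
    "T \<rhd> \<Gamma> \<turnstile> A Type \<Longrightarrow> T \<rhd> \<Gamma> \<turnstile> B Type \<Longrightarrow> T \<rhd> \<Gamma> \<turnstile> b \<approx> b' \<Colon> B \<Longrightarrow>
     T \<rhd> \<Gamma> \<turnstile> InR b \<approx> InR b' \<Colon> Plus A B"
| Plus_elim:
    "T \<rhd> Plus A B # \<Gamma> \<turnstile> C Type \<Longrightarrow> T \<rhd> \<Gamma> \<turnstile> d \<Colon> Plus A B \<Longrightarrow>
     T \<rhd> A # \<Gamma> \<turnstile> m \<Colon> inst 1 (InL (Var 0)) C \<Longrightarrow>
     T \<rhd> B # \<Gamma> \<turnstile> n \<Colon> inst 1 (InR (Var 0)) C \<Longrightarrow>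
     T \<rhd> \<Gamma> \<turnstile> ElPlus d m n \<Colon> inst 0 d C"
| Plus_elim_eq:
    "T \<rhd> Plus A B # \<Gamma> \<turnstile> C Type \<Longrightarrow> T \<rhd> \<Gamma> \<turnstile> d \<approx> d' \<Colon> Plus A B \<Longrightarrow>
     T \<rhd> A # \<Gamma> \<turnstile> m \<approx> m' \<Colon> inst 1 (InL (Var 0)) C \<Longrightarrow>
     T \<rhd> B # \<Gamma> \<turnstile> n \<approx> n' \<Colon> inst 1 (InR (Var 0)) C \<Longrightarrow>
     T \<rhd> \<Gamma> \<turnstile> ElPlus d m n \<approx> ElPlus d' m' n' \<Colon> inst 0 d C"
| Plus_beta_InL:
    "T \<rhd> Plus A B # \<Gamma> \<turnstile> C Type \<Longrightarrow> T \<rhd> \<Gamma> \<turnstile> a \<Colon> A \<Longrightarrow>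
     T \<rhd> A # \<Gamma> \<turnstile> m \<Colon> inst 1 (InL (Var 0)) C \<Longrightarrow>
     T \<rhd> B # \<Gamma> \<turnstile> n \<Colon> inst 1 (InR (Var 0)) C \<Longrightarrow>
     T \<rhd> \<Gamma> \<turnstile> ElPlus (InL a) m n \<approx> inst 0 a m \<Colon> inst 0 (InL a) C"
| Plus_beta_InR:
    "T \<rhd> Plus A B # \<Gamma> \<turnstile> C Type \<Longrightarrow> T \<rhd> \<Gamma> \<turnstile> b \<Colon> B \<Longrightarrow>
     T \<rhd> A # \<Gamma> \<turnstile> m \<Colon> inst 1 (InL (Var 0)) C \<Longrightarrow>
     T \<rhd> B # \<Gamma> \<turnstile> n \<Colon> inst 1 (InR (Var 0)) C \<Longrightarrow>
     T \<rhd> \<Gamma> \<turnstile> ElPlus (InR b) m n \<approx> inst 0 b n \<Colon> inst 0 (InR b) C"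

  \<comment> \<open>lists\<close>
| List_form: "T \<rhd> \<Gamma> \<turnstile> A Type \<Longrightarrow> T \<rhd> \<Gamma> \<turnstile> ListT A Type"
| List_form_eq: "T \<rhd> \<Gamma> \<turnstile> A \<approx> A' Type \<Longrightarrow> T \<rhd> \<Gamma> \<turnstile> ListT A \<approx> ListT A' Type"
| Eps_intro: "T \<rhd> \<Gamma> \<turnstile> A Type \<Longrightarrow> T \<rhd> \<Gamma> \<turnstile> Eps \<Colon> ListT A"
| Cons_intro:
    "T \<rhd> \<Gamma> \<turnstile> A Type \<Longrightarrow> T \<rhd> \<Gamma> \<turnstile> a \<Colon> A \<Longrightarrow> T \<rhd> \<Gamma> \<turnstile> l \<Colon> ListT A \<Longrightarrow>
     T \<rhd> \<Gamma> \<turnstile> ConsT a l \<Colon> ListT A"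
| Cons_intro_eq:
    "T \<rhd> \<Gamma> \<turnstile> A Type \<Longrightarrow> T \<rhd> \<Gamma> \<turnstile> a \<approx> a' \<Colon> A \<Longrightarrow> T \<rhd> \<Gamma> \<turnstile> l \<approx> l' \<Colon> ListT A \<Longrightarrow>
     T \<rhd> \<Gamma> \<turnstile> ConsT a l \<approx> ConsT a' l' \<Colon> ListT A"
| List_elim:
    "T \<rhd> ListT A # \<Gamma> \<turnstile> C Type \<Longrightarrow> T \<rhd> \<Gamma> \<turnstile> l \<Colon> ListT A \<Longrightarrow>
     T \<rhd> \<Gamma> \<turnstile> m \<Colon> inst 0 Eps C \<Longrightarrow>
     T \<rhd> inst 2 (Var 0) C # ListT (lift A) # A # \<Gamma> \<turnstile>
       n \<Colon> inst 3 (ConsT (Var 2) (Var 1)) C \<Longrightarrow>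
     T \<rhd> \<Gamma> \<turnstile> ElList l m n \<Colon> inst 0 l C"
| List_elim_eq:
    "T \<rhd> ListT A # \<Gamma> \<turnstile> C Type \<Longrightarrow> T \<rhd> \<Gamma> \<turnstile> l \<approx> l' \<Colon> ListT A \<Longrightarrow>
     T \<rhd> \<Gamma> \<turnstile> m \<approx> m' \<Colon> inst 0 Eps C \<Longrightarrow>
     T \<rhd> inst 2 (Var 0) C # ListT (lift A) # A # \<Gamma> \<turnstile>
       n \<approx> n' \<Colon> inst 3 (ConsT (Var 2) (Var 1)) C \<Longrightarrow>
     T \<rhd> \<Gamma> \<turnstile> ElList l m n \<approx> ElList l' m' n' \<Colon> inst 0 l C"
| List_beta_Eps:
    "T \<rhd> ListT A # \<Gamma> \<turnstile> C Type \<Longrightarrow> T \<rhd> \<Gamma> \<turnstile> m \<Colon> inst 0 Eps C \<Longrightarrow>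
     T \<rhd> inst 2 (Var 0) C # ListT (lift A) # A # \<Gamma> \<turnstile>
       n \<Colon> inst 3 (ConsT (Var 2) (Var 1)) C \<Longrightarrow>
     T \<rhd> \<Gamma> \<turnstile> ElList Eps m n \<approx> m \<Colon> inst 0 Eps C"
| List_beta_Cons:
    "T \<rhd> ListT A # \<Gamma> \<turnstile> C Type \<Longrightarrow>
     T \<rhd> \<Gamma> \<turnstile> a \<Colon> A \<Longrightarrow> T \<rhd> \<Gamma> \<turnstile> l \<Colon> ListT A \<Longrightarrow>
     T \<rhd> \<Gamma> \<turnstile> m \<Colon> inst 0 Eps C \<Longrightarrow>
     T \<rhd> inst 2 (Var 0) C # ListT (lift A) # A # \<Gamma> \<turnstile>
       n \<Colon> inst 3 (ConsT (Var 2) (Var 1)) C \<Longrightarrow>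
     T \<rhd> \<Gamma> \<turnstile> ElList (ConsT a l) m n \<approx> subst (ElList l m n \<cdot> l \<cdot> a \<cdot> Var) n \<Colon>
       inst 0 (ConsT a l) C"

  \<comment> \<open>dependent sums\<close>
| Sig_form:
    "T \<rhd> \<Gamma> \<turnstile> A Type \<Longrightarrow> T \<rhd> A # \<Gamma> \<turnstile> B Type \<Longrightarrow> T \<rhd> \<Gamma> \<turnstile> Sig A B Type"
| Sig_form_eq:
    "T \<rhd> \<Gamma> \<turnstile> A \<approx> A' Type \<Longrightarrow> T \<rhd> A # \<Gamma> \<turnstile> B \<approx> B' Type \<Longrightarrow>
     T \<rhd> \<Gamma> \<turnstile> Sig A B \<approx> Sig A' B' Type"
| Sig_intro:
    "T \<rhd> \<Gamma> \<turnstile> A Type \<Longrightarrow> T \<rhd> A # \<Gamma> \<turnstile> B Type \<Longrightarrow>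
     T \<rhd> \<Gamma> \<turnstile> a \<Colon> A \<Longrightarrow> T \<rhd> \<Gamma> \<turnstile> b \<Colon> inst 0 a B \<Longrightarrow>
     T \<rhd> \<Gamma> \<turnstile> PairT a b \<Colon> Sig A B"
| Sig_intro_eq:
    "T \<rhd> \<Gamma> \<turnstile> A Type \<Longrightarrow> T \<rhd> A # \<Gamma> \<turnstile> B Type \<Longrightarrow>
     T \<rhd> \<Gamma> \<turnstile> a \<approx> a' \<Colon> A \<Longrightarrow> T \<rhd> \<Gamma> \<turnstile> b \<approx> b' \<Colon> inst 0 a B \<Longrightarrow>
     T \<rhd> \<Gamma> \<turnstile> PairT a b \<approx> PairT a' b' \<Colon> Sig A B"
| Sig_elim:
    "T \<rhd> Sig A B # \<Gamma> \<turnstile> C Type \<Longrightarrow> T \<rhd> \<Gamma> \<turnstile> d \<Colon> Sig A B \<Longrightarrow>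
     T \<rhd> B # A # \<Gamma> \<turnstile> m \<Colon> inst 2 (PairT (Var 1) (Var 0)) C \<Longrightarrow>
     T \<rhd> \<Gamma> \<turnstile> ElSig d m \<Colon> inst 0 d C"
| Sig_elim_eq:
    "T \<rhd> Sig A B # \<Gamma> \<turnstile> C Type \<Longrightarrow> T \<rhd> \<Gamma> \<turnstile> d \<approx> d' \<Colon> Sig A B \<Longrightarrow>
     T \<rhd> B # A # \<Gamma> \<turnstile> m \<approx> m' \<Colon> inst 2 (PairT (Var 1) (Var 0)) C \<Longrightarrow>
     T \<rhd> \<Gamma> \<turnstile> ElSig d m \<approx> ElSig d' m' \<Colon> inst 0 d C"
| Sig_beta:
    "T \<rhd> Sig A B # \<Gamma> \<turnstile> C Type \<Longrightarrow>
     T \<rhd> \<Gamma> \<turnstile> a \<Colon> A \<Longrightarrow> T \<rhd> \<Gamma> \<turnstile> b \<Colon> inst 0 a B \<Longrightarrow>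
     T \<rhd> B # A # \<Gamma> \<turnstile> m \<Colon> inst 2 (PairT (Var 1) (Var 0)) C \<Longrightarrow>
     T \<rhd> \<Gamma> \<turnstile> ElSig (PairT a b) m \<approx> subst (b \<cdot> a \<cdot> Var) m \<Colon> inst 0 (PairT a b) C"

  \<comment> \<open>excluded middle, in the classical theory only\<close>
| lem: "T = CC_ML_c \<Longrightarrow> T \<rhd> \<Gamma> \<turnstile> Ctxt \<Longrightarrow> T \<rhd> \<Gamma> \<turnstile> Lem \<Colon> LEM"

definition consistent :: "theory_name \<Rightarrow> bool" where
  "consistent T \<longleftrightarrow> \<not> (\<exists>t. T \<rhd> [] \<turnstile> t \<Colon> Bot)"

end

theory Submission
  imports Defs
begin

text \<open>
  Every derivation of \<open>CC_ML\<close> is one of \<open>CC_ML_c\<close>, so only the passage from consistency of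
  \<open>CC_ML\<close> to that of \<open>CC_ML_c\<close> has content. It is a double-negation translation of the
  classical theory into the intuitionistic one. The universe \<open>Prp\<close> is translated by the type
  \<open>SProp\<close> of \<^emph>\<open>stable\<close> propositions, that is, of pairs of a proposition \<open>P\<close> and a proof of
  \<open>\<not>\<not>P \<Rightarrow> P\<close>; a proposition that is used as a type is translated by its first component.
  All other type formers, and all term formers except products of propositions and \<open>Lem\<close>, are
  translated by themselves. This works for three reasons. A product of stable propositions is stable,
  whatever type it ranges over (\<open>stab_eq\<close>), so the universal quantifier is translated by itself,
  paired with a stability proof. The impredicative disjunction quantifies, after translation,
  over stable propositions only, and then excluded middle is provable (\<open>em_type\<close>). Finally
  \<open>\<bottom>\<close> becomes the statement that all stable propositions hold, and since \<open>\<bottom>\<close> is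
  stable itself, this yields \<open>\<bottom>\<close> back (\<open>BotS_elim\<close>). So a classical proof of \<open>\<bottom>\<close> is
  translated into an intuitionistic one.

  The difficulty is that propositions are types without any coercion. The same raw expression
  \<open>Pi A B\<close> has a translation \<open>ty (Pi A B)\<close> as a type, which is a product, and a translation
  \<open>tm (Pi A B)\<close> as a term, which is a pair; they are related only by the judgemental equality of
  the product with the first projection of the pair. Consequently the translation commutes with
  substitution only up to judgemental equality, and only for well-typed expressions: when a
  variable in type position is replaced by a product, \<open>proj1 (PairT (Pi A B) p)\<close> stands on one
  side and \<open>Pi A B\<close> on the other. Commutation therefore cannot be a preliminary lemma about raw
  syntax. It is built into the induction hypothesis: a type or a term is called \<^emph>\<open>valid\<close> if its
  translation is natural, up to judgemental equality, in all substitutions whose values have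
  well-typed translations (\<open>natural_type\<close>, \<open>valid_term\<close>). The identity substitution is one of
  them, so naturality includes well-typedness. Each rule preserves validity, and
  \<open>soundness\<close> follows by induction on derivations. That judgemental equations determine the
  typing of both sides (\<open>presuppositions\<close>) is used throughout.
\<close>

section \<open>Substitution calculus\<close>

lemma scons_simps [simp]: "(a \<cdot> s) 0 = a" "(a \<cdot> s) (Suc n) = s n"
  by (simp_all add: scons_def)

lemma up_simps [simp]: "up s 0 = Var 0" "up s (Suc n) = lift (s n)"
  by (simp_all add: up_def)

lemma up_ren_simps [simp]: "up_ren r 0 = 0" "up_ren r (Suc n) = Suc (r n)"
  by (simp_all add: up_ren_def)

lemma up_Var: "up (\<lambda>n. Var (r n)) = (\<lambda>n. Var (up_ren r n))"
proof
  show "up (\<lambda>n. Var (r n)) n = Var (up_ren r n)" for n by (cases n) auto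
qed

lemma rename_subst: "rename r e = subst (\<lambda>n. Var (r n)) e"
  by (induction e arbitrary: r) (simp_all add: up_Var)

lemma up_ren_id [simp]: "up_ren (\<lambda>n. n) = (\<lambda>n. n)"
proof
  show "up_ren (\<lambda>n. n) n = n" for n by (cases n) auto
qed

lemma subst_Var [simp]: "subst Var e = e"
proof -
  have "up Var = Var" using up_Var[of "\<lambda>n. n"] by simp
  then show ?thesis by (induction e) simp_all
qed

lemma subst_rename: "subst s (rename r e) = subst (\<lambda>n. s (r n)) e"
proof -
  have "(\<lambda>n. up s (up_ren r n)) = up (\<lambda>n. s (r n))" for s r
  proof
    show "up s (up_ren r n) = up (\<lambda>n. s (r n)) n" for n by (cases n) auto
  qed
  then show ?thesis by (induction e arbitrary: s r) simp_all
qed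

lemma rename_rename: "rename r (rename q e) = rename (\<lambda>n. r (q n)) e"
  by (simp add: rename_subst[of r] rename_subst[of "\<lambda>n. r (q n)"] subst_rename)

lemma rename_of_subst: "rename r (subst s e) = subst (\<lambda>n. rename r (s n)) e"
proof -
  have "(\<lambda>n. rename (up_ren r) (up s n)) = up (\<lambda>n. rename r (s n))" for s r
  proof
    show "rename (up_ren r) (up s n) = up (\<lambda>n. rename r (s n)) n" for n
      by (cases n) (auto simp: rename_rename)
  qed
  then show ?thesis by (induction e arbitrary: s r) simp_all
qed

lemma subst_subst: "subst s (subst t e) = subst (\<lambda>n. subst s (t n)) e"
proof -
  have "(\<lambda>n. subst (up s) (up t n)) = up (\<lambda>n. subst s (t n))" for s t
  proof
    show "subst (up s) (up t n) = up (\<lambda>n. subst s (t n)) n" for n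
      by (cases n) (auto simp: subst_rename rename_of_subst)
  qed
  then show ?thesis by (induction e arbitrary: s t) simp_all
qed

lemma subst_ext_Suc:
  "s 0 = t 0 \<Longrightarrow> (\<And>n. s (Suc n) = t (Suc n)) \<Longrightarrow> subst s e = subst t e"
  by (metis ext not0_implies_Suc)

lemmas subst_norm = rename_rename subst_rename rename_of_subst subst_subst

lemma subst_up_lift: "subst (up s) (lift e) = lift (subst s e)"
  by (simp add: subst_norm)

lemma inst_lift [simp]: "inst 0 a (lift e) = e"
  by (simp add: inst_def subst_norm)

lemma subst_inst0: "subst s (inst 0 a C) = inst 0 (subst s a) (subst (up s) C)"
  unfolding inst_def subst_norm
  by (rule subst_ext_Suc) (auto simp: subst_norm)

lemma lookup_Cons [simp]:
  "lookup (A # \<Gamma>) 0 = lift A" "lookup (A # \<Gamma>) (Suc n) = lift (lookup \<Gamma> n)"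
  by (simp_all add: lookup_def rename_rename)

section \<open>Weakening, substitution and presuppositions\<close>
lemma ctxt_ConsD: "T \<rhd> A # \<Gamma> \<turnstile> Ctxt \<Longrightarrow> T \<rhd> \<Gamma> \<turnstile> A Type"
  by (cases rule: is_ctxt.cases) auto

lemma CC_ML_le:
  assumes "T = CC_ML"
  shows "T \<rhd> \<Gamma> \<turnstile> Ctxt \<Longrightarrow> T' \<rhd> \<Gamma> \<turnstile> Ctxt"
    "T \<rhd> \<Gamma> \<turnstile> A Type \<Longrightarrow> T' \<rhd> \<Gamma> \<turnstile> A Type"
    "T \<rhd> \<Gamma> \<turnstile> A \<approx> B Type \<Longrightarrow> T' \<rhd> \<Gamma> \<turnstile> A \<approx> B Type"
    "T \<rhd> \<Gamma> \<turnstile> a \<Colon> A \<Longrightarrow> T' \<rhd> \<Gamma> \<turnstile> a \<Colon> A"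
    "T \<rhd> \<Gamma> \<turnstile> a \<approx> b \<Colon> A \<Longrightarrow> T' \<rhd> \<Gamma> \<turnstile> a \<approx> b \<Colon> A"
proof (induction rule: is_ctxt_is_type_type_eq_has_type_term_eq.inducts)
  case (lem \<Gamma>)
  with assms show ?case by simp
qed (rule is_ctxt_is_type_type_eq_has_type_term_eq.intros; assumption)+

lemma judgement_ctxt:
  "T \<rhd> \<Gamma> \<turnstile> Ctxt \<Longrightarrow> True"
  "T \<rhd> \<Gamma> \<turnstile> A Type \<Longrightarrow> T \<rhd> \<Gamma> \<turnstile> Ctxt"
  "T \<rhd> \<Gamma> \<turnstile> A \<approx> B Type \<Longrightarrow> T \<rhd> \<Gamma> \<turnstile> Ctxt"
  "T \<rhd> \<Gamma> \<turnstile> a \<Colon> A \<Longrightarrow> T \<rhd> \<Gamma> \<turnstile> Ctxt"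
  "T \<rhd> \<Gamma> \<turnstile> a \<approx> b \<Colon> A \<Longrightarrow> T \<rhd> \<Gamma> \<turnstile> Ctxt"
proof (induction rule: is_ctxt_is_type_type_eq_has_type_term_eq.inducts)
qed (assumption | rule TrueI)+

definition subst_ok :: "theory_name \<Rightarrow> ctxt \<Rightarrow> (nat \<Rightarrow> expr) \<Rightarrow> ctxt \<Rightarrow> bool" where
  "subst_ok T \<Gamma> s \<Delta> \<longleftrightarrow>
     T \<rhd> \<Gamma> \<turnstile> Ctxt \<and> (\<forall>n<length \<Delta>. T \<rhd> \<Gamma> \<turnstile> s n \<Colon> subst s (lookup \<Delta> n))"

lemma subst_ok:
  assumes "subst_ok T \<Gamma> s \<Delta>"
  shows subst_ok_type: "T \<rhd> \<Delta> \<turnstile> A Type \<Longrightarrow> T \<rhd> \<Gamma> \<turnstile> subst s A Type"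
    and subst_ok_type_eq: "T \<rhd> \<Delta> \<turnstile> A \<approx> B Type \<Longrightarrow> T \<rhd> \<Gamma> \<turnstile> subst s A \<approx> subst s B Type"
    and subst_ok_term: "T \<rhd> \<Delta> \<turnstile> a \<Colon> A \<Longrightarrow> T \<rhd> \<Gamma> \<turnstile> subst s a \<Colon> subst s A"
    and subst_ok_term_eq: "T \<rhd> \<Delta> \<turnstile> a \<approx> b \<Colon> A \<Longrightarrow> T \<rhd> \<Gamma> \<turnstile> subst s a \<approx> subst s b \<Colon> subst s A"
  using assms unfolding subst_ok_def
  by (blast intro: ty_subst tyeq_subst tm_subst tmeq_subst)+

definition ren_ok :: "theory_name \<Rightarrow> ctxt \<Rightarrow> (nat \<Rightarrow> nat) \<Rightarrow> ctxt \<Rightarrow> bool" where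
  "ren_ok T \<Gamma> r \<Delta> \<longleftrightarrow>
     T \<rhd> \<Gamma> \<turnstile> Ctxt \<and> (\<forall>n<length \<Delta>. r n < length \<Gamma> \<and> lookup \<Gamma> (r n) = rename r (lookup \<Delta> n))"

lemma ren_ok_subst: "ren_ok T \<Gamma> r \<Delta> \<Longrightarrow> subst_ok T \<Gamma> (\<lambda>n. Var (r n)) \<Delta>"
  unfolding ren_ok_def subst_ok_def by (metis var rename_subst)

lemma rename_ok:
  assumes "ren_ok T \<Gamma> r \<Delta>"
  shows rename_ok_type: "T \<rhd> \<Delta> \<turnstile> A Type \<Longrightarrow> T \<rhd> \<Gamma> \<turnstile> rename r A Type"
    and rename_ok_type_eq: "T \<rhd> \<Delta> \<turnstile> A \<approx> B Type \<Longrightarrow> T \<rhd> \<Gamma> \<turnstile> rename r A \<approx> rename r B Type"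
    and rename_ok_term: "T \<rhd> \<Delta> \<turnstile> a \<Colon> A \<Longrightarrow> T \<rhd> \<Gamma> \<turnstile> rename r a \<Colon> rename r A"
    and rename_ok_term_eq: "T \<rhd> \<Delta> \<turnstile> a \<approx> b \<Colon> A \<Longrightarrow> T \<rhd> \<Gamma> \<turnstile> rename r a \<approx> rename r b \<Colon> rename r A"
  using subst_ok[OF ren_ok_subst[OF assms]] by (simp_all add: rename_subst)

lemma ren_ok_Suc: "T \<rhd> A # \<Gamma> \<turnstile> Ctxt \<Longrightarrow> ren_ok T (A # \<Gamma>) Suc \<Gamma>"
  by (simp add: ren_ok_def)

lemmas lift_ok = rename_ok[OF ren_ok_Suc]

lemma ren_ok_shift:
  assumes "T \<rhd> \<Xi> \<turnstile> Ctxt" "drop k \<Xi> = \<Gamma>"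
  shows "ren_ok T \<Xi> (\<lambda>n. n + k) \<Gamma>"
proof -
  have "lookup \<Xi> (n + k) = rename (\<lambda>n. n + k) (lookup \<Gamma> n)" if "n + k < length \<Xi>" for n
    using that assms(2) by (auto simp: lookup_def rename_rename add_ac)
  then show ?thesis using assms by (auto simp: ren_ok_def)
qed

lemma ren_ok_up:
  assumes "ren_ok T \<Gamma> r \<Delta>" "T \<rhd> rename r A # \<Gamma> \<turnstile> Ctxt"
  shows "ren_ok T (rename r A # \<Gamma>) (up_ren r) (A # \<Delta>)"
  using assms unfolding ren_ok_def
  by (auto simp: less_Suc_eq_0_disj rename_rename)

lemma subst_ok_scons:
  assumes "subst_ok T \<Gamma> s \<Delta>" "T \<rhd> \<Gamma> \<turnstile> a \<Colon> subst s A"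
  shows "subst_ok T \<Gamma> (a \<cdot> s) (A # \<Delta>)"
  using assms by (auto simp: subst_ok_def less_Suc_eq_0_disj subst_rename)

lemma subst_ok_id: "T \<rhd> \<Gamma> \<turnstile> Ctxt \<Longrightarrow> subst_ok T \<Gamma> Var \<Gamma>"
  by (simp add: subst_ok_def var)

lemma subst_ok_inst: "T \<rhd> \<Gamma> \<turnstile> a \<Colon> A \<Longrightarrow> subst_ok T \<Gamma> (a \<cdot> Var) (A # \<Gamma>)"
  by (rule subst_ok_scons) (auto intro: subst_ok_id judgement_ctxt(4))

lemma inst0: "inst 0 a = subst (a \<cdot> Var)"
  by (simp add: inst_def fun_eq_iff)

lemma inst_ok:
  assumes "T \<rhd> \<Gamma> \<turnstile> a \<Colon> A"
  shows inst_ok_type: "T \<rhd> A # \<Gamma> \<turnstile> B Type \<Longrightarrow> T \<rhd> \<Gamma> \<turnstile> inst 0 a B Type"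
    and inst_ok_term: "T \<rhd> A # \<Gamma> \<turnstile> b \<Colon> B \<Longrightarrow> T \<rhd> \<Gamma> \<turnstile> inst 0 a b \<Colon> inst 0 a B"
  using subst_ok[OF subst_ok_inst[OF assms]] by (simp_all add: inst0)

lemma subst_eq_ok_type:
  assumes "subst_ok T \<Gamma> s \<Delta>" "subst_ok T \<Gamma> t \<Delta>"
    and "\<And>n. n < length \<Delta> \<Longrightarrow> T \<rhd> \<Gamma> \<turnstile> s n \<approx> t n \<Colon> subst s (lookup \<Delta> n)"
    and "T \<rhd> \<Delta> \<turnstile> A Type"
  shows "T \<rhd> \<Gamma> \<turnstile> subst s A \<approx> subst t A Type"
  using assms unfolding subst_ok_def by (blast intro: ty_subst_eq)

lemma subst_eq_ok_term:
  assumes "subst_ok T \<Gamma> s \<Delta>" "subst_ok T \<Gamma> t \<Delta>"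
    and "\<And>n. n < length \<Delta> \<Longrightarrow> T \<rhd> \<Gamma> \<turnstile> s n \<approx> t n \<Colon> subst s (lookup \<Delta> n)"
    and "T \<rhd> \<Delta> \<turnstile> a \<Colon> A"
  shows "T \<rhd> \<Gamma> \<turnstile> subst s a \<approx> subst t a \<Colon> subst s A"
  using assms unfolding subst_ok_def by (blast intro: tm_subst_eq)

lemma inst_eq_ok_type:
  assumes "T \<rhd> \<Gamma> \<turnstile> a \<approx> a' \<Colon> A" "T \<rhd> \<Gamma> \<turnstile> a \<Colon> A" "T \<rhd> \<Gamma> \<turnstile> a' \<Colon> A" "T \<rhd> A # \<Gamma> \<turnstile> B Type"
  shows "T \<rhd> \<Gamma> \<turnstile> inst 0 a B \<approx> inst 0 a' B Type"
  unfolding inst0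
  by (rule subst_eq_ok_type[OF subst_ok_inst subst_ok_inst])
    (use assms in \<open>auto simp: less_Suc_eq_0_disj subst_norm intro: tmeq_refl intro!: var judgement_ctxt(4)[OF assms(2)]\<close>)

text \<open>
  Replacing the last declaration of a context by an equal type is a substitution by the
  identity.
\<close>
lemma ctxt_conv_ok:
  assumes "T \<rhd> \<Gamma> \<turnstile> A \<approx> A' Type" "T \<rhd> \<Gamma> \<turnstile> A' Type"
  shows "subst_ok T (A' # \<Gamma>) Var (A # \<Gamma>)"
proof -
  have c: "T \<rhd> A' # \<Gamma> \<turnstile> Ctxt" using assms(2) by (rule ctxt_ext)
  have "T \<rhd> A' # \<Gamma> \<turnstile> Var 0 \<Colon> lift A"
    using tm_conv[OF var[OF c, of 0], of "lift A"] tyeq_sym[OF lift_ok(2)[OF c assms(1)]] by simp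
  moreover have "T \<rhd> A' # \<Gamma> \<turnstile> Var (Suc n) \<Colon> lift (lookup \<Gamma> n)" if "n < length \<Gamma>" for n
    using var[OF c, of "Suc n"] that by simp
  ultimately show ?thesis using c by (auto simp: subst_ok_def less_Suc_eq_0_disj)
qed

lemma ctxt_conv:
  assumes "T \<rhd> \<Gamma> \<turnstile> A \<approx> A' Type" "T \<rhd> \<Gamma> \<turnstile> A' Type"
  shows ctxt_conv_type: "T \<rhd> A # \<Gamma> \<turnstile> B Type \<Longrightarrow> T \<rhd> A' # \<Gamma> \<turnstile> B Type"
    and ctxt_conv_term: "T \<rhd> A # \<Gamma> \<turnstile> b \<Colon> B \<Longrightarrow> T \<rhd> A' # \<Gamma> \<turnstile> b \<Colon> B"
    and ctxt_conv_term_eq: "T \<rhd> A # \<Gamma> \<turnstile> b \<approx> b' \<Colon> B \<Longrightarrow> T \<rhd> A' # \<Gamma> \<turnstile> b \<approx> b' \<Colon> B"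
  using subst_ok[OF ctxt_conv_ok[OF assms]] by simp_all

lemma lookup_type:
  "T \<rhd> \<Gamma> \<turnstile> Ctxt \<Longrightarrow> n < length \<Gamma> \<Longrightarrow> T \<rhd> \<Gamma> \<turnstile> lookup \<Gamma> n Type"
proof (induction \<Gamma> arbitrary: n)
  case (Cons A \<Gamma>)
  have A: "T \<rhd> \<Gamma> \<turnstile> A Type" using Cons.prems(1) by (rule ctxt_ConsD)
  have "T \<rhd> A # \<Gamma> \<turnstile> lookup (A # \<Gamma>) n Type"
  proof (cases n)
    case 0
    then show ?thesis using lift_ok(1)[OF Cons.prems(1) A] by simp
  next
    case (Suc m)
    then have "T \<rhd> \<Gamma> \<turnstile> lookup \<Gamma> m Type"
      using Cons judgement_ctxt(2)[OF A] by simp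
    then show ?thesis using lift_ok(1)[OF Cons.prems(1)] Suc by simp
  qed
  then show ?case .
qed simp

lemma Bot_Prp: "T \<rhd> \<Gamma> \<turnstile> Ctxt \<Longrightarrow> T \<rhd> \<Gamma> \<turnstile> Bot \<Colon> Prp"
  unfolding Bot_def
  by (metis All_form Prp_form ctxt_ext length_Cons lookup_Cons(1) rename.simps(2) var zero_less_Suc)

lemma Imp_type: "T \<rhd> \<Gamma> \<turnstile> A Type \<Longrightarrow> T \<rhd> \<Gamma> \<turnstile> B Type \<Longrightarrow> T \<rhd> \<Gamma> \<turnstile> Imp A B Type"
  unfolding Imp_def by (metis Pi_form ctxt_ext lift_ok(1))

lemma Imp_Prp: "T \<rhd> \<Gamma> \<turnstile> A Type \<Longrightarrow> T \<rhd> \<Gamma> \<turnstile> Q \<Colon> Prp \<Longrightarrow> T \<rhd> \<Gamma> \<turnstile> Imp A Q \<Colon> Prp"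
  unfolding Imp_def using All_form lift_ok(3)[OF ctxt_ext, of T \<Gamma> A Q Prp] by simp

lemma Neg_Prp: "T \<rhd> \<Gamma> \<turnstile> A Type \<Longrightarrow> T \<rhd> \<Gamma> \<turnstile> Neg A \<Colon> Prp"
  unfolding Neg_def by (intro Imp_Prp Bot_Prp judgement_ctxt(2))

lemma Disj_Prp:
  assumes "T \<rhd> \<Gamma> \<turnstile> P \<Colon> Prp" "T \<rhd> \<Gamma> \<turnstile> Q \<Colon> Prp"
  shows "T \<rhd> \<Gamma> \<turnstile> Disj P Q \<Colon> Prp"
proof -
  have c: "T \<rhd> Prp # \<Gamma> \<turnstile> Ctxt"
    using assms(1) by (intro ctxt_ext Prp_form judgement_ctxt(4))
  have "T \<rhd> Prp # \<Gamma> \<turnstile> Var 0 \<Colon> Prp" using var[OF c, of 0] by simp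
  moreover have "T \<rhd> Prp # \<Gamma> \<turnstile> lift P \<Colon> Prp" "T \<rhd> Prp # \<Gamma> \<turnstile> lift Q \<Colon> Prp"
    using lift_ok(3)[OF c] assms by fastforce+
  ultimately show ?thesis
    unfolding Disj_def using assms(1)
    by (intro All_form Imp_Prp Prp_type Prp_form judgement_ctxt(4))
qed

lemma LEM_type: 
  assumes "T \<rhd> \<Gamma> \<turnstile> Ctxt"
  shows "T \<rhd> \<Gamma> \<turnstile> LEM Type"
proof -
  have c: "T \<rhd> Prp # \<Gamma> \<turnstile> Ctxt"
    using assms(1) by (intro ctxt_ext Prp_form)
  have "T \<rhd> Prp # \<Gamma> \<turnstile> Var 0 \<Colon> Prp" using var[OF c, of 0] by simp
  then show ?thesis unfolding LEM_def using assms
    by (intro Prp_type[of _ _ "Pi _ _"] All_form Prp_form Disj_Prp Neg_Prp Prp_type)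
qed

text \<open>
  In the congruence rules for dependent constructors the right-hand side is first typed by an
  instance of the motive at the right-hand argument, which the rules for substitution of equals
  convert to the instance at the left-hand argument. That the parameters of sums and lists
  are types is, in the computation rules, read off from the contexts of the premises.
\<close>
lemma presuppositions:
  "T \<rhd> \<Gamma> \<turnstile> Ctxt \<Longrightarrow> True"
  "T \<rhd> \<Gamma> \<turnstile> A Type \<Longrightarrow> True"
  "T \<rhd> \<Gamma> \<turnstile> A \<approx> B Type \<Longrightarrow> T \<rhd> \<Gamma> \<turnstile> A Type \<and> T \<rhd> \<Gamma> \<turnstile> B Type"
  "T \<rhd> \<Gamma> \<turnstile> a \<Colon> A \<Longrightarrow> T \<rhd> \<Gamma> \<turnstile> A Type"
  "T \<rhd> \<Gamma> \<turnstile> a \<approx> b \<Colon> A \<Longrightarrow> T \<rhd> \<Gamma> \<turnstile> A Type \<and> T \<rhd> \<Gamma> \<turnstile> a \<Colon> A \<and> T \<rhd> \<Gamma> \<turnstile> b \<Colon> A"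
proof (induction rule: is_ctxt_is_type_type_eq_has_type_term_eq.inducts)
  case (var \<Gamma> n)
  then show ?case by (auto intro: lookup_type)
next
  case (tyeq_subst \<Gamma> \<Delta> s A B)
  then show ?case by (blast intro: ty_subst)
next
  case (tm_subst \<Gamma> \<Delta> s A B)
  then show ?case by (blast intro: ty_subst)
next
  case (tmeq_subst \<Gamma> \<Delta> s A B)
  then show ?case by (blast intro: ty_subst tm_subst)
next
  case (ty_subst_eq \<Gamma> \<Delta> s t A)
  then show ?case by (blast intro: ty_subst)
next
  case (tm_subst_eq \<Gamma> \<Delta> s t a A)
  have "T \<rhd> \<Gamma> \<turnstile> subst s A \<approx> subst t A Type"
    using tm_subst_eq by (blast intro: is_ctxt_is_type_type_eq_has_type_term_eq.ty_subst_eq)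
  moreover have "T \<rhd> \<Gamma> \<turnstile> subst s A Type" "T \<rhd> \<Gamma> \<turnstile> subst s a \<Colon> subst s A"
      "T \<rhd> \<Gamma> \<turnstile> subst t a \<Colon> subst t A"
    using tm_subst_eq by (blast intro: ty_subst tm_subst)+
  ultimately show ?case by (blast intro: tyeq_sym tm_conv)
next
  case (Pi_form_eq \<Gamma> A A' B B')
  then show ?case by (blast intro: Pi_form ctxt_conv_type)
next
  case (All_form_eq \<Gamma> A A' P P')
  then show ?case by (blast intro: All_form ctxt_conv_term Prp_form judgement_ctxt(2))
next
  case (Pi_intro_eq \<Gamma> A A' b b' B)
  then have "T \<rhd> \<Gamma> \<turnstile> Pi A' B \<approx> Pi A B Type" 
    by (meson Pi_form_eq tyeq_refl tyeq_sym)
  then show ?case using Pi_intro_eq by (blast intro: Pi_intro Pi_form ctxt_conv_term tm_conv)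
next
  case (Pi_elim_eq \<Gamma> A B f f' a a')
  then show ?case
    by (meson inst_eq_ok_type inst_ok_type Pi_elim tyeq_sym tm_conv)
next
  case (N0_elim_eq \<Gamma> C d d')
  then show ?case by (meson inst_eq_ok_type inst_ok_type N0_elim tyeq_sym tm_conv)
next
  case (N1_elim_eq \<Gamma> C d d' m m')
  then show ?case by (meson inst_eq_ok_type inst_ok_type N1_elim tyeq_sym tm_conv)
next
  case (N1_beta \<Gamma> C m)
  then show ?case by (meson N1_elim N1_intro judgement_ctxt)
next
  case (Plus_elim_eq A B \<Gamma> C d d' m m' n n')
  then show ?case by (meson inst_eq_ok_type inst_ok_type Plus_elim tyeq_sym tm_conv)
next
  case (Plus_beta_InL A B \<Gamma> C a m n)
  then have A: "T \<rhd> \<Gamma> \<turnstile> A Type" "T \<rhd> \<Gamma> \<turnstile> B Type" by (meson ctxt_ConsD judgement_ctxt)+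
  have *: "inst 0 a (inst 1 (InL (Var 0)) C) = inst 0 (InL a) C"
    unfolding inst_def subst_norm
    by (rule subst_ext_Suc) (auto simp: subst_norm)
  show ?case using Plus_beta_InL A inst_ok_term[of T \<Gamma> a A m]
    by (metis inst_ok_type InL_intro Plus_elim *)
next
  case (Plus_beta_InR A B \<Gamma> C a m n)
  then have A: "T \<rhd> \<Gamma> \<turnstile> A Type" "T \<rhd> \<Gamma> \<turnstile> B Type" by (meson ctxt_ConsD judgement_ctxt)+
  have *: "inst 0 a (inst 1 (InR (Var 0)) C) = inst 0 (InR a) C"
    unfolding inst_def subst_norm
    by (rule subst_ext_Suc) (auto simp: subst_norm)
  show ?case using Plus_beta_InR A inst_ok_term[of T \<Gamma> a B n]
    by (metis inst_ok_type InR_intro Plus_elim *)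
next
  case (List_elim_eq A \<Gamma> C l l' m m' n n')
  then show ?case by (meson inst_eq_ok_type inst_ok_type List_elim tyeq_sym tm_conv)
next
  case (List_beta_Eps A \<Gamma> C m n)
  then have A: "T \<rhd> \<Gamma> \<turnstile> A Type" by (meson ctxt_ConsD judgement_ctxt)
  show ?case using List_beta_Eps A by (meson inst_ok_type Eps_intro List_elim)
next
  case (List_beta_Cons A \<Gamma> C a l m n)
  then have A: "T \<rhd> \<Gamma> \<turnstile> A Type" by (meson ctxt_ConsD judgement_ctxt)
  have hyps: "T \<rhd> ListT A # \<Gamma> \<turnstile> C Type" "T \<rhd> \<Gamma> \<turnstile> a \<Colon> A" "T \<rhd> \<Gamma> \<turnstile> l \<Colon> ListT A"
    "T \<rhd> \<Gamma> \<turnstile> m \<Colon> inst 0 Eps C" "T \<rhd> inst 2 (Var 0) C # ListT (lift A) # A # \<Gamma> \<turnstile>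
       n \<Colon> inst 3 (ConsT (Var 2) (Var 1)) C"
    using List_beta_Cons by simp_all
  note al = Cons_intro[OF A hyps(2,3)]
  have e: "T \<rhd> \<Gamma> \<turnstile> ElList l m n \<Colon> inst 0 l C"
    using List_beta_Cons by (blast intro: List_elim)
  have s2: "subst (l \<cdot> a \<cdot> Var) (inst 2 (Var 0) C) = inst 0 l C"
    unfolding inst_def subst_norm
    by (rule subst_ext_Suc) (auto simp: subst_norm)
  have s3: "subst (ElList l m n \<cdot> l \<cdot> a \<cdot> Var) (inst 3 (ConsT (Var 2) (Var 1)) C) = inst 0 (ConsT a l) C"
    unfolding inst_def subst_norm
    by (rule subst_ext_Suc) (auto simp: subst_norm numeral_2_eq_2 numeral_3_eq_3)
  have "subst_ok T \<Gamma> (ElList l m n \<cdot> l \<cdot> a \<cdot> Var) (inst 2 (Var 0) C # ListT (lift A) # A # \<Gamma>)"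
    by (intro subst_ok_scons subst_ok_id)
      (use List_beta_Cons e A in \<open>auto simp: s2 subst_norm intro: judgement_ctxt(2)\<close>)
  from subst_ok_term[OF this hyps(5)] show ?case unfolding s3
    using List_elim[OF hyps(1) al] hyps inst_ok_type al by blast
next
  case (Sig_elim_eq A B \<Gamma> C d d' m m')
  then show ?case by (meson inst_eq_ok_type inst_ok_type Sig_elim tyeq_sym tm_conv)
next
  case (Sig_beta A B \<Gamma> C a b m)
  then have B: "T \<rhd> A # \<Gamma> \<turnstile> B Type" by (meson ctxt_ConsD judgement_ctxt)
  then have A: "T \<rhd> \<Gamma> \<turnstile> A Type" by (meson ctxt_ConsD judgement_ctxt)
  have hyps: "T \<rhd> Sig A B # \<Gamma> \<turnstile> C Type" "T \<rhd> \<Gamma> \<turnstile> a \<Colon> A" "T \<rhd> \<Gamma> \<turnstile> b \<Colon> inst 0 a B"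
    "T \<rhd> B # A # \<Gamma> \<turnstile> m \<Colon> inst 2 (PairT (Var 1) (Var 0)) C"
    using Sig_beta by simp_all
  note p = Sig_intro[OF A B hyps(2,3)]
  have s3: "subst (b \<cdot> a \<cdot> Var) (inst 2 (PairT (Var 1) (Var 0)) C) = inst 0 (PairT a b) C"
    unfolding inst_def subst_norm
    by (rule subst_ext_Suc) (auto simp: subst_norm numeral_2_eq_2)
  have "subst_ok T \<Gamma> (b \<cdot> a \<cdot> Var) (B # A # \<Gamma>)"
    by (intro subst_ok_scons subst_ok_id)
      (use Sig_beta A in \<open>auto simp: subst_norm inst0 intro: judgement_ctxt(2)\<close>)
  from subst_ok_term[OF this hyps(4)] show ?case unfolding s3
    using Sig_elim[OF hyps(1) p] hyps inst_ok_type p by blast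
next
  case (Sig_intro_eq \<Gamma> A B a a' b b')
  then have "T \<rhd> \<Gamma> \<turnstile> b' \<Colon> inst 0 a' B" by (meson inst_eq_ok_type tm_conv)
  with Sig_intro_eq show ?case by (meson Sig_form Sig_intro)
next
  case (Sig_form_eq \<Gamma> A A' B B')
  then show ?case by (blast intro: Sig_form ctxt_conv_type)
next
  case (Pi_beta \<Gamma> A b B a)
  then show ?case by (blast intro: Pi_elim Pi_intro inst_ok_term inst_ok_type)
next
  case (lem \<Gamma>)
  then show ?case by (blast intro: LEM_type)
qed (blast intro: inst_ok_type Prp_form Prp_type N0_form N1_form N1_intro N0_elim Plus_form InL_intro
   InR_intro List_form Eps_intro Cons_intro Pi_form Sig_form judgement_ctxt(2,4) tm_conv)+

section \<open>Stable propositions\<close>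
lemma Imp_subst [simp]: "subst s (Imp P Q) = Imp (subst s P) (subst s Q)"
  by (simp add: Imp_def subst_up_lift)

lemma Bot_subst [simp]: "subst s Bot = Bot"
  by (simp add: Bot_def)

lemma Neg_subst [simp]: "subst s (Neg P) = Neg (subst s P)"
  by (simp add: Neg_def)

lemma Connectives_rename [simp]:
  "rename r (Imp P Q) = Imp (rename r P) (rename r Q)"
  "rename r Bot = Bot" "rename r (Neg P) = Neg (rename r P)"
  by (simp_all add: rename_subst)

definition Stab :: "expr \<Rightarrow> expr" where
  "Stab P = Imp (Neg (Neg P)) P"

definition SProp :: expr where
  "SProp = Sig Prp (Stab (Var 0))"

definition proj1 :: "expr \<Rightarrow> expr" where
  "proj1 d = ElSig d (Var 1)"

definition proj2 :: "expr \<Rightarrow> expr" where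
  "proj2 d = ElSig d (Var 0)"

lemma Stab_subst [simp]: "subst s (Stab P) = Stab (subst s P)"
  by (simp add: Stab_def)

lemma SProp_subst [simp]: "subst s SProp = SProp"
  by (simp add: SProp_def)

lemma proj_subst [simp]: "subst s (proj1 d) = proj1 (subst s d)" "subst s (proj2 d) = proj2 (subst s d)"
  by (simp_all add: proj1_def proj2_def)

lemma SProp_rename [simp]:
  "rename r (Stab P) = Stab (rename r P)" "rename r SProp = SProp"
  "rename r (proj1 d) = proj1 (rename r d)" "rename r (proj2 d) = proj2 (rename r d)"
  by (simp_all add: rename_subst)

lemma inst_simps [simp]:
  "inst k a (Imp P Q) = Imp (inst k a P) (inst k a Q)" "inst k a (Neg P) = Neg (inst k a P)"
  "inst k a Bot = Bot" "inst k a (Stab P) = Stab (inst k a P)" "inst k a SProp = SProp"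
  "inst k a (proj1 d) = proj1 (inst k a d)" "inst k a (proj2 d) = proj2 (inst k a d)"
  "inst k a Prp = Prp" "inst k a (Var 0) = a"
  by (simp_all add: inst_def)

lemma type_eq_presup:
  assumes "T \<rhd> \<Gamma> \<turnstile> A \<approx> B Type"
  shows type_left: "T \<rhd> \<Gamma> \<turnstile> A Type" and type_right: "T \<rhd> \<Gamma> \<turnstile> B Type"
  using presuppositions(3)[OF assms] by auto

lemma term_eq_presup:
  assumes "T \<rhd> \<Gamma> \<turnstile> a \<approx> b \<Colon> A"
  shows tm_left: "T \<rhd> \<Gamma> \<turnstile> a \<Colon> A"
    and tm_type: "T \<rhd> \<Gamma> \<turnstile> A Type"
  using presuppositions(5)[OF assms] by auto

lemma Imp_intro_eq:
  "T \<rhd> \<Gamma> \<turnstile> P \<approx> P' Type \<Longrightarrow> T \<rhd> P # \<Gamma> \<turnstile> b \<approx> b' \<Colon> lift Q \<Longrightarrow>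
   T \<rhd> \<Gamma> \<turnstile> Lam P b \<approx> Lam P' b' \<Colon> Imp P Q"
  unfolding Imp_def by (rule Pi_intro_eq)

lemma Imp_elim_eq:
  assumes "T \<rhd> \<Gamma> \<turnstile> f \<approx> f' \<Colon> Imp P Q" "T \<rhd> \<Gamma> \<turnstile> a \<approx> a' \<Colon> P" "T \<rhd> \<Gamma> \<turnstile> Q Type"
  shows "T \<rhd> \<Gamma> \<turnstile> App f a \<approx> App f' a' \<Colon> Q"
proof -
  have P: "T \<rhd> \<Gamma> \<turnstile> P Type" using assms(2) by (rule tm_type)
  have "T \<rhd> P # \<Gamma> \<turnstile> lift Q Type" using lift_ok(1)[OF ctxt_ext[OF P] assms(3)] .
  from Pi_elim_eq[OF P this _ assms(2)] assms(1) show ?thesis by (simp add: Imp_def)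
qed

lemma Imp_elim:
  "T \<rhd> \<Gamma> \<turnstile> f \<Colon> Imp P Q \<Longrightarrow> T \<rhd> \<Gamma> \<turnstile> a \<Colon> P \<Longrightarrow> T \<rhd> \<Gamma> \<turnstile> Q Type \<Longrightarrow> T \<rhd> \<Gamma> \<turnstile> App f a \<Colon> Q"
  by (meson Imp_elim_eq tmeq_refl tm_left)

lemma Imp_intro: "T \<rhd> \<Gamma> \<turnstile> P Type \<Longrightarrow> T \<rhd> P # \<Gamma> \<turnstile> b \<Colon> lift Q \<Longrightarrow> T \<rhd> \<Gamma> \<turnstile> Lam P b \<Colon> Imp P Q"
  unfolding Imp_def by (rule Pi_intro)

lemma Imp_eq:
  "T \<rhd> \<Gamma> \<turnstile> P \<approx> P' Type \<Longrightarrow> T \<rhd> \<Gamma> \<turnstile> Q \<approx> Q' \<Colon> Prp \<Longrightarrow> T \<rhd> \<Gamma> \<turnstile> Imp P Q \<approx> Imp P' Q' \<Colon> Prp"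
  unfolding Imp_def using All_form_eq lift_ok(4)[OF ctxt_ext[OF type_left], of T \<Gamma> P P' Q Q' Prp] by simp

lemma Neg_eq: "T \<rhd> \<Gamma> \<turnstile> P \<approx> P' Type \<Longrightarrow> T \<rhd> \<Gamma> \<turnstile> Neg P \<approx> Neg P' \<Colon> Prp"
  unfolding Neg_def by (intro Imp_eq tmeq_refl Bot_Prp judgement_ctxt(3))

lemma Neg_intro_eq:
  "T \<rhd> \<Gamma> \<turnstile> P \<approx> P' Type \<Longrightarrow> T \<rhd> P # \<Gamma> \<turnstile> b \<approx> b' \<Colon> Bot \<Longrightarrow>
   T \<rhd> \<Gamma> \<turnstile> Lam P b \<approx> Lam P' b' \<Colon> Neg P"
  unfolding Neg_def by (rule Imp_intro_eq) simp_all

lemma Neg_elim_eq: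
  "T \<rhd> \<Gamma> \<turnstile> f \<approx> f' \<Colon> Neg P \<Longrightarrow> T \<rhd> \<Gamma> \<turnstile> a \<approx> a' \<Colon> P \<Longrightarrow>
   T \<rhd> \<Gamma> \<turnstile> App f a \<approx> App f' a' \<Colon> Bot"
  unfolding Neg_def by (rule Imp_elim_eq) (auto intro: Prp_type Bot_Prp judgement_ctxt)

lemma Neg_intro: "T \<rhd> \<Gamma> \<turnstile> P Type \<Longrightarrow> T \<rhd> P # \<Gamma> \<turnstile> b \<Colon> Bot \<Longrightarrow> T \<rhd> \<Gamma> \<turnstile> Lam P b \<Colon> Neg P"
  by (meson Neg_intro_eq tyeq_refl tmeq_refl tm_left)

lemma Neg_elim: "T \<rhd> \<Gamma> \<turnstile> f \<Colon> Neg P \<Longrightarrow> T \<rhd> \<Gamma> \<turnstile> a \<Colon> P \<Longrightarrow> T \<rhd> \<Gamma> \<turnstile> App f a \<Colon> Bot"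
  by (meson Neg_elim_eq tmeq_refl tm_left)

lemma Stab_eq: "T \<rhd> \<Gamma> \<turnstile> P \<approx> P' \<Colon> Prp \<Longrightarrow> T \<rhd> \<Gamma> \<turnstile> Stab P \<approx> Stab P' \<Colon> Prp"
  unfolding Stab_def by (intro Imp_eq Prp_type_eq Neg_eq)

lemma Stab_Prp: "T \<rhd> \<Gamma> \<turnstile> P \<Colon> Prp \<Longrightarrow> T \<rhd> \<Gamma> \<turnstile> Stab P \<Colon> Prp"
  unfolding Stab_def by (intro Imp_Prp Prp_type Neg_Prp)

lemma Stab_Var0: "T \<rhd> \<Gamma> \<turnstile> Ctxt \<Longrightarrow> T \<rhd> Prp # \<Gamma> \<turnstile> Stab (Var 0) Type"
  using var[OF ctxt_ext[OF Prp_form], of T \<Gamma> 0] by (auto intro: Stab_Prp Prp_type)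

lemma SProp_type: "T \<rhd> \<Gamma> \<turnstile> Ctxt \<Longrightarrow> T \<rhd> \<Gamma> \<turnstile> SProp Type"
  unfolding SProp_def by (intro Sig_form Prp_form Stab_Var0)

lemma SProp_pair_eq:
  assumes "T \<rhd> \<Gamma> \<turnstile> P \<approx> P' \<Colon> Prp" "T \<rhd> \<Gamma> \<turnstile> b \<approx> b' \<Colon> Stab P"
  shows "T \<rhd> \<Gamma> \<turnstile> PairT P b \<approx> PairT P' b' \<Colon> SProp"
  using assms judgement_ctxt(5)[OF assms(1)] unfolding SProp_def
  by (intro Sig_intro_eq) (auto intro: Prp_form Stab_Var0)

lemma SProp_ctxt:
  assumes "T \<rhd> \<Gamma> \<turnstile> Ctxt"
  shows "T \<rhd> Stab (Var 0) # Prp # \<Gamma> \<turnstile> Ctxt" "T \<rhd> Prp # \<Gamma> \<turnstile> Ctxt" "T \<rhd> SProp # \<Gamma> \<turnstile> Ctxt"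
  using assms by (auto intro: ctxt_ext Prp_form Stab_Var0 SProp_type)

lemma proj1_var:
  "T \<rhd> \<Gamma> \<turnstile> Ctxt \<Longrightarrow> T \<rhd> Stab (Var 0) # Prp # \<Gamma> \<turnstile> Var 1 \<Colon> Prp"
  using var[OF SProp_ctxt(1), of T \<Gamma> 1] by simp

lemma proj1_eq:
  assumes "T \<rhd> \<Gamma> \<turnstile> d \<approx> d' \<Colon> SProp"
  shows "T \<rhd> \<Gamma> \<turnstile> proj1 d \<approx> proj1 d' \<Colon> Prp"
proof -
  have c: "T \<rhd> \<Gamma> \<turnstile> Ctxt" using assms by (rule judgement_ctxt)
  show ?thesis
    using Sig_elim_eq[of T Prp "Stab (Var 0)" \<Gamma> Prp d d' "Var 1" "Var 1"] assms c
    by (auto simp: proj1_def SProp_def[symmetric] intro: Prp_form SProp_ctxt tmeq_refl proj1_var[simplified])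
qed

lemma proj1_Prp: "T \<rhd> \<Gamma> \<turnstile> d \<Colon> SProp \<Longrightarrow> T \<rhd> \<Gamma> \<turnstile> proj1 d \<Colon> Prp"
  by (meson proj1_eq tmeq_refl tm_left)

lemma proj1_beta:
  assumes "T \<rhd> \<Gamma> \<turnstile> P \<Colon> Prp" "T \<rhd> \<Gamma> \<turnstile> b \<Colon> Stab P"
  shows "T \<rhd> \<Gamma> \<turnstile> proj1 (PairT P b) \<approx> P \<Colon> Prp"
proof -
  have c: "T \<rhd> \<Gamma> \<turnstile> Ctxt" using assms(1) by (rule judgement_ctxt)
  show ?thesis
    using Sig_beta[of T Prp "Stab (Var 0)" \<Gamma> Prp P b "Var 1"] assms c
    by (auto simp: proj1_def SProp_def[symmetric] intro: Prp_form SProp_ctxt proj1_var[simplified])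
qed

lemma proj2_eq:
  assumes "T \<rhd> \<Gamma> \<turnstile> d \<approx> d' \<Colon> SProp"
  shows "T \<rhd> \<Gamma> \<turnstile> proj2 d \<approx> proj2 d' \<Colon> Stab (proj1 d)"
proof -
  have c: "T \<rhd> \<Gamma> \<turnstile> Ctxt" using assms by (rule judgement_ctxt)
  let ?\<Delta> = "Stab (Var 0) # Prp # \<Gamma>"
  have "T \<rhd> SProp # \<Gamma> \<turnstile> Var 0 \<Colon> SProp"
    using var[OF SProp_ctxt(3)[OF c], of 0] by simp
  then have C: "T \<rhd> SProp # \<Gamma> \<turnstile> Stab (proj1 (Var 0)) Type"
    by (intro Prp_type Stab_Prp proj1_Prp)
  have v: "T \<rhd> ?\<Delta> \<turnstile> Var 0 \<Colon> Stab (Var 1)" "T \<rhd> ?\<Delta> \<turnstile> Var 1 \<Colon> Prp"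
    using var[OF SProp_ctxt(1)[OF c], of 0] var[OF SProp_ctxt(1)[OF c], of 1] by simp_all
  have "T \<rhd> ?\<Delta> \<turnstile> Var 0 \<Colon> Stab (proj1 (PairT (Var 1) (Var 0)))"
    using v by (meson tm_conv Stab_eq proj1_beta tmeq_sym Prp_type_eq)
  then have "T \<rhd> ?\<Delta> \<turnstile> Var 0 \<approx> Var 0 \<Colon> inst 2 (PairT (Var 1) (Var 0)) (Stab (proj1 (Var 0)))"
    by (simp add: tmeq_refl)
  from Sig_elim_eq[OF C[unfolded SProp_def] assms[unfolded SProp_def] this]
  show ?thesis by (simp add: proj2_def)
qed

text \<open>
  The stability proof of a product \<open>Pi A B\<close>, where \<open>B\<close> is the first component of the stable
  proposition \<open>b\<close>: given \<open>h\<close> of type \<open>\<not>\<not>(Pi A B)\<close> and \<open>x\<close> of type \<open>A\<close>, it suffices by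
  stability of \<open>b\<close> to refute every \<open>k\<close> of type \<open>\<not>B x\<close>, and \<open>h (\<lambda>f. k (f x))\<close> does that. The type \<open>B\<close> is a
  separate argument because it is the translation of the body as a type, which is equal to
  \<open>proj1 b\<close> only judgementally.
\<close>
definition stab :: "expr \<Rightarrow> expr \<Rightarrow> expr \<Rightarrow> expr" where
  "stab A B b =
     Lam (Neg (Neg (Pi A B)))
      (Lam (lift A)
        (App (proj2 (rename (up_ren Suc) b))
          (Lam (Neg (rename (up_ren Suc) B))
            (App (Var 2)
              (Lam (rename (\<lambda>n. n + 3) (Pi A B))
                (App (Var 1) (App (Var 0) (Var 2))))))))"

lemma rename_stab: "rename r (stab A B b) = stab (rename r A) (rename (up_ren r) B) (rename (up_ren r) b)"
proof -
  have *: "(\<lambda>x. up_ren (up_ren r) (up_ren Suc x)) = (\<lambda>x. up_ren Suc (up_ren r x))"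
  proof
    show "up_ren (up_ren r) (up_ren Suc x) = up_ren Suc (up_ren r x)" for x by (cases x) auto
  qed
  have **: "(\<lambda>x. up_ren (up_ren (up_ren (up_ren r))) (up_ren (\<lambda>n. n + 3) x))
     = (\<lambda>x. up_ren (\<lambda>n. n + 3) (up_ren r x))"
  proof
    show "up_ren (up_ren (up_ren (up_ren r))) (up_ren (\<lambda>n. n + 3) x) = up_ren (\<lambda>n. n + 3) (up_ren r x)" for x
      by (cases x) (auto simp: numeral_3_eq_3)
  qed
  show ?thesis
    by (simp add: stab_def rename_rename * ** numeral_3_eq_3[symmetric]) (simp add: numeral_2_eq_2 numeral_3_eq_3)
qed

lemma subst_stab: "subst s (stab A B b) = stab (subst s A) (subst (up s) B) (subst (up s) b)"
proof -
  have 1: "subst (up (up s)) (rename (up_ren Suc) C) = rename (up_ren Suc) (subst (up s) C)" for C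
    unfolding subst_norm by (rule subst_ext_Suc) (auto simp: subst_norm)
  have 2: "subst (up (up (up (up s)))) (rename (up_ren (\<lambda>n. Suc (Suc (Suc n)))) C)
      = rename (up_ren (\<lambda>n. Suc (Suc (Suc n)))) (subst (up s) C)" for C
    unfolding subst_norm by (rule subst_ext_Suc) (auto simp: subst_norm)
  have 3: "subst (up (up (up s))) (rename (\<lambda>n. Suc (Suc (Suc n))) C)
      = rename (\<lambda>n. Suc (Suc (Suc n))) (subst s C)" for C
    unfolding subst_norm by (simp add: subst_norm)
  show ?thesis
    by (simp add: stab_def 1 2 3 subst_up_lift numeral_2_eq_2 numeral_3_eq_3)
qed

text \<open>
  Stated as an equation, this gives the typing of the stability proof as the case of equal
  arguments, and the same derivation, with congruence rules in place of the typing rules, also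
  covers the naturality of the translation at products and the translated congruence rule.
\<close>
lemma stab_eq:
  assumes A: "T \<rhd> \<Gamma> \<turnstile> A \<approx> A' Type" and B: "T \<rhd> A # \<Gamma> \<turnstile> B \<approx> B' \<Colon> Prp"
    and b: "T \<rhd> A # \<Gamma> \<turnstile> b \<approx> b' \<Colon> SProp" and Bb: "T \<rhd> A # \<Gamma> \<turnstile> B \<approx> proj1 b \<Colon> Prp"
  shows "T \<rhd> \<Gamma> \<turnstile> stab A B b \<approx> stab A' B' b' \<Colon> Stab (Pi A B)"
proof -
  \<comment> \<open>the contexts after the abstractions over \<open>h\<close>, \<open>x\<close>, \<open>k\<close> and \<open>f\<close>\<close>
  let ?NN = "Neg (Neg (Pi A B))"
  let ?l = "rename (up_ren Suc)" and ?l3 = "rename (\<lambda>n. n + 3)"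
  let ?\<Gamma>1 = "?NN # \<Gamma>"
  let ?\<Gamma>2 = "lift A # ?\<Gamma>1"
  let ?\<Gamma>3 = "Neg (?l B) # ?\<Gamma>2"
  let ?\<Gamma>4 = "?l3 (Pi A B) # ?\<Gamma>3"
  let ?f = "App (Var 1) (App (Var 0) (Var 2))"
  let ?g = "App (Var 2) (Lam (?l3 (Pi A B)) ?f)" and ?g' = "App (Var 2) (Lam (?l3 (Pi A' B')) ?f)"
  let ?h = "Lam (Neg (?l B)) ?g" and ?h' = "Lam (Neg (?l B')) ?g'"
  let ?i = "App (proj2 (?l b)) ?h" and ?i' = "App (proj2 (?l b')) ?h'"
  have Pi: "T \<rhd> \<Gamma> \<turnstile> Pi A B \<approx> Pi A' B' \<Colon> Prp" using A B by (rule All_form_eq)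
  have NN: "T \<rhd> \<Gamma> \<turnstile> ?NN \<approx> Neg (Neg (Pi A' B')) Type"
    using Pi by (intro Prp_type_eq Neg_eq)
  have c1: "T \<rhd> ?\<Gamma>1 \<turnstile> Ctxt" using NN by (intro ctxt_ext type_left)
  have A1: "T \<rhd> ?\<Gamma>1 \<turnstile> lift A \<approx> lift A' Type" using lift_ok(2)[OF c1 A] .
  have c2: "T \<rhd> ?\<Gamma>2 \<turnstile> Ctxt" using A1 by (intro ctxt_ext type_left)
  have r2: "ren_ok T ?\<Gamma>2 (up_ren Suc) (A # \<Gamma>)" using ren_ok_up[OF ren_ok_Suc[OF c1] c2] .
  have B2: "T \<rhd> ?\<Gamma>2 \<turnstile> ?l B \<approx> ?l B' \<Colon> Prp" using rename_ok_term_eq[OF r2 B] by simp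
  have Bb2: "T \<rhd> ?\<Gamma>2 \<turnstile> ?l B \<approx> proj1 (?l b) \<Colon> Prp" using rename_ok_term_eq[OF r2 Bb] by simp
  have b2: "T \<rhd> ?\<Gamma>2 \<turnstile> ?l b \<approx> ?l b' \<Colon> SProp" using rename_ok_term_eq[OF r2 b] by simp
  have NB2: "T \<rhd> ?\<Gamma>2 \<turnstile> Neg (?l B) \<approx> Neg (?l B') Type" using B2 by (intro Prp_type_eq Neg_eq)
  have c3: "T \<rhd> ?\<Gamma>3 \<turnstile> Ctxt" using NB2 by (intro ctxt_ext type_left)
  have r3: "ren_ok T ?\<Gamma>3 (\<lambda>n. n + 3) \<Gamma>" using c3 by (rule ren_ok_shift) (simp add: numeral_3_eq_3)
  have Pi3: "T \<rhd> ?\<Gamma>3 \<turnstile> ?l3 (Pi A B) \<approx> ?l3 (Pi A' B') \<Colon> Prp"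
    using rename_ok_term_eq[OF r3 Pi] by simp
  have c4: "T \<rhd> ?\<Gamma>4 \<turnstile> Ctxt" using Pi3 by (intro ctxt_ext type_left Prp_type_eq)
  let ?A4 = "lift (?l3 A)" and ?B4 = "?l (rename (up_ren (\<lambda>n. n + 3)) B)"
  have r4: "ren_ok T ?\<Gamma>4 (\<lambda>n. n + 4) \<Gamma>" using c4 by (rule ren_ok_shift) (simp add: eval_nat_numeral)
  have A4e: "rename (\<lambda>n. n + 4) A = ?A4" by (simp add: rename_rename numeral_3_eq_3 eval_nat_numeral)
  have A4: "T \<rhd> ?\<Gamma>4 \<turnstile> ?A4 Type" using rename_ok_type[OF r4 type_left[OF A]] by (simp add: A4e)
  have r4': "ren_ok T (?A4 # ?\<Gamma>4) (up_ren (\<lambda>n. n + 4)) (A # \<Gamma>)"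
    using ren_ok_up[OF r4, of A] A4 by (simp add: A4e ctxt_ext)
  have "(\<lambda>x. up_ren Suc (up_ren (\<lambda>n. n + 3) x)) = up_ren (\<lambda>n. n + 4)"
  proof
    show "up_ren Suc (up_ren (\<lambda>n. n + 3) x) = up_ren (\<lambda>n. n + 4) x" for x
      by (cases x) (auto simp: eval_nat_numeral)
  qed
  then have B4: "T \<rhd> ?A4 # ?\<Gamma>4 \<turnstile> ?B4 Type"
    using rename_ok_type[OF r4' Prp_type[OF tm_left[OF B]]] by (simp add: rename_rename)
  have f: "T \<rhd> ?\<Gamma>4 \<turnstile> Var 0 \<Colon> Pi ?A4 ?B4" using var[OF c4, of 0] by simp
  have x: "T \<rhd> ?\<Gamma>4 \<turnstile> Var 2 \<Colon> ?A4"
    using var[OF c4, of 2] by (simp add: rename_rename eval_nat_numeral)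
  have k: "T \<rhd> ?\<Gamma>4 \<turnstile> Var 1 \<Colon> Neg (lift (lift (?l B)))"
    using var[OF c4, of 1] by simp
  have e: "inst 0 (Var 2) ?B4 = lift (lift (?l B))"
    unfolding inst_def subst_norm unfolding rename_subst
    by (rule subst_ext_Suc) (auto simp: eval_nat_numeral)
  have "T \<rhd> ?\<Gamma>4 \<turnstile> App (Var 0) (Var 2) \<Colon> lift (lift (?l B))"
    using Pi_elim[OF A4 B4 f x] by (simp only: e)
  then have "T \<rhd> ?\<Gamma>4 \<turnstile> ?f \<Colon> Bot"
    using k by (blast intro: Neg_elim)
  then have "T \<rhd> ?\<Gamma>3 \<turnstile> Lam (?l3 (Pi A B)) ?f \<approx> Lam (?l3 (Pi A' B')) ?f \<Colon> Neg (?l3 (Pi A B))"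
    using Pi3 by (intro Neg_intro_eq tmeq_refl Prp_type_eq)
  moreover have "lookup (X # Y # Neg (Neg P) # \<Gamma>) 2 = Neg (Neg (?l3 P))" for X Y P
    by (simp add: rename_rename eval_nat_numeral)
  then have "T \<rhd> ?\<Gamma>3 \<turnstile> Var 2 \<Colon> Neg (Neg (?l3 (Pi A B)))"
    using var[OF c3, of 2] by (simp del: rename.simps)
  ultimately have "T \<rhd> ?\<Gamma>3 \<turnstile> ?g \<approx> ?g' \<Colon> Bot"
    by (blast intro: Neg_elim_eq tmeq_refl)
  then have "T \<rhd> ?\<Gamma>2 \<turnstile> ?h \<approx> ?h' \<Colon> Neg (Neg (?l B))"
    using NB2 by (intro Neg_intro_eq)
  moreover have "T \<rhd> ?\<Gamma>2 \<turnstile> proj2 (?l b) \<approx> proj2 (?l b') \<Colon> Stab (?l B)"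
    using proj2_eq[OF b2] Bb2 by (meson tmeq_conv Stab_eq tmeq_sym Prp_type_eq)
  ultimately have "T \<rhd> ?\<Gamma>2 \<turnstile> ?i \<approx> ?i' \<Colon> ?l B"
    using B2 unfolding Stab_def by (blast intro: Imp_elim_eq Prp_type tm_left)
  from Pi_intro_eq[OF A1 this] show ?thesis
    unfolding stab_def Stab_def using NN by (intro Imp_intro_eq) simp_all
qed

section \<open>Excluded middle for stable propositions\<close>
definition BotS :: expr where "BotS = Pi SProp (proj1 (Var 0))"

lemma BotS_closed [simp]: "subst s BotS = BotS" "rename r BotS = BotS"
  by (simp_all add: BotS_def)

lemma BotS_intro: "T \<rhd> SProp # \<Gamma> \<turnstile> b \<Colon> proj1 (Var 0) \<Longrightarrow> T \<rhd> \<Gamma> \<turnstile> Lam SProp b \<Colon> BotS"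
  unfolding BotS_def by (meson Pi_intro ctxt_ConsD judgement_ctxt(4))

lemma BotS_Prp: "T \<rhd> \<Gamma> \<turnstile> Ctxt \<Longrightarrow> T \<rhd> \<Gamma> \<turnstile> BotS \<Colon> Prp"
  unfolding BotS_def using var[OF SProp_ctxt(3), of T \<Gamma> 0]
  by (intro All_form SProp_type proj1_Prp) simp_all

text \<open>
  With \<open>p\<close>, \<open>z\<close> stable, \<open>f\<close> of type \<open>p \<Rightarrow> z\<close> and \<open>g\<close> of type \<open>\<not>p \<Rightarrow> z\<close>, stability of \<open>z\<close> reduces
  the goal \<open>z\<close> to a contradiction from \<open>k\<close> of type \<open>\<not>z\<close>. This is \<open>k (g (\<lambda>x q. k (f x) (proj1 q)))\<close>. The negations in the
  statement are translated, hence use \<open>BotS\<close>, whereas the stability of \<open>z\<close> uses \<open>Bot\<close>; the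
  argument of \<open>g\<close> bridges the two by applying \<open>k (f x)\<close> of type \<open>Bot\<close> to the proposition
  underlying an arbitrary stable \<open>q\<close>.
\<close>
definition em :: expr where
  "em = Lam SProp (Lam SProp
     (Lam (Imp (proj1 (Var 1)) (proj1 (Var 0)))
       (Lam (Imp (Imp (proj1 (Var 2)) BotS) (proj1 (Var 1)))
         (App (proj2 (Var 2))
           (Lam (Neg (proj1 (Var 2)))
             (App (Var 0)
               (App (Var 1)
                 (Lam (proj1 (Var 4))
                   (Lam SProp
                     (App (App (Var 2) (App (Var 4) (Var 1))) (proj1 (Var 0))))))))))))"

text \<open>
  The translation of \<open>LEM\<close> (lemma \<open>ty_LEM\<close>), written out.
\<close>
definition EM :: expr where
  "EM = Pi SProp (Pi SProp
     (Imp (Imp (proj1 (Var 1)) (proj1 (Var 0)))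
       (Imp (Imp (Imp (proj1 (Var 1)) BotS) (proj1 (Var 0))) (proj1 (Var 0)))))"

lemma em_closed [simp]: "subst s em = em"
  by (simp add: em_def eval_nat_numeral)

lemma App_Bot:
  assumes "T \<rhd> \<Gamma> \<turnstile> b \<Colon> Bot" "T \<rhd> \<Gamma> \<turnstile> P \<Colon> Prp"
  shows "T \<rhd> \<Gamma> \<turnstile> App b P \<Colon> P"
proof -
  have c: "T \<rhd> \<Gamma> \<turnstile> Ctxt" using assms(1) by (rule judgement_ctxt)
  have "T \<rhd> Prp # \<Gamma> \<turnstile> Var 0 Type"
    using var[OF SProp_ctxt(2)[OF c], of 0] by (auto intro: Prp_type)
  from Pi_elim[OF Prp_form[OF c] this assms[unfolded Bot_def]] show ?thesis by simp
qed

lemma em_type: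
  assumes c: "T \<rhd> \<Gamma> \<turnstile> Ctxt"
  shows "T \<rhd> \<Gamma> \<turnstile> em \<Colon> EM"
proof -
  let ?F = "Imp (proj1 (Var 1)) (proj1 (Var 0))"
  let ?G = "Imp (Imp (proj1 (Var 2)) BotS) (proj1 (Var 1))"
  let ?\<Gamma>2 = "SProp # SProp # \<Gamma>"
  let ?\<Gamma>4 = "?G # ?F # ?\<Gamma>2"
  let ?\<Gamma>5 = "Neg (proj1 (Var 2)) # ?\<Gamma>4"
  let ?\<Gamma>6 = "proj1 (Var 4) # ?\<Gamma>5"
  let ?\<Gamma>7 = "SProp # ?\<Gamma>6"
  \<comment> \<open>\<open>?efq\<close> proves an arbitrary stable proposition \<open>q\<close> from \<open>p\<close> and the refutation of \<open>z\<close>; \<open>?notp\<close> is the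
    resulting refutation of \<open>p\<close>; \<open>?absurd\<close> feeds it to the second case, against the refutation of
    \<open>z\<close>, and \<open>?body\<close> removes the double negation by stability of \<open>z\<close>\<close>
  let ?efq = "App (App (Var 2) (App (Var 4) (Var 1))) (proj1 (Var 0))"
  let ?notp = "Lam (proj1 (Var 4)) (Lam SProp ?efq)"
  let ?absurd = "App (Var 0) (App (Var 1) ?notp)"
  let ?refute = "Lam (Neg (proj1 (Var 2))) ?absurd"
  let ?body = "App (proj2 (Var 2)) ?refute"
  note nums = eval_nat_numeral
  have S1: "T \<rhd> \<Gamma> \<turnstile> SProp Type" using c by (rule SProp_type)
  have S2: "T \<rhd> SProp # \<Gamma> \<turnstile> SProp Type" using c by (intro SProp_type ctxt_ext)
  have c2: "T \<rhd> ?\<Gamma>2 \<turnstile> Ctxt" using S2 by (rule ctxt_ext)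
  have v2: "T \<rhd> ?\<Gamma>2 \<turnstile> Var 0 \<Colon> SProp" "T \<rhd> ?\<Gamma>2 \<turnstile> Var 1 \<Colon> SProp"
    using var[OF c2, of 0] var[OF c2, of 1] by simp_all
  have F: "T \<rhd> ?\<Gamma>2 \<turnstile> ?F Type" using v2 by (intro Imp_type Prp_type proj1_Prp)
  have c3: "T \<rhd> ?F # ?\<Gamma>2 \<turnstile> Ctxt" using F by (rule ctxt_ext)
  have v3: "T \<rhd> ?F # ?\<Gamma>2 \<turnstile> Var 1 \<Colon> SProp" "T \<rhd> ?F # ?\<Gamma>2 \<turnstile> Var 2 \<Colon> SProp"
    using var[OF c3, of 1] var[OF c3, of 2] by (simp_all add: nums)
  have G: "T \<rhd> ?F # ?\<Gamma>2 \<turnstile> ?G Type"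
    using v3 c3 by (intro Imp_type Prp_type proj1_Prp BotS_Prp)
  have c4: "T \<rhd> ?\<Gamma>4 \<turnstile> Ctxt" using G by (rule ctxt_ext)
  have z4: "T \<rhd> ?\<Gamma>4 \<turnstile> Var 2 \<Colon> SProp" using var[OF c4, of 2] by (simp add: nums)
  have Z4: "T \<rhd> ?\<Gamma>4 \<turnstile> proj1 (Var 2) Type" using z4 by (intro Prp_type proj1_Prp)
  have N: "T \<rhd> ?\<Gamma>4 \<turnstile> Neg (proj1 (Var 2)) Type" using Z4 by (intro Prp_type[of _ _ "Neg _"] Neg_Prp)
  have c5: "T \<rhd> ?\<Gamma>5 \<turnstile> Ctxt" using N by (rule ctxt_ext)
  have v5: "T \<rhd> ?\<Gamma>5 \<turnstile> Var 0 \<Colon> Neg (proj1 (Var 3))"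
      "T \<rhd> ?\<Gamma>5 \<turnstile> Var 1 \<Colon> Imp (Imp (proj1 (Var 4)) BotS) (proj1 (Var 3))"
      "T \<rhd> ?\<Gamma>5 \<turnstile> Var 3 \<Colon> SProp" "T \<rhd> ?\<Gamma>5 \<turnstile> Var 4 \<Colon> SProp"
    using var[OF c5, of 0] var[OF c5, of 1] var[OF c5, of 3] var[OF c5, of 4] by (simp_all add: nums)
  have P5: "T \<rhd> ?\<Gamma>5 \<turnstile> proj1 (Var 4) Type" using v5 by (intro Prp_type proj1_Prp)
  have c6: "T \<rhd> ?\<Gamma>6 \<turnstile> Ctxt" using P5 by (rule ctxt_ext)
  have c7: "T \<rhd> ?\<Gamma>7 \<turnstile> Ctxt" using c6 by (intro ctxt_ext[OF SProp_type])
  have v7: "T \<rhd> ?\<Gamma>7 \<turnstile> Var 0 \<Colon> SProp" "T \<rhd> ?\<Gamma>7 \<turnstile> Var 1 \<Colon> proj1 (Var 6)"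
      "T \<rhd> ?\<Gamma>7 \<turnstile> Var 2 \<Colon> Neg (proj1 (Var 5))"
      "T \<rhd> ?\<Gamma>7 \<turnstile> Var 4 \<Colon> Imp (proj1 (Var 6)) (proj1 (Var 5))"
      "T \<rhd> ?\<Gamma>7 \<turnstile> Var 5 \<Colon> SProp"
    using var[OF c7, of 0] var[OF c7, of 1] var[OF c7, of 2] var[OF c7, of 4] var[OF c7, of 5]
    by (simp_all add: nums)
  have "T \<rhd> ?\<Gamma>7 \<turnstile> App (Var 2) (App (Var 4) (Var 1)) \<Colon> Bot"
    using v7 by (blast intro: Imp_elim Neg_elim Prp_type proj1_Prp)
  then have "T \<rhd> ?\<Gamma>7 \<turnstile> ?efq \<Colon> proj1 (Var 0)"
    using v7 by (intro App_Bot proj1_Prp)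
  then have "T \<rhd> ?\<Gamma>6 \<turnstile> Lam SProp ?efq \<Colon> BotS"
    by (rule BotS_intro)
  then have "T \<rhd> ?\<Gamma>5 \<turnstile> ?notp \<Colon> Imp (proj1 (Var 4)) BotS"
    using P5 by (intro Imp_intro) simp_all
  then have "T \<rhd> ?\<Gamma>5 \<turnstile> ?absurd \<Colon> Bot"
    using v5 by (blast intro: Imp_elim Neg_elim Prp_type proj1_Prp)
  then have "T \<rhd> ?\<Gamma>4 \<turnstile> ?refute \<Colon> Neg (Neg (proj1 (Var 2)))"
    using N by (intro Neg_intro)
  moreover have "T \<rhd> ?\<Gamma>4 \<turnstile> proj2 (Var 2) \<Colon> Imp (Neg (Neg (proj1 (Var 2)))) (proj1 (Var 2))"
    using proj2_eq[OF tmeq_refl[OF z4]] unfolding Stab_def by (rule tm_left)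
  ultimately have "T \<rhd> ?\<Gamma>4 \<turnstile> ?body \<Colon> proj1 (Var 2)"
    using Z4 by (blast intro: Imp_elim)
  then have "T \<rhd> ?F # ?\<Gamma>2 \<turnstile> Lam ?G ?body \<Colon> Imp ?G (proj1 (Var 1))"
    using G by (intro Imp_intro) (simp_all add: nums)
  then show ?thesis unfolding em_def EM_def using S1 S2 F
    by (intro Pi_intro Imp_intro) (simp_all add: nums)
qed

section \<open>The translation\<close>

text \<open>
  The two translations of an expression, as a term and as a type, depend on each other and are
  therefore computed together. An expression that is not a type former can be a type only by
  being a proposition, so its translation as a type is the first projection of its translation as a term.
  Type formers other than \<open>Pi\<close> are never terms, and the value \<open>Star\<close> for them is arbitrary.
\<close>
primrec translate :: "expr \<Rightarrow> expr \<times> expr" where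
  "translate (Var n) = (Var n, proj1 (Var n))"
| "translate Prp = (Star, SProp)"
| "translate (Pi A B) =
    (let P = Pi (snd (translate A)) (snd (translate B))
     in (PairT P (stab (snd (translate A)) (snd (translate B)) (fst (translate B))), P))"
| "translate (Lam A b) = (let t = Lam (snd (translate A)) (fst (translate b)) in (t, proj1 t))"
| "translate (App f a) = (let t = App (fst (translate f)) (fst (translate a)) in (t, proj1 t))"
| "translate N0 = (Star, N0)"
| "translate (ElN0 d) = (let t = ElN0 (fst (translate d)) in (t, proj1 t))"
| "translate N1 = (Star, N1)"
| "translate Star = (Star, proj1 Star)"
| "translate (ElN1 d m) = (let t = ElN1 (fst (translate d)) (fst (translate m)) in (t, proj1 t))"
| "translate (Plus A B) = (Star, Plus (snd (translate A)) (snd (translate B)))"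
| "translate (InL a) = (let t = InL (fst (translate a)) in (t, proj1 t))"
| "translate (InR b) = (let t = InR (fst (translate b)) in (t, proj1 t))"
| "translate (ElPlus d m n) =
    (let t = ElPlus (fst (translate d)) (fst (translate m)) (fst (translate n)) in (t, proj1 t))"
| "translate (ListT A) = (Star, ListT (snd (translate A)))"
| "translate Eps = (Eps, proj1 Eps)"
| "translate (ConsT a l) = (let t = ConsT (fst (translate a)) (fst (translate l)) in (t, proj1 t))"
| "translate (ElList l m n) =
    (let t = ElList (fst (translate l)) (fst (translate m)) (fst (translate n)) in (t, proj1 t))"
| "translate (Sig A B) = (Star, Sig (snd (translate A)) (snd (translate B)))"
| "translate (PairT a b) = (let t = PairT (fst (translate a)) (fst (translate b)) in (t, proj1 t))"
| "translate (ElSig d m) = (let t = ElSig (fst (translate d)) (fst (translate m)) in (t, proj1 t))"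
| "translate Lem = (em, proj1 em)"

definition tm :: "expr \<Rightarrow> expr" where "tm e = fst (translate e)"
definition ty :: "expr \<Rightarrow> expr" where "ty e = snd (translate e)"

lemma tm_simps [simp]:
  "tm (Var i) = Var i"
  "tm (Pi A B) = PairT (Pi (ty A) (ty B)) (stab (ty A) (ty B) (tm B))"
  "tm (Lam A b) = Lam (ty A) (tm b)"
  "tm (App f a) = App (tm f) (tm a)"
  "tm (ElN0 d) = ElN0 (tm d)"
  "tm Star = Star"
  "tm (ElN1 d m) = ElN1 (tm d) (tm m)"
  "tm (InL a) = InL (tm a)"
  "tm (InR a) = InR (tm a)"
  "tm (ElPlus d m n) = ElPlus (tm d) (tm m) (tm n)"
  "tm Eps = Eps"
  "tm (ConsT a l) = ConsT (tm a) (tm l)"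
  "tm (ElList l m n) = ElList (tm l) (tm m) (tm n)"
  "tm (PairT a b) = PairT (tm a) (tm b)"
  "tm (ElSig d m) = ElSig (tm d) (tm m)"
  "tm Lem = em"
  by (simp_all add: tm_def ty_def Let_def)

lemma ty_simps [simp]:
  "ty (Var i) = proj1 (Var i)"
  "ty Prp = SProp"
  "ty (Pi A B) = Pi (ty A) (ty B)"
  "ty N0 = N0"
  "ty N1 = N1"
  "ty (Plus A B) = Plus (ty A) (ty B)"
  "ty (ListT A) = ListT (ty A)"
  "ty (Sig A B) = Sig (ty A) (ty B)"
  "ty (Lam A b) = proj1 (Lam (ty A) (tm b))"
  "ty (App f a) = proj1 (App (tm f) (tm a))"
  "ty (ElN0 d) = proj1 (ElN0 (tm d))"
  "ty Star = proj1 Star"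
  "ty (ElN1 d m) = proj1 (ElN1 (tm d) (tm m))"
  "ty (InL a) = proj1 (InL (tm a))"
  "ty (InR a) = proj1 (InR (tm a))"
  "ty (ElPlus d m n) = proj1 (ElPlus (tm d) (tm m) (tm n))"
  "ty Eps = proj1 Eps"
  "ty (ConsT a l) = proj1 (ConsT (tm a) (tm l))"
  "ty (ElList l m n) = proj1 (ElList (tm l) (tm m) (tm n))"
  "ty (PairT a b) = proj1 (PairT (tm a) (tm b))"
  "ty (ElSig d m) = proj1 (ElSig (tm d) (tm m))"
  "ty Lem = proj1 em"
  by (simp_all add: tm_def ty_def Let_def)

text \<open>
  Renamings, unlike substitutions, never place a product in the position of a variable, so the
  translation commutes with them on the nose.
\<close>
lemma translate_rename: "tm (rename r e) = rename r (tm e) \<and> ty (rename r e) = rename r (ty e)"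
proof (induction e arbitrary: r)
  case Prp
  show ?case by (simp add: tm_def)
next
  case N0
  show ?case by (simp add: tm_def)
next
  case N1
  show ?case by (simp add: tm_def)
next
  case (Plus A B)
  then show ?case by (simp add: tm_def)
next
  case (ListT A)
  then show ?case by (simp add: tm_def)
next
  case (Sig A B)
  then show ?case by (simp add: tm_def)
qed (simp_all add: rename_stab rename_subst[of _ em])

lemma tm_rename [simp]: "tm (rename r e) = rename r (tm e)"
  and ty_rename [simp]: "ty (rename r e) = rename r (ty e)"
  by (simp_all add: translate_rename)

lemma ty_connectives [simp]:
  "ty (Imp P Q) = Imp (ty P) (ty Q)" "ty Bot = BotS" "ty (Neg P) = Imp (ty P) BotS"
  "ty (Disj P Q) = Pi SProp (Imp (Imp (lift (ty P)) (proj1 (Var 0)))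
     (Imp (Imp (lift (ty Q)) (proj1 (Var 0))) (proj1 (Var 0))))"
  by (simp_all add: Imp_def Bot_def BotS_def Neg_def Disj_def)

lemma ty_LEM: "ty LEM = EM"
  by (simp add: LEM_def EM_def)

lemma up_Var_id [simp]: "up Var = Var"
  using up_Var[of "\<lambda>n. n"] by simp

lemma tm_up: "(\<lambda>n. tm (up s n)) = up (\<lambda>n. tm (s n))"
proof
  show "tm (up s n) = up (\<lambda>n. tm (s n)) n" for n by (cases n) auto
qed

lemma lookup_ty: "n < length \<Gamma> \<Longrightarrow> lookup (map ty \<Gamma>) n = ty (lookup \<Gamma> n)"
  by (simp add: lookup_def)

section \<open>Validity\<close>

text \<open>
  The two translations of a proposition agree. The first disjunct, which holds for everything
  but type formers, makes the condition meaningful for terms that are not propositions; the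
  second is an equation of propositions and not merely of types, because a product is formed as
  a proposition only over a term of type \<open>Prp\<close>.
\<close>
definition coherent :: "ctxt \<Rightarrow> expr \<Rightarrow> bool" where
  "coherent \<Theta> a \<longleftrightarrow> ty a = proj1 (tm a) \<or> CC_ML \<rhd> \<Theta> \<turnstile> ty a \<approx> proj1 (tm a) \<Colon> Prp"

text \<open>
  The target context \<open>\<Theta>\<close> is an arbitrary context of \<open>CC_ML\<close> rather than a translated one, so that
  admissible substitutions can be pushed under binders, where \<open>\<Theta>\<close> grows by a translated substituted
  type (\<open>admissible_up\<close>). The types of the values are translations of substituted types, which
  makes admissibility stable under composition (\<open>admissible_comp\<close>). In valid contexts these agree with the substituted translations
  (\<open>admissible_subst_ok\<close>).
\<close>
definition admissible :: "ctxt \<Rightarrow> (nat \<Rightarrow> expr) \<Rightarrow> ctxt \<Rightarrow> bool" where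
  "admissible \<Theta> s \<Gamma> \<longleftrightarrow> CC_ML \<rhd> \<Theta> \<turnstile> Ctxt \<and>
     (\<forall>n<length \<Gamma>. CC_ML \<rhd> \<Theta> \<turnstile> tm (s n) \<Colon> ty (subst s (lookup \<Gamma> n)) \<and> coherent \<Theta> (s n))"

definition natural_type :: "ctxt \<Rightarrow> expr \<Rightarrow> bool" where
  "natural_type \<Gamma> A \<longleftrightarrow> (\<forall>\<Theta> s. admissible \<Theta> s \<Gamma> \<longrightarrow>
     CC_ML \<rhd> \<Theta> \<turnstile> ty (subst s A) \<approx> subst (\<lambda>n. tm (s n)) (ty A) Type)"

fun valid_ctxt :: "ctxt \<Rightarrow> bool" where
  "valid_ctxt [] \<longleftrightarrow> True"
| "valid_ctxt (A # \<Gamma>) \<longleftrightarrow> valid_ctxt \<Gamma> \<and> natural_type \<Gamma> A"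

definition valid_type :: "ctxt \<Rightarrow> expr \<Rightarrow> bool" where
  "valid_type \<Gamma> A \<longleftrightarrow> valid_ctxt \<Gamma> \<and> natural_type \<Gamma> A"

definition valid_term :: "ctxt \<Rightarrow> expr \<Rightarrow> expr \<Rightarrow> bool" where
  "valid_term \<Gamma> a A \<longleftrightarrow> valid_type \<Gamma> A \<and> (\<forall>\<Theta> s. admissible \<Theta> s \<Gamma> \<longrightarrow>
     CC_ML \<rhd> \<Theta> \<turnstile> tm (subst s a) \<approx> subst (\<lambda>n. tm (s n)) (tm a) \<Colon> ty (subst s A) \<and>
     coherent \<Theta> (subst s a))"

definition valid_type_eq :: "ctxt \<Rightarrow> expr \<Rightarrow> expr \<Rightarrow> bool" where
  "valid_type_eq \<Gamma> A B \<longleftrightarrow> valid_type \<Gamma> A \<and> valid_type \<Gamma> B \<and>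
     CC_ML \<rhd> map ty \<Gamma> \<turnstile> ty A \<approx> ty B Type"

definition valid_term_eq :: "ctxt \<Rightarrow> expr \<Rightarrow> expr \<Rightarrow> expr \<Rightarrow> bool" where
  "valid_term_eq \<Gamma> a b A \<longleftrightarrow> valid_term \<Gamma> a A \<and> valid_term \<Gamma> b A \<and>
     CC_ML \<rhd> map ty \<Gamma> \<turnstile> tm a \<approx> tm b \<Colon> ty A"

lemma admissible_ctxt: "admissible \<Theta> s \<Gamma> \<Longrightarrow> CC_ML \<rhd> \<Theta> \<turnstile> Ctxt"
  by (simp add: admissible_def)

lemma valid_ctxt_Cons: "valid_ctxt (A # \<Gamma>) \<longleftrightarrow> valid_type \<Gamma> A"
  by (simp add: valid_type_def)

lemma valid_type_ctxt: "valid_type \<Gamma> A \<Longrightarrow> valid_ctxt \<Gamma>"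
  by (simp add: valid_type_def)

lemma valid_term_type: "valid_term \<Gamma> a A \<Longrightarrow> valid_type \<Gamma> A"
  by (simp add: valid_term_def)

lemma valid_term_ctxt: "valid_term \<Gamma> a A \<Longrightarrow> valid_ctxt \<Gamma>"
  by (simp add: valid_term_def valid_type_def)

lemma coherent_rename:
  assumes "coherent \<Theta> a" "ren_ok CC_ML \<Xi> r \<Theta>"
  shows "coherent \<Xi> (rename r a)"
  using assms(1) rename_ok_term_eq[OF assms(2), of "ty a" "proj1 (tm a)" Prp] by (auto simp: coherent_def)

lemma admissible_rename:
  assumes "admissible \<Theta> s \<Gamma>" "ren_ok CC_ML \<Xi> r \<Theta>"
  shows "admissible \<Xi> (\<lambda>n. rename r (s n)) \<Gamma>"
  using assms rename_ok_term[OF assms(2)] coherent_rename[OF _ assms(2)]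
  by (auto simp: admissible_def ren_ok_def rename_of_subst[symmetric])

lemma admissible_scons:
  assumes "admissible \<Theta> s \<Gamma>" "CC_ML \<rhd> \<Theta> \<turnstile> tm a \<Colon> ty (subst s A)" "coherent \<Theta> a"
  shows "admissible \<Theta> (a \<cdot> s) (A # \<Gamma>)"
  using assms by (auto simp: admissible_def less_Suc_eq_0_disj subst_rename)

lemma coherent_Var [simp]: "coherent \<Theta> (Var n)"
  by (simp add: coherent_def)

lemma admissible_up:
  assumes "admissible \<Theta> s \<Gamma>" "natural_type \<Gamma> A"
  shows "admissible (ty (subst s A) # \<Theta>) (up s) (A # \<Gamma>)"
proof -
  have "CC_ML \<rhd> \<Theta> \<turnstile> ty (subst s A) Type"
    using assms unfolding natural_type_def by (blast intro: type_left)
  then have c: "CC_ML \<rhd> ty (subst s A) # \<Theta> \<turnstile> Ctxt" by (rule ctxt_ext)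
  show ?thesis unfolding up_def
    by (rule admissible_scons[OF admissible_rename[OF assms(1) ren_ok_Suc[OF c]]])
      (use var[OF c, of 0] in \<open>simp_all add: rename_of_subst[symmetric]\<close>)
qed

lemma admissible_tail:
  assumes "admissible \<Theta> s (A # \<Gamma>)"
  shows "admissible \<Theta> (\<lambda>n. s (Suc n)) \<Gamma>"
  unfolding admissible_def
proof (intro conjI allI impI)
  show "CC_ML \<rhd> \<Theta> \<turnstile> Ctxt" using assms by (rule admissible_ctxt)
  fix n assume "n < length \<Gamma>"
  then have "CC_ML \<rhd> \<Theta> \<turnstile> tm (s (Suc n)) \<Colon> ty (subst s (lookup (A # \<Gamma>) (Suc n)))"
    "coherent \<Theta> (s (Suc n))"
    using assms unfolding admissible_def by (auto simp del: lookup_Cons)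
  then show "CC_ML \<rhd> \<Theta> \<turnstile> tm (s (Suc n)) \<Colon> ty (subst (\<lambda>n. s (Suc n)) (lookup \<Gamma> n))"
    "coherent \<Theta> (s (Suc n))"
    by (simp_all add: subst_rename)
qed

lemma natural_type_lift: "natural_type \<Gamma> A \<Longrightarrow> natural_type (B # \<Gamma>) (lift A)"
  unfolding natural_type_def by (simp add: subst_rename) (blast dest: admissible_tail)

lemma valid_lookup: "valid_ctxt \<Gamma> \<Longrightarrow> n < length \<Gamma> \<Longrightarrow> natural_type \<Gamma> (lookup \<Gamma> n)"
proof (induction \<Gamma> arbitrary: n)
  case (Cons A \<Gamma>)
  then show ?case by (cases n) (auto intro: natural_type_lift)
qed simp

text \<open>
  The declared types are natural, so along an admissible substitution the translated values
  can be retyped by the substituted translations of the declarations. This turns an admissible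
  substitution of the source into an ordinary substitution of the target.
\<close>
lemma admissible_subst_ok:
  assumes "valid_ctxt \<Gamma>" "admissible \<Theta> s \<Gamma>"
  shows "subst_ok CC_ML \<Theta> (\<lambda>n. tm (s n)) (map ty \<Gamma>)"
  unfolding subst_ok_def
proof (intro conjI allI impI)
  show "CC_ML \<rhd> \<Theta> \<turnstile> Ctxt" using assms(2) by (rule admissible_ctxt)
  fix n assume "n < length (map ty \<Gamma>)"
  then have n: "n < length \<Gamma>" by simp
  have "CC_ML \<rhd> \<Theta> \<turnstile> ty (subst s (lookup \<Gamma> n)) \<approx> subst (\<lambda>n. tm (s n)) (ty (lookup \<Gamma> n)) Type"
    using valid_lookup[OF assms(1) n] assms(2) unfolding natural_type_def by blast
  then show "CC_ML \<rhd> \<Theta> \<turnstile> tm (s n) \<Colon> subst (\<lambda>n. tm (s n)) (lookup (map ty \<Gamma>) n)"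
    using assms(2) n unfolding admissible_def by (simp add: lookup_ty) (blast intro: tm_conv)
qed

lemma admissible_Var: "CC_ML \<rhd> map ty \<Gamma> \<turnstile> Ctxt \<Longrightarrow> admissible (map ty \<Gamma>) Var \<Gamma>"
  unfolding admissible_def by (auto simp: lookup_ty[symmetric] intro: var)

text \<open>
  The identity is admissible once the translated context is known to be well formed, and naturality
  of the next declaration at the identity then extends the context by a well-formed type.
\<close>
lemma valid_ctxt_ok: "valid_ctxt \<Gamma> \<Longrightarrow> CC_ML \<rhd> map ty \<Gamma> \<turnstile> Ctxt"
proof (induction \<Gamma>)
  case Nil
  show ?case by (simp add: ctxt_empty)
next
  case (Cons A \<Gamma>)
  then have "admissible (map ty \<Gamma>) Var \<Gamma>" "natural_type \<Gamma> A" by (auto intro: admissible_Var)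
  then have "CC_ML \<rhd> map ty \<Gamma> \<turnstile> ty A Type"
    unfolding natural_type_def by (fastforce dest: type_left)
  then show ?case by (simp add: ctxt_ext)
qed

lemma admissible_id: "valid_ctxt \<Gamma> \<Longrightarrow> admissible (map ty \<Gamma>) Var \<Gamma>"
  by (intro admissible_Var valid_ctxt_ok)

lemma natural_typeD:
  "valid_type \<Gamma> A \<Longrightarrow> admissible \<Theta> s \<Gamma> \<Longrightarrow> CC_ML \<rhd> \<Theta> \<turnstile> ty (subst s A) \<approx> subst (\<lambda>n. tm (s n)) (ty A) Type"
  by (simp add: valid_type_def natural_type_def)

lemma valid_typeD: "valid_type \<Gamma> A \<Longrightarrow> admissible \<Theta> s \<Gamma> \<Longrightarrow> CC_ML \<rhd> \<Theta> \<turnstile> ty (subst s A) Type"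
  by (blast intro: natural_typeD type_left)

lemma valid_typeD_id: "valid_type \<Gamma> A \<Longrightarrow> CC_ML \<rhd> map ty \<Gamma> \<turnstile> ty A Type"
  using valid_typeD[OF _ admissible_id, of \<Gamma> A] by (simp add: valid_type_ctxt)

lemma natural_termD:
  "valid_term \<Gamma> a A \<Longrightarrow> admissible \<Theta> s \<Gamma> \<Longrightarrow>
   CC_ML \<rhd> \<Theta> \<turnstile> tm (subst s a) \<approx> subst (\<lambda>n. tm (s n)) (tm a) \<Colon> ty (subst s A)"
  by (simp add: valid_term_def)

lemma valid_termD: "valid_term \<Gamma> a A \<Longrightarrow> admissible \<Theta> s \<Gamma> \<Longrightarrow> CC_ML \<rhd> \<Theta> \<turnstile> tm (subst s a) \<Colon> ty (subst s A)"
  by (blast intro: natural_termD tm_left)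

lemma valid_termD_id: "valid_term \<Gamma> a A \<Longrightarrow> CC_ML \<rhd> map ty \<Gamma> \<turnstile> tm a \<Colon> ty A"
  using valid_termD[OF _ admissible_id, of \<Gamma> a A] by (simp add: valid_term_ctxt)

lemma coherentD: "valid_term \<Gamma> a A \<Longrightarrow> admissible \<Theta> s \<Gamma> \<Longrightarrow> coherent \<Theta> (subst s a)"
  by (simp add: valid_term_def)

lemma valid_typeI:
  assumes "valid_ctxt \<Gamma>" "\<And>\<Theta> s. admissible \<Theta> s \<Gamma> \<Longrightarrow> CC_ML \<rhd> \<Theta> \<turnstile> ty (subst s A) \<approx> subst (\<lambda>n. tm (s n)) (ty A) Type"
  shows "valid_type \<Gamma> A"
  using assms by (simp add: valid_type_def natural_type_def)

lemma valid_termI: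
  assumes "valid_type \<Gamma> A"
    "\<And>\<Theta> s. admissible \<Theta> s \<Gamma> \<Longrightarrow> CC_ML \<rhd> \<Theta> \<turnstile> tm (subst s a) \<approx> subst (\<lambda>n. tm (s n)) (tm a) \<Colon> ty (subst s A)"
    "\<And>\<Theta> s. admissible \<Theta> s \<Gamma> \<Longrightarrow> coherent \<Theta> (subst s a)"
  shows "valid_term \<Gamma> a A"
  using assms by (simp add: valid_term_def)

lemma valid_var:
  assumes "valid_ctxt \<Gamma>" "n < length \<Gamma>"
  shows "valid_term \<Gamma> (Var n) (lookup \<Gamma> n)"
  using assms valid_lookup[OF assms] by (intro valid_termI) (auto simp: valid_type_def admissible_def intro: tmeq_refl)

definition valid_subst :: "ctxt \<Rightarrow> (nat \<Rightarrow> expr) \<Rightarrow> ctxt \<Rightarrow> bool" where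
  "valid_subst \<Gamma> s \<Delta> \<longleftrightarrow> valid_ctxt \<Gamma> \<and> (\<forall>n<length \<Delta>. valid_term \<Gamma> (s n) (subst s (lookup \<Delta> n)))"

lemma admissible_comp:
  assumes "valid_subst \<Gamma> s \<Delta>" "admissible \<Theta> r \<Gamma>"
  shows "admissible \<Theta> (\<lambda>n. subst r (s n)) \<Delta>"
  using assms by (auto simp: admissible_def[of _ "\<lambda>n. subst r (s n)"] valid_subst_def subst_subst[symmetric]
    intro: admissible_ctxt valid_termD coherentD)

lemma valid_subst_good: "valid_subst \<Gamma> s \<Delta> \<Longrightarrow> admissible (map ty \<Gamma>) s \<Delta>"
  using admissible_comp[of \<Gamma> s \<Delta> "map ty \<Gamma>" Var] admissible_id[of \<Gamma>] by (simp add: valid_subst_def)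

section \<open>Validity of the structural rules\<close>

text \<open>
  Composing with an admissible \<open>r\<close> can be done before or after translating; the two resulting
  target substitutions have equal values because the values of \<open>s\<close> are natural.
\<close>
lemma subst_comp_eq:
  assumes "valid_subst \<Gamma> s \<Delta>" "admissible \<Theta> r \<Gamma>" "valid_ctxt \<Delta>"
  shows "subst_ok CC_ML \<Theta> (\<lambda>n. tm (subst r (s n))) (map ty \<Delta>)"
    "subst_ok CC_ML \<Theta> (\<lambda>n. subst (\<lambda>m. tm (r m)) (tm (s n))) (map ty \<Delta>)"
    "\<And>n. n < length (map ty \<Delta>) \<Longrightarrow> CC_ML \<rhd> \<Theta> \<turnstile> tm (subst r (s n)) \<approx> subst (\<lambda>m. tm (r m)) (tm (s n))
       \<Colon> subst (\<lambda>n. tm (subst r (s n))) (lookup (map ty \<Delta>) n)"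
proof -
  have g: "admissible \<Theta> (\<lambda>n. subst r (s n)) \<Delta>" using assms(1,2) by (rule admissible_comp)
  show 1: "subst_ok CC_ML \<Theta> (\<lambda>n. tm (subst r (s n))) (map ty \<Delta>)"
    by (rule admissible_subst_ok[OF assms(3) g])
  have v: "valid_ctxt \<Gamma>" using assms(1) by (simp add: valid_subst_def)
  have s: "subst_ok CC_ML (map ty \<Gamma>) (\<lambda>n. tm (s n)) (map ty \<Delta>)"
    by (rule admissible_subst_ok[OF assms(3) valid_subst_good[OF assms(1)]])
  have r: "subst_ok CC_ML \<Theta> (\<lambda>n. tm (r n)) (map ty \<Gamma>)"
    by (rule admissible_subst_ok[OF v assms(2)])
  show "subst_ok CC_ML \<Theta> (\<lambda>n. subst (\<lambda>m. tm (r m)) (tm (s n))) (map ty \<Delta>)"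
    using s subst_ok_term[OF r] admissible_ctxt[OF g] by (fastforce simp: subst_ok_def subst_subst)
  fix n assume "n < length (map ty \<Delta>)"
  then have n: "n < length \<Delta>" by simp
  have "CC_ML \<rhd> \<Theta> \<turnstile> tm (subst r (s n)) \<approx> subst (\<lambda>m. tm (r m)) (tm (s n))
     \<Colon> ty (subst (\<lambda>n. subst r (s n)) (lookup \<Delta> n))"
    using natural_termD[OF _ assms(2)] assms(1) n by (simp add: valid_subst_def subst_subst[symmetric])
  moreover have "CC_ML \<rhd> \<Theta> \<turnstile> ty (subst (\<lambda>n. subst r (s n)) (lookup \<Delta> n))
     \<approx> subst (\<lambda>n. tm (subst r (s n))) (ty (lookup \<Delta> n)) Type"
    using valid_lookup[OF assms(3) n] g by (simp add: natural_type_def)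
  ultimately show "CC_ML \<rhd> \<Theta> \<turnstile> tm (subst r (s n)) \<approx> subst (\<lambda>m. tm (r m)) (tm (s n))
       \<Colon> subst (\<lambda>n. tm (subst r (s n))) (lookup (map ty \<Delta>) n)"
    using n by (simp add: lookup_ty tmeq_conv)
qed

text \<open>
  Naturality of a substituted type at \<open>r\<close> is obtained from naturality of the type at the
  composite of \<open>s\<close> with \<open>r\<close> and at \<open>s\<close>, which are compared by \<open>subst_comp_eq\<close>.
\<close>
lemma valid_ty_subst:
  assumes "valid_subst \<Gamma> s \<Delta>" "valid_type \<Delta> A"
  shows "valid_type \<Gamma> (subst s A)"
proof (rule valid_typeI)
  show v: "valid_ctxt \<Gamma>" using assms(1) by (simp add: valid_subst_def)
  have d: "valid_ctxt \<Delta>" using assms(2) by (rule valid_type_ctxt)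
  fix \<Theta> r assume g: "admissible \<Theta> r \<Gamma>"
  note c = subst_comp_eq[OF assms(1) g d]
  have "CC_ML \<rhd> \<Theta> \<turnstile> ty (subst r (subst s A)) \<approx> subst (\<lambda>n. tm (subst r (s n))) (ty A) Type"
    using natural_typeD[OF assms(2) admissible_comp[OF assms(1) g]] by (simp add: subst_subst)
  moreover have "CC_ML \<rhd> \<Theta> \<turnstile> subst (\<lambda>n. tm (subst r (s n))) (ty A)
      \<approx> subst (\<lambda>n. subst (\<lambda>m. tm (r m)) (tm (s n))) (ty A) Type"
    using subst_eq_ok_type[OF c valid_typeD_id[OF assms(2)]] .
  moreover have "CC_ML \<rhd> \<Theta> \<turnstile> subst (\<lambda>m. tm (r m)) (ty (subst s A))
      \<approx> subst (\<lambda>n. subst (\<lambda>m. tm (r m)) (tm (s n))) (ty A) Type"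
    using subst_ok_type_eq[OF admissible_subst_ok[OF v g] natural_typeD[OF assms(2) valid_subst_good[OF assms(1)]]]
    by (simp add: subst_subst)
  ultimately show "CC_ML \<rhd> \<Theta> \<turnstile> ty (subst r (subst s A)) \<approx> subst (\<lambda>n. tm (r n)) (ty (subst s A)) Type"
    by (meson tyeq_sym tyeq_trans)
qed

lemma valid_tm_subst:
  assumes "valid_subst \<Gamma> s \<Delta>" "valid_term \<Delta> a A"
  shows "valid_term \<Gamma> (subst s a) (subst s A)"
proof (rule valid_termI)
  have v: "valid_ctxt \<Gamma>" using assms(1) by (simp add: valid_subst_def)
  have A: "valid_type \<Delta> A" using assms(2) by (rule valid_term_type)
  have d: "valid_ctxt \<Delta>" using A by (rule valid_type_ctxt)
  show "valid_type \<Gamma> (subst s A)" using valid_ty_subst[OF assms(1) A] .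
  fix \<Theta> r assume g: "admissible \<Theta> r \<Gamma>"
  note c = subst_comp_eq[OF assms(1) g d] and gc = admissible_comp[OF assms(1) g]
  let ?X = "ty (subst r (subst s A))"
  have X: "CC_ML \<rhd> \<Theta> \<turnstile> ?X \<approx> subst (\<lambda>n. tm (subst r (s n))) (ty A) Type"
    using natural_typeD[OF A gc] by (simp add: subst_subst)
  have 1: "CC_ML \<rhd> \<Theta> \<turnstile> tm (subst r (subst s a)) \<approx> subst (\<lambda>n. tm (subst r (s n))) (tm a) \<Colon> ?X"
    using natural_termD[OF assms(2) gc] by (simp add: subst_subst)
  have "CC_ML \<rhd> \<Theta> \<turnstile> subst (\<lambda>n. tm (subst r (s n))) (tm a)
      \<approx> subst (\<lambda>n. subst (\<lambda>m. tm (r m)) (tm (s n))) (tm a) \<Colon> subst (\<lambda>n. tm (subst r (s n))) (ty A)"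
    using subst_eq_ok_term[OF c valid_termD_id[OF assms(2)]] .
  then have 2: "CC_ML \<rhd> \<Theta> \<turnstile> subst (\<lambda>n. tm (subst r (s n))) (tm a)
      \<approx> subst (\<lambda>n. subst (\<lambda>m. tm (r m)) (tm (s n))) (tm a) \<Colon> ?X"
    using X by (meson tmeq_conv tyeq_sym)
  have "CC_ML \<rhd> \<Theta> \<turnstile> subst (\<lambda>m. tm (r m)) (tm (subst s a))
      \<approx> subst (\<lambda>n. subst (\<lambda>m. tm (r m)) (tm (s n))) (tm a) \<Colon> subst (\<lambda>m. tm (r m)) (ty (subst s A))"
    using subst_ok_term_eq[OF admissible_subst_ok[OF v g] natural_termD[OF assms(2) valid_subst_good[OF assms(1)]]]
    by (simp add: subst_subst)
  moreover have "CC_ML \<rhd> \<Theta> \<turnstile> ?X \<approx> subst (\<lambda>m. tm (r m)) (ty (subst s A)) Type"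
    using natural_typeD[OF valid_ty_subst[OF assms(1) A] g] .
  ultimately have 3: "CC_ML \<rhd> \<Theta> \<turnstile> subst (\<lambda>m. tm (r m)) (tm (subst s a))
      \<approx> subst (\<lambda>n. subst (\<lambda>m. tm (r m)) (tm (s n))) (tm a) \<Colon> ?X"
    by (meson tmeq_conv tyeq_sym)
  show "CC_ML \<rhd> \<Theta> \<turnstile> tm (subst r (subst s a)) \<approx> subst (\<lambda>n. tm (r n)) (tm (subst s a)) \<Colon> ?X"
    using 1 2 3 by (meson tmeq_sym tmeq_trans)
  show "coherent \<Theta> (subst r (subst s a))"
    using coherentD[OF assms(2) gc] by (simp add: subst_subst)
qed

lemma valid_tyeq_subst:
  assumes "valid_subst \<Gamma> s \<Delta>" "valid_type_eq \<Delta> A B"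
  shows "valid_type_eq \<Gamma> (subst s A) (subst s B)"
proof -
  have AB: "valid_type \<Delta> A" "valid_type \<Delta> B" "CC_ML \<rhd> map ty \<Delta> \<turnstile> ty A \<approx> ty B Type"
    using assms(2) by (simp_all add: valid_type_eq_def)
  note g = valid_subst_good[OF assms(1)]
  note ok = admissible_subst_ok[OF valid_type_ctxt[OF AB(1)] g]
  show ?thesis
    using valid_ty_subst[OF assms(1)] AB natural_typeD[OF AB(1) g] natural_typeD[OF AB(2) g] subst_ok_type_eq[OF ok AB(3)]
    unfolding valid_type_eq_def by (meson tyeq_sym tyeq_trans)
qed

lemma natural_eqD:
  assumes "valid_type_eq \<Gamma> A B" "admissible \<Theta> s \<Gamma>"
  shows "CC_ML \<rhd> \<Theta> \<turnstile> ty (subst s A) \<approx> ty (subst s B) Type"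
proof -
  have AB: "valid_type \<Gamma> A" "valid_type \<Gamma> B" "CC_ML \<rhd> map ty \<Gamma> \<turnstile> ty A \<approx> ty B Type"
    using assms(1) by (simp_all add: valid_type_eq_def)
  note ok = admissible_subst_ok[OF valid_type_ctxt[OF AB(1)] assms(2)]
  show ?thesis
    using natural_typeD[OF AB(1) assms(2)] natural_typeD[OF AB(2) assms(2)] subst_ok_type_eq[OF ok AB(3)]
    by (meson tyeq_sym tyeq_trans)
qed

lemma valid_tm_conv:
  assumes "valid_term \<Gamma> a A" "valid_type_eq \<Gamma> A B"
  shows "valid_term \<Gamma> a B"
  using assms natural_eqD[OF assms(2)]
  by (intro valid_termI) (auto simp: valid_type_eq_def intro: natural_termD tmeq_conv coherentD)

lemma valid_tmeq_conv:
  assumes "valid_term_eq \<Gamma> a b A" "valid_type_eq \<Gamma> A B"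
  shows "valid_term_eq \<Gamma> a b B"
  using assms valid_tm_conv[OF _ assms(2)] unfolding valid_term_eq_def
  by (auto simp: valid_type_eq_def intro: tmeq_conv)

lemma valid_tmeq_subst:
  assumes "valid_subst \<Gamma> s \<Delta>" "valid_term_eq \<Delta> a b A"
  shows "valid_term_eq \<Gamma> (subst s a) (subst s b) (subst s A)"
proof -
  have ab: "valid_term \<Delta> a A" "valid_term \<Delta> b A" "CC_ML \<rhd> map ty \<Delta> \<turnstile> tm a \<approx> tm b \<Colon> ty A"
    using assms(2) by (simp_all add: valid_term_eq_def)
  note g = valid_subst_good[OF assms(1)] and A = valid_term_type[OF ab(1)]
  note ok = admissible_subst_ok[OF valid_type_ctxt[OF A] g]
  show ?thesis
    using valid_tm_subst[OF assms(1)] ab natural_termD[OF ab(1) g] natural_termD[OF ab(2) g]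
      subst_ok_term_eq[OF ok ab(3)] natural_typeD[OF A g]
    unfolding valid_term_eq_def by (meson tmeq_conv tmeq_sym tmeq_trans tyeq_sym)
qed

definition valid_subst_eq where
  "valid_subst_eq \<Gamma> s t \<Delta> \<longleftrightarrow> valid_subst \<Gamma> s \<Delta> \<and> valid_subst \<Gamma> t \<Delta> \<and>
     (\<forall>n<length \<Delta>. valid_term_eq \<Gamma> (s n) (t n) (subst s (lookup \<Delta> n)))"

lemma valid_subst_eqD:
  assumes "valid_subst_eq \<Gamma> s t \<Delta>" "valid_ctxt \<Delta>" "n < length (map ty \<Delta>)"
  shows "CC_ML \<rhd> map ty \<Gamma> \<turnstile> tm (s n) \<approx> tm (t n) \<Colon> subst (\<lambda>n. tm (s n)) (lookup (map ty \<Delta>) n)"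
proof -
  have n: "n < length \<Delta>" using assms(3) by simp
  have "CC_ML \<rhd> map ty \<Gamma> \<turnstile> tm (s n) \<approx> tm (t n) \<Colon> ty (subst s (lookup \<Delta> n))"
    using assms(1) n by (simp add: valid_subst_eq_def valid_term_eq_def)
  moreover have "CC_ML \<rhd> map ty \<Gamma> \<turnstile> ty (subst s (lookup \<Delta> n)) \<approx> subst (\<lambda>n. tm (s n)) (ty (lookup \<Delta> n)) Type"
    using assms(1) valid_lookup[OF assms(2) n] valid_subst_good by (auto simp: valid_subst_eq_def natural_type_def)
  ultimately show ?thesis using n by (simp add: lookup_ty tmeq_conv)
qed

lemma valid_ty_subst_eq:
  assumes "valid_subst_eq \<Gamma> s t \<Delta>" "valid_type \<Delta> A"
  shows "valid_type_eq \<Gamma> (subst s A) (subst t A)"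
proof -
  have st: "valid_subst \<Gamma> s \<Delta>" "valid_subst \<Gamma> t \<Delta>" using assms(1) by (simp_all add: valid_subst_eq_def)
  note d = valid_type_ctxt[OF assms(2)]
  note gs = valid_subst_good[OF st(1)] and gt = valid_subst_good[OF st(2)]
  have "CC_ML \<rhd> map ty \<Gamma> \<turnstile> subst (\<lambda>n. tm (s n)) (ty A) \<approx> subst (\<lambda>n. tm (t n)) (ty A) Type"
    by (rule subst_eq_ok_type[OF admissible_subst_ok[OF d gs] admissible_subst_ok[OF d gt] _ valid_typeD_id[OF assms(2)]])
      (rule valid_subst_eqD[OF assms(1) d])
  then show ?thesis
    using valid_ty_subst[OF st(1) assms(2)] valid_ty_subst[OF st(2) assms(2)]
      natural_typeD[OF assms(2) gs] natural_typeD[OF assms(2) gt]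
    unfolding valid_type_eq_def by (meson tyeq_sym tyeq_trans)
qed

lemma valid_type_eq_sym: "valid_type_eq \<Gamma> A B \<Longrightarrow> valid_type_eq \<Gamma> B A"
  by (auto simp: valid_type_eq_def intro: tyeq_sym)

lemma valid_tm_subst_eq:
  assumes "valid_subst_eq \<Gamma> s t \<Delta>" "valid_term \<Delta> a A"
  shows "valid_term_eq \<Gamma> (subst s a) (subst t a) (subst s A)"
proof -
  have st: "valid_subst \<Gamma> s \<Delta>" "valid_subst \<Gamma> t \<Delta>" using assms(1) by (simp_all add: valid_subst_eq_def)
  note A = valid_term_type[OF assms(2)]
  note d = valid_type_ctxt[OF A]
  note gs = valid_subst_good[OF st(1)] and gt = valid_subst_good[OF st(2)]
  note e = valid_ty_subst_eq[OF assms(1) A]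
  have "CC_ML \<rhd> map ty \<Gamma> \<turnstile> subst (\<lambda>n. tm (s n)) (tm a) \<approx> subst (\<lambda>n. tm (t n)) (tm a) \<Colon> subst (\<lambda>n. tm (s n)) (ty A)"
    by (rule subst_eq_ok_term[OF admissible_subst_ok[OF d gs] admissible_subst_ok[OF d gt] _ valid_termD_id[OF assms(2)]])
      (rule valid_subst_eqD[OF assms(1) d])
  moreover have "CC_ML \<rhd> map ty \<Gamma> \<turnstile> subst (\<lambda>n. tm (s n)) (ty A) \<approx> ty (subst s A) Type"
    using natural_typeD[OF A gs] by (rule tyeq_sym)
  moreover have "CC_ML \<rhd> map ty \<Gamma> \<turnstile> ty (subst t A) \<approx> ty (subst s A) Type"
    using e by (simp add: valid_type_eq_def tyeq_sym)
  ultimately have "CC_ML \<rhd> map ty \<Gamma> \<turnstile> tm (subst s a) \<approx> tm (subst t a) \<Colon> ty (subst s A)"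
    using natural_termD[OF assms(2) gs] natural_termD[OF assms(2) gt]
    by (meson tmeq_conv tmeq_sym tmeq_trans)
  then show ?thesis
    using valid_tm_subst[OF st(1) assms(2)] valid_tm_subst[OF st(2) assms(2)] valid_type_eq_sym[OF e]
    unfolding valid_term_eq_def by (blast intro: valid_tm_conv)
qed

declare valid_ctxt.simps(2) [simp del] valid_ctxt_Cons [simp]

lemma valid_type_tail: "valid_type (A # \<Gamma>) B \<Longrightarrow> valid_type \<Gamma> A"
  using valid_type_ctxt by force

lemma valid_term_tail: "valid_term (A # \<Gamma>) b B \<Longrightarrow> valid_type \<Gamma> A"
  using valid_term_ctxt by force

lemma valid_subst_id: "valid_ctxt \<Gamma> \<Longrightarrow> valid_subst \<Gamma> Var \<Gamma>"
  by (simp add: valid_subst_def valid_var)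

lemma valid_subst_scons:
  assumes "valid_subst \<Gamma> s \<Delta>" "valid_term \<Gamma> a (subst s A)"
  shows "valid_subst \<Gamma> (a \<cdot> s) (A # \<Delta>)"
  using assms by (auto simp: valid_subst_def less_Suc_eq_0_disj subst_rename)

lemma valid_subst_inst: "valid_term \<Gamma> a A \<Longrightarrow> valid_subst \<Gamma> (a \<cdot> Var) (A # \<Gamma>)"
  by (rule valid_subst_scons) (auto intro: valid_subst_id valid_term_ctxt)

lemma valid_inst:
  assumes "valid_term \<Gamma> a A"
  shows valid_inst_type: "valid_type (A # \<Gamma>) B \<Longrightarrow> valid_type \<Gamma> (inst 0 a B)"
    and valid_inst_term: "valid_term (A # \<Gamma>) b B \<Longrightarrow> valid_term \<Gamma> (inst 0 a b) (inst 0 a B)"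
  using valid_subst_inst[OF assms] by (simp_all add: inst0 valid_ty_subst valid_tm_subst)

lemma valid_term_eq_refl: "valid_term \<Gamma> a A \<Longrightarrow> valid_term_eq \<Gamma> a a A"
  by (simp add: valid_term_eq_def tmeq_refl valid_termD_id)

lemma valid_type_eq_refl: "valid_type \<Gamma> A \<Longrightarrow> valid_type_eq \<Gamma> A A"
  by (simp add: valid_type_eq_def tyeq_refl valid_typeD_id)

lemma valid_term_eqD:
  assumes "valid_term_eq \<Gamma> a b A"
  shows "valid_term \<Gamma> a A" "valid_term \<Gamma> b A" "CC_ML \<rhd> map ty \<Gamma> \<turnstile> tm a \<approx> tm b \<Colon> ty A"
  using assms by (simp_all add: valid_term_eq_def)

lemma valid_type_eqD:
  assumes "valid_type_eq \<Gamma> A B"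
  shows "valid_type \<Gamma> A" "valid_type \<Gamma> B" "CC_ML \<rhd> map ty \<Gamma> \<turnstile> ty A \<approx> ty B Type"
  using assms by (simp_all add: valid_type_eq_def)

lemma valid_inst_eq:
  assumes "valid_term_eq \<Gamma> a a' A" "valid_type (A # \<Gamma>) B"
  shows "valid_type_eq \<Gamma> (inst 0 a' B) (inst 0 a B)"
proof -
  have "valid_subst_eq \<Gamma> (a \<cdot> Var) (a' \<cdot> Var) (A # \<Gamma>)"
    unfolding valid_subst_eq_def
    using assms(1) valid_subst_inst[OF valid_term_eqD(1)[OF assms(1)]] valid_subst_inst[OF valid_term_eqD(2)[OF assms(1)]]
      valid_term_eq_refl[OF valid_var[OF valid_term_ctxt[OF valid_term_eqD(1)[OF assms(1)]]]]
    by (auto simp: less_Suc_eq_0_disj subst_rename)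
  from valid_ty_subst_eq[OF this assms(2)] show ?thesis
    by (simp add: inst0 valid_type_eq_sym)
qed

lemma valid_lift_type_eq:
  assumes "valid_type \<Gamma> B" "valid_type_eq \<Gamma> A A'"
  shows "valid_type_eq (B # \<Gamma>) (lift A) (lift A')"
proof -
  have v: "valid_ctxt (B # \<Gamma>)" using assms(1) by simp
  have "valid_subst (B # \<Gamma>) (\<lambda>n. Var (Suc n)) \<Gamma>"
    using v valid_var[OF v, of "Suc _"] by (auto simp: valid_subst_def rename_subst[symmetric])
  from valid_tyeq_subst[OF this assms(2)] show ?thesis by (simp add: rename_subst)
qed

lemma valid_ctxt_conv:
  assumes "valid_type_eq \<Gamma> A A'"
  shows valid_ctxt_conv_type: "valid_type (A # \<Gamma>) B \<Longrightarrow> valid_type (A' # \<Gamma>) B"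
    and valid_ctxt_conv_term: "valid_term (A # \<Gamma>) b B \<Longrightarrow> valid_term (A' # \<Gamma>) b B"
proof -
  have A': "valid_type \<Gamma> A'" using assms by (rule valid_type_eqD)
  then have v: "valid_ctxt (A' # \<Gamma>)" by (simp add: valid_ctxt_Cons)
  have "valid_term (A' # \<Gamma>) (Var 0) (lift A)"
    by (rule valid_tm_conv[OF _ valid_type_eq_sym[OF valid_lift_type_eq[OF A' assms]]])
      (use valid_var[OF v, of 0] in simp)
  then have "valid_subst (A' # \<Gamma>) Var (A # \<Gamma>)"
    using v valid_var[OF v, of "Suc _"] by (auto simp: valid_subst_def less_Suc_eq_0_disj)
  then show "valid_type (A # \<Gamma>) B \<Longrightarrow> valid_type (A' # \<Gamma>) B"
    "valid_term (A # \<Gamma>) b B \<Longrightarrow> valid_term (A' # \<Gamma>) b B"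
    using valid_ty_subst[of "A' # \<Gamma>" Var "A # \<Gamma>" B] valid_tm_subst[of "A' # \<Gamma>" Var "A # \<Gamma>" b B]
    by simp_all
qed

lemma valid_term_eqI:
  assumes "valid_term \<Gamma> a A" "valid_term \<Gamma> b B" "valid_type_eq \<Gamma> B A"
    "CC_ML \<rhd> map ty \<Gamma> \<turnstile> tm a \<approx> tm b \<Colon> ty A"
  shows "valid_term_eq \<Gamma> a b A"
  using assms by (auto simp: valid_term_eq_def intro: valid_tm_conv)

lemma tm_scons [simp]: "(\<lambda>n. tm ((a \<cdot> s) n)) = tm a \<cdot> (\<lambda>n. tm (s n))"
proof
  show "tm ((a \<cdot> s) n) = (tm a \<cdot> (\<lambda>n. tm (s n))) n" for n by (cases n) auto
qed

lemma tm_inst: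
  assumes "valid_term \<Gamma> a A" "valid_term (A # \<Gamma>) b B"
  shows "CC_ML \<rhd> map ty \<Gamma> \<turnstile> inst 0 (tm a) (tm b) \<approx> tm (inst 0 a b) \<Colon> ty (inst 0 a B)"
  using tmeq_sym[OF natural_termD[OF assms(2) valid_subst_good[OF valid_subst_inst[OF assms(1)]]]]
  by (simp add: inst0)

lemma admissible_Cons: "admissible \<Theta> s \<Gamma> \<Longrightarrow> valid_ctxt (A # \<Gamma>) \<Longrightarrow> admissible (ty (subst s A) # \<Theta>) (up s) (A # \<Gamma>)"
  by (simp add: admissible_up valid_type_def)

lemma natural_up:
  assumes "admissible \<Theta> s \<Gamma>"
  shows natural_up_type: "valid_type (A # \<Gamma>) B \<Longrightarrow>
     CC_ML \<rhd> ty (subst s A) # \<Theta> \<turnstile> ty (subst (up s) B) \<approx> subst (up (\<lambda>n. tm (s n))) (ty B) Type"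
    and natural_up_term: "valid_term (A # \<Gamma>) b B \<Longrightarrow>
     CC_ML \<rhd> ty (subst s A) # \<Theta> \<turnstile> tm (subst (up s) b) \<approx> subst (up (\<lambda>n. tm (s n))) (tm b)
       \<Colon> ty (subst (up s) B)"
proof -
  show "CC_ML \<rhd> ty (subst s A) # \<Theta> \<turnstile> ty (subst (up s) B) \<approx> subst (up (\<lambda>n. tm (s n))) (ty B) Type"
    if "valid_type (A # \<Gamma>) B"
    using natural_typeD[OF that admissible_Cons[OF assms valid_type_ctxt[OF that]]] by (simp add: tm_up)
  show "CC_ML \<rhd> ty (subst s A) # \<Theta> \<turnstile> tm (subst (up s) b) \<approx> subst (up (\<lambda>n. tm (s n))) (tm b)
       \<Colon> ty (subst (up s) B)" if "valid_term (A # \<Gamma>) b B"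
    using natural_termD[OF that admissible_Cons[OF assms valid_term_ctxt[OF that]]] by (simp add: tm_up)
qed

text \<open>
  The eliminators instantiate their motive \<open>C\<close> at constructors applied to \<open>k\<close> fresh variables.
  Since shifting an admissible substitution by \<open>k\<close> and extending it by \<open>e\<close> is admissible again,
  naturality of \<open>C\<close> relates the translated instance to the instance of the translated motive,
  which is what the rules of the target demand.
\<close>
lemma natural_inst:
  assumes C: "valid_type (D # \<Gamma>) C" and g: "admissible \<Theta> s \<Gamma>" and r: "ren_ok CC_ML \<Xi> (\<lambda>n. n + k) \<Theta>"
    and e: "CC_ML \<rhd> \<Xi> \<turnstile> tm e \<Colon> rename (\<lambda>n. n + k) (ty (subst s D))" and ce: "coherent \<Xi> e"
  shows "CC_ML \<rhd> \<Xi> \<turnstile> inst k (tm e) (ty (subst (up s) C)) \<approx> ty (inst k e (subst (up s) C)) Type"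
proof -
  let ?r = "e \<cdot> (\<lambda>n. rename (\<lambda>n. n + k) (s n))"
  have "admissible \<Xi> ?r (D # \<Gamma>)"
    using admissible_rename[OF g r] e ce by (intro admissible_scons) (simp_all add: rename_of_subst[symmetric])
  then have "CC_ML \<rhd> \<Xi> \<turnstile> ty (subst ?r C) \<approx> subst (\<lambda>n. tm (?r n)) (ty C) Type"
    by (rule natural_typeD[OF C])
  moreover have "inst k e (subst (up s) C) = subst ?r C"
    unfolding inst_def subst_norm by (rule subst_ext_Suc) (simp_all add: subst_rename flip: rename_subst)
  moreover have "subst_ok CC_ML \<Xi> (tm e \<cdot> (\<lambda>n. Var (n + k))) (ty (subst s D) # \<Theta>)"
    using ren_ok_subst[OF r] e by (intro subst_ok_scons) (simp_all add: rename_subst)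
  from subst_ok_type_eq[OF this natural_up_type[OF g C]]
  have "CC_ML \<rhd> \<Xi> \<turnstile> inst k (tm e) (ty (subst (up s) C))
     \<approx> subst (tm e \<cdot> (\<lambda>n. Var (n + k))) (subst (up (\<lambda>n. tm (s n))) (ty C)) Type"
    by (simp add: inst_def)
  moreover have "subst (tm e \<cdot> (\<lambda>n. Var (n + k))) (subst (up (\<lambda>n. tm (s n))) (ty C)) = subst (\<lambda>n. tm (?r n)) (ty C)"
    unfolding subst_norm by (rule subst_ext_Suc) (simp_all add: subst_rename flip: rename_subst)
  ultimately show ?thesis by (metis tyeq_sym tyeq_trans)
qed

lemma natural_inst0:
  assumes "valid_type (D # \<Gamma>) C" "valid_term \<Gamma> d D" "admissible \<Theta> s \<Gamma>"
  shows "CC_ML \<rhd> \<Theta> \<turnstile> inst 0 (tm (subst s d)) (ty (subst (up s) C)) \<approx> ty (subst s (inst 0 d C)) Type"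
  unfolding subst_inst0
  by (rule natural_inst[OF assms(1) assms(3)])
    (use assms in \<open>auto simp: ren_ok_def rename_subst intro: admissible_ctxt valid_termD coherentD\<close>)

lemma natural_inst0_id:
  assumes "valid_type (D # \<Gamma>) C" "valid_term \<Gamma> d D"
  shows "CC_ML \<rhd> map ty \<Gamma> \<turnstile> inst 0 (tm d) (ty C) \<approx> ty (inst 0 d C) Type"
  using natural_inst0[OF assms admissible_id[OF valid_term_ctxt[OF assms(2)]]] by simp

section \<open>Propositions\<close>

lemma coherent_SProp:
  "coherent \<Theta> a \<Longrightarrow> CC_ML \<rhd> \<Theta> \<turnstile> tm a \<Colon> SProp \<Longrightarrow> CC_ML \<rhd> \<Theta> \<turnstile> ty a \<approx> proj1 (tm a) \<Colon> Prp"
  unfolding coherent_def using proj1_Prp tmeq_refl by metis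

lemma valid_Prp_form: "valid_ctxt \<Gamma> \<Longrightarrow> valid_type \<Gamma> Prp"
  by (rule valid_typeI) (auto intro: tyeq_refl SProp_type admissible_ctxt)

lemma prop_coherent:
  assumes "valid_term \<Gamma> P Prp" "admissible \<Theta> s \<Gamma>"
  shows "CC_ML \<rhd> \<Theta> \<turnstile> ty (subst s P) \<approx> proj1 (tm (subst s P)) \<Colon> Prp"
  using coherent_SProp[OF coherentD[OF assms]] valid_termD[OF assms] by simp

lemma prop_coherent_id:
  assumes "valid_term \<Gamma> P Prp"
  shows "CC_ML \<rhd> map ty \<Gamma> \<turnstile> ty P \<approx> proj1 (tm P) \<Colon> Prp"
  using prop_coherent[OF assms admissible_id[OF valid_term_ctxt[OF assms]]] by simp

text \<open>
  The equation holds at type \<open>Prp\<close>: both sides are compared with the first projections of the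
  translations as terms, which are natural as terms of \<open>SProp\<close>.
\<close>
lemma natural_prop:
  assumes "valid_term \<Gamma> P Prp" "admissible \<Theta> s \<Gamma>"
  shows "CC_ML \<rhd> \<Theta> \<turnstile> ty (subst s P) \<approx> subst (\<lambda>n. tm (s n)) (ty P) \<Colon> Prp"
proof -
  have "CC_ML \<rhd> \<Theta> \<turnstile> subst (\<lambda>n. tm (s n)) (ty P) \<approx> proj1 (subst (\<lambda>n. tm (s n)) (tm P)) \<Colon> Prp"
    using subst_ok_term_eq[OF admissible_subst_ok[OF valid_term_ctxt[OF assms(1)] assms(2)] prop_coherent_id[OF assms(1)]]
    by simp
  moreover have "CC_ML \<rhd> \<Theta> \<turnstile> proj1 (tm (subst s P)) \<approx> proj1 (subst (\<lambda>n. tm (s n)) (tm P)) \<Colon> Prp"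
    using natural_termD[OF assms] by (simp add: proj1_eq)
  ultimately show ?thesis using prop_coherent[OF assms] by (meson tmeq_sym tmeq_trans)
qed

lemma valid_Prp_type: "valid_term \<Gamma> P Prp \<Longrightarrow> valid_type \<Gamma> P"
  by (rule valid_typeI) (auto intro: valid_term_ctxt natural_prop Prp_type_eq)

lemma prop_eq:
  assumes "valid_term_eq \<Gamma> P Q Prp"
  shows "CC_ML \<rhd> map ty \<Gamma> \<turnstile> ty P \<approx> ty Q \<Colon> Prp"
  using valid_term_eqD[OF assms] prop_coherent_id proj1_eq[of _ _ "tm P" "tm Q"]
  by (metis tmeq_sym tmeq_trans ty_simps(2))

lemma valid_Prp_type_eq: "valid_term_eq \<Gamma> P Q Prp \<Longrightarrow> valid_type_eq \<Gamma> P Q"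
  using prop_eq by (auto simp: valid_type_eq_def intro: valid_Prp_type valid_term_eqD Prp_type_eq)

section \<open>Products\<close>

lemma valid_Pi_form:
  assumes "valid_type (A # \<Gamma>) B"
  shows "valid_type \<Gamma> (Pi A B)"
proof -
  have A: "valid_type \<Gamma> A" using assms by (rule valid_type_tail)
  show ?thesis
  proof (rule valid_typeI[OF valid_type_ctxt[OF A]])
    fix \<Theta> s assume g: "admissible \<Theta> s \<Gamma>"
    show "CC_ML \<rhd> \<Theta> \<turnstile> ty (subst s (Pi A B)) \<approx> subst (\<lambda>n. tm (s n)) (ty (Pi A B)) Type"
      using Pi_form_eq[OF natural_typeD[OF A g] natural_up_type[OF g assms]] by simp
  qed
qed

lemma valid_Pi_form_eq:
  assumes "valid_type_eq \<Gamma> A A'" "valid_type_eq (A # \<Gamma>) B B'"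
  shows "valid_type_eq \<Gamma> (Pi A B) (Pi A' B')"
  using valid_type_eqD[OF assms(1)] valid_type_eqD[OF assms(2)]
  unfolding valid_type_eq_def[of \<Gamma> "Pi A B"]
  by (auto intro: valid_Pi_form valid_ctxt_conv_type[OF assms(1)] Pi_form_eq)

text \<open>
  Products are the propositions whose two translations are not syntactically a term and its first
  projection. Naturality of the pair needs congruence of the stability proof, and coherence is
  the computation rule of the first projection.
\<close>
lemma valid_All_form:
  assumes P: "valid_term (A # \<Gamma>) P Prp"
  shows "valid_term \<Gamma> (Pi A P) Prp"
proof (rule valid_termI)
  have A: "valid_type \<Gamma> A" using P by (rule valid_term_tail)
  show "valid_type \<Gamma> Prp" using A by (intro valid_Prp_form valid_type_ctxt)
  fix \<Theta> s assume g: "admissible \<Theta> s \<Gamma>"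
  note A' = natural_typeD[OF A g]
  note gA = admissible_Cons[OF g valid_term_ctxt[OF P]]
  note e = natural_prop[OF P gA] natural_up_term[OF g P] prop_coherent[OF P gA]
  have s: "CC_ML \<rhd> \<Theta> \<turnstile> stab (ty (subst s A)) (ty (subst (up s) P)) (tm (subst (up s) P))
     \<approx> stab (subst (\<lambda>n. tm (s n)) (ty A)) (subst (up (\<lambda>n. tm (s n))) (ty P)) (subst (up (\<lambda>n. tm (s n))) (tm P))
     \<Colon> Stab (Pi (ty (subst s A)) (ty (subst (up s) P)))"
    using A' e by (intro stab_eq) (simp_all add: tm_up)
  have p: "CC_ML \<rhd> \<Theta> \<turnstile> Pi (ty (subst s A)) (ty (subst (up s) P))
     \<approx> Pi (subst (\<lambda>n. tm (s n)) (ty A)) (subst (up (\<lambda>n. tm (s n))) (ty P)) \<Colon> Prp"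
    using A' e by (intro All_form_eq) (simp_all add: tm_up)
  show "CC_ML \<rhd> \<Theta> \<turnstile> tm (subst s (Pi A P)) \<approx> subst (\<lambda>n. tm (s n)) (tm (Pi A P)) \<Colon> ty (subst s Prp)"
    using SProp_pair_eq[OF p s] by (simp add: subst_stab)
  show "coherent \<Theta> (subst s (Pi A P))"
    using proj1_beta[OF tm_left[OF p] tm_left[OF s]] by (simp add: coherent_def tmeq_sym)
qed

lemma valid_All_form_eq:
  assumes A: "valid_type_eq \<Gamma> A A'" and P: "valid_term_eq (A # \<Gamma>) P P' Prp"
  shows "valid_term_eq \<Gamma> (Pi A P) (Pi A' P') Prp"
proof -
  note P' = valid_term_eqD[OF P] and A' = valid_type_eqD[OF A]
  have "valid_term \<Gamma> (Pi A P) Prp" "valid_term \<Gamma> (Pi A' P') Prp"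
    using P' by (auto intro: valid_All_form valid_ctxt_conv_term[OF A])
  moreover have "CC_ML \<rhd> map ty \<Gamma> \<turnstile> tm (Pi A P) \<approx> tm (Pi A' P') \<Colon> ty Prp"
    using A'(3) prop_eq[OF P] P'(3) prop_coherent_id[OF P'(1)]
    by (auto intro!: SProp_pair_eq All_form_eq stab_eq)
  ultimately show ?thesis by (simp add: valid_term_eq_def)
qed

lemma valid_Pi_intro:
  assumes b: "valid_term (A # \<Gamma>) b B"
  shows "valid_term \<Gamma> (Lam A b) (Pi A B)"
proof -
  have A: "valid_type \<Gamma> A" using b by (rule valid_term_tail)
  show ?thesis
  proof (rule valid_termI)
    show "valid_type \<Gamma> (Pi A B)" using b by (intro valid_Pi_form valid_term_type)
    fix \<Theta> s assume g: "admissible \<Theta> s \<Gamma>"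
    show "CC_ML \<rhd> \<Theta> \<turnstile> tm (subst s (Lam A b)) \<approx> subst (\<lambda>n. tm (s n)) (tm (Lam A b)) \<Colon> ty (subst s (Pi A B))"
      using Pi_intro_eq[OF natural_typeD[OF A g] natural_up_term[OF g b]] by simp
  qed (simp add: coherent_def)
qed

lemma valid_Pi_intro_eq:
  assumes A: "valid_type_eq \<Gamma> A A'" and b: "valid_term_eq (A # \<Gamma>) b b' B"
  shows "valid_term_eq \<Gamma> (Lam A b) (Lam A' b') (Pi A B)"
proof -
  note b' = valid_term_eqD[OF b]
  have B: "valid_type_eq (A # \<Gamma>) B B" using b'(1) by (intro valid_type_eq_refl valid_term_type)
  show ?thesis
    using b' valid_type_eqD[OF A] 
    by (intro valid_term_eqI[OF valid_Pi_intro valid_Pi_intro valid_type_eq_sym[OF valid_Pi_form_eq[OF A B]]])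
      (auto intro: valid_ctxt_conv_term[OF A] Pi_intro_eq)
qed

text \<open>
  A congruence of the target whose types are presented as translations. Taking the right-hand
  sides to be the substituted translations gives naturality of an application; taking \<open>s\<close> to be
  the identity gives the translated congruence rule. The eliminators below follow the same pattern.
\<close>
lemma Pi_elim_cong:
  assumes B: "valid_type (A # \<Gamma>) B" and a: "valid_term \<Gamma> a A" and g: "admissible \<Theta> s \<Gamma>"
    and f: "CC_ML \<rhd> \<Theta> \<turnstile> f \<approx> f' \<Colon> ty (subst s (Pi A B))"
    and a': "CC_ML \<rhd> \<Theta> \<turnstile> tm (subst s a) \<approx> a' \<Colon> ty (subst s A)"
  shows "CC_ML \<rhd> \<Theta> \<turnstile> App f (tm (subst s a)) \<approx> App f' a' \<Colon> ty (subst s (inst 0 a B))"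
  using tmeq_conv[OF Pi_elim_eq[OF tm_type[OF a'] type_left[OF natural_up_type[OF g B]] _ a'] natural_inst0[OF B a g]] f
  by simp

lemma valid_Pi_elim:
  assumes B: "valid_type (A # \<Gamma>) B" and f: "valid_term \<Gamma> f (Pi A B)" and a: "valid_term \<Gamma> a A"
  shows "valid_term \<Gamma> (App f a) (inst 0 a B)"
  using Pi_elim_cong[OF B a] natural_termD[OF f] natural_termD[OF a]
  by (intro valid_termI valid_inst_type[OF a B]) (simp_all add: coherent_def)

lemma valid_Pi_elim_eq:
  assumes B: "valid_type (A # \<Gamma>) B" and f: "valid_term_eq \<Gamma> f f' (Pi A B)" and a: "valid_term_eq \<Gamma> a a' A"
  shows "valid_term_eq \<Gamma> (App f a) (App f' a') (inst 0 a B)"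
proof -
  note f' = valid_term_eqD[OF f] and a' = valid_term_eqD[OF a]
  show ?thesis
    using Pi_elim_cong[OF B a'(1) admissible_id[OF valid_term_ctxt[OF a'(1)]]] f'(3) a'(3)
    by (intro valid_term_eqI[OF valid_Pi_elim[OF B f'(1) a'(1)] valid_Pi_elim[OF B f'(2) a'(2)] valid_inst_eq[OF a B]])
      simp
qed

lemma valid_Pi_beta:
  assumes b: "valid_term (A # \<Gamma>) b B" and a: "valid_term \<Gamma> a A"
  shows "valid_term_eq \<Gamma> (App (Lam A b) a) (inst 0 a b) (inst 0 a B)"
proof -
  note B = valid_term_type[OF b]
  have "CC_ML \<rhd> map ty \<Gamma> \<turnstile> App (Lam (ty A) (tm b)) (tm a) \<approx> inst 0 (tm a) (tm b) \<Colon> inst 0 (tm a) (ty B)"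
    using valid_termD_id[OF b] by (intro Pi_beta valid_termD_id[OF a] valid_typeD_id[OF valid_term_type[OF a]]) simp
  then have "CC_ML \<rhd> map ty \<Gamma> \<turnstile> tm (App (Lam A b) a) \<approx> tm (inst 0 a b) \<Colon> ty (inst 0 a B)"
    using tmeq_trans[OF tmeq_conv[OF _ natural_inst0_id[OF B a]] tm_inst[OF a b]] by simp
  then show ?thesis using valid_Pi_elim[OF B valid_Pi_intro[OF b] a] valid_inst_term[OF a b]
    by (simp add: valid_term_eq_def)
qed

section \<open>Empty and singleton types\<close>

lemma valid_N0_form: "valid_ctxt \<Gamma> \<Longrightarrow> valid_type \<Gamma> N0"
  by (rule valid_typeI) (auto intro: tyeq_refl N0_form admissible_ctxt)

lemma N0_elim_cong:
  assumes C: "valid_type (N0 # \<Gamma>) C" and d: "valid_term \<Gamma> d N0" and g: "admissible \<Theta> s \<Gamma>"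
    and d': "CC_ML \<rhd> \<Theta> \<turnstile> tm (subst s d) \<approx> d' \<Colon> N0"
  shows "CC_ML \<rhd> \<Theta> \<turnstile> ElN0 (tm (subst s d)) \<approx> ElN0 d' \<Colon> ty (subst s (inst 0 d C))"
  using type_left[OF natural_up_type[OF g C]]
  by (intro tmeq_conv[OF N0_elim_eq[OF _ d'] natural_inst0[OF C d g]]) simp

lemma valid_N0_elim:
  assumes C: "valid_type (N0 # \<Gamma>) C" and d: "valid_term \<Gamma> d N0"
  shows "valid_term \<Gamma> (ElN0 d) (inst 0 d C)"
  using N0_elim_cong[OF C d] natural_termD[OF d]
  by (intro valid_termI valid_inst_type[OF d C]) (simp_all add: coherent_def)

lemma valid_N0_elim_eq:
  assumes C: "valid_type (N0 # \<Gamma>) C" and d: "valid_term_eq \<Gamma> d d' N0"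
  shows "valid_term_eq \<Gamma> (ElN0 d) (ElN0 d') (inst 0 d C)"
proof -
  note d' = valid_term_eqD[OF d]
  show ?thesis
    using N0_elim_cong[OF C d'(1) admissible_id[OF valid_term_ctxt[OF d'(1)]]] d'(3)
    by (intro valid_term_eqI[OF valid_N0_elim[OF C d'(1)] valid_N0_elim[OF C d'(2)] valid_inst_eq[OF d C]])
      simp
qed

lemma valid_N1_form: "valid_ctxt \<Gamma> \<Longrightarrow> valid_type \<Gamma> N1"
  by (rule valid_typeI) (auto intro: tyeq_refl N1_form admissible_ctxt)

lemma valid_N1_intro: "valid_ctxt \<Gamma> \<Longrightarrow> valid_term \<Gamma> Star N1"
  by (rule valid_termI) (auto simp: coherent_def intro: valid_N1_form tmeq_refl N1_intro admissible_ctxt)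

lemma N1_elim_cong:
  assumes C: "valid_type (N1 # \<Gamma>) C" and d: "valid_term \<Gamma> d N1" and g: "admissible \<Theta> s \<Gamma>"
    and d': "CC_ML \<rhd> \<Theta> \<turnstile> tm (subst s d) \<approx> d' \<Colon> N1"
    and m: "CC_ML \<rhd> \<Theta> \<turnstile> m \<approx> m' \<Colon> ty (subst s (inst 0 Star C))"
  shows "CC_ML \<rhd> \<Theta> \<turnstile> ElN1 (tm (subst s d)) m \<approx> ElN1 d' m' \<Colon> ty (subst s (inst 0 d C))"
proof -
  have "CC_ML \<rhd> \<Theta> \<turnstile> m \<approx> m' \<Colon> inst 0 Star (ty (subst (up s) C))"
    using tmeq_conv[OF m tyeq_sym[OF natural_inst0[OF C valid_N1_intro[OF valid_term_ctxt[OF d]] g]]] by simp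
  from tmeq_conv[OF N1_elim_eq[OF _ d' this] natural_inst0[OF C d g]] show ?thesis
    using type_left[OF natural_up_type[OF g C]] by simp
qed

lemma valid_N1_elim:
  assumes C: "valid_type (N1 # \<Gamma>) C" and d: "valid_term \<Gamma> d N1" and m: "valid_term \<Gamma> m (inst 0 Star C)"
  shows "valid_term \<Gamma> (ElN1 d m) (inst 0 d C)"
  using N1_elim_cong[OF C d] natural_termD[OF d] natural_termD[OF m]
  by (intro valid_termI valid_inst_type[OF d C]) (simp_all add: coherent_def)

lemma valid_N1_elim_eq:
  assumes C: "valid_type (N1 # \<Gamma>) C" and d: "valid_term_eq \<Gamma> d d' N1"
    and m: "valid_term_eq \<Gamma> m m' (inst 0 Star C)"
  shows "valid_term_eq \<Gamma> (ElN1 d m) (ElN1 d' m') (inst 0 d C)"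
proof -
  note d' = valid_term_eqD[OF d] and m' = valid_term_eqD[OF m]
  show ?thesis
    using N1_elim_cong[OF C d'(1) admissible_id[OF valid_term_ctxt[OF d'(1)]]] d'(3) m'(3)
    by (intro valid_term_eqI[OF valid_N1_elim[OF C d'(1) m'(1)] valid_N1_elim[OF C d'(2) m'(2)] valid_inst_eq[OF d C]])
      simp
qed

lemma valid_N1_beta:
  assumes C: "valid_type (N1 # \<Gamma>) C" and m: "valid_term \<Gamma> m (inst 0 Star C)"
  shows "valid_term_eq \<Gamma> (ElN1 Star m) m (inst 0 Star C)"
proof -
  have S: "valid_term \<Gamma> Star N1" using m by (intro valid_N1_intro valid_term_ctxt)
  note e = natural_inst0_id[OF C S]
  have "CC_ML \<rhd> map ty \<Gamma> \<turnstile> ElN1 Star (tm m) \<approx> tm m \<Colon> inst 0 Star (ty C)"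
    using valid_typeD_id[OF C] tm_conv[OF valid_termD_id[OF m] tyeq_sym[OF e]] by (intro N1_beta) simp_all
  then have "CC_ML \<rhd> map ty \<Gamma> \<turnstile> tm (ElN1 Star m) \<approx> tm m \<Colon> ty (inst 0 Star C)"
    using tmeq_conv[OF _ e] by simp
  then show ?thesis using valid_N1_elim[OF C S m] m by (simp add: valid_term_eq_def)
qed

section \<open>Disjoint sums\<close>

lemma valid_Plus_form:
  assumes A: "valid_type \<Gamma> A" and B: "valid_type \<Gamma> B"
  shows "valid_type \<Gamma> (Plus A B)"
proof (rule valid_typeI[OF valid_type_ctxt[OF A]])
  fix \<Theta> s assume g: "admissible \<Theta> s \<Gamma>"
  show "CC_ML \<rhd> \<Theta> \<turnstile> ty (subst s (Plus A B)) \<approx> subst (\<lambda>n. tm (s n)) (ty (Plus A B)) Type"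
    using Plus_form_eq[OF natural_typeD[OF A g] natural_typeD[OF B g]] by simp
qed

lemma valid_Plus_form_eq:
  assumes "valid_type_eq \<Gamma> A A'" "valid_type_eq \<Gamma> B B'"
  shows "valid_type_eq \<Gamma> (Plus A B) (Plus A' B')"
  using valid_type_eqD[OF assms(1)] valid_type_eqD[OF assms(2)]
  by (auto simp: valid_type_eq_def[of \<Gamma> "Plus A B"] intro: valid_Plus_form Plus_form_eq)

lemma valid_InL_intro:
  assumes B: "valid_type \<Gamma> B" and a: "valid_term \<Gamma> a A"
  shows "valid_term \<Gamma> (InL a) (Plus A B)"
proof (rule valid_termI)
  note A = valid_term_type[OF a]
  show "valid_type \<Gamma> (Plus A B)" using A B by (rule valid_Plus_form)
  fix \<Theta> s assume g: "admissible \<Theta> s \<Gamma>"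
  show "CC_ML \<rhd> \<Theta> \<turnstile> tm (subst s (InL a)) \<approx> subst (\<lambda>n. tm (s n)) (tm (InL a)) \<Colon> ty (subst s (Plus A B))"
    using InL_intro_eq[OF valid_typeD[OF A g] valid_typeD[OF B g] natural_termD[OF a g]] by simp
qed (simp add: coherent_def)

lemma valid_InL_intro_eq:
  assumes B: "valid_type \<Gamma> B" and a: "valid_term_eq \<Gamma> a a' A"
  shows "valid_term_eq \<Gamma> (InL a) (InL a') (Plus A B)"
proof -
  note a' = valid_term_eqD[OF a]
  show ?thesis
    using valid_InL_intro[OF B a'(1)] valid_InL_intro[OF B a'(2)]
      InL_intro_eq[OF valid_typeD_id[OF valid_term_type[OF a'(1)]] valid_typeD_id[OF B] a'(3)]
    by (simp add: valid_term_eq_def)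
qed

lemma valid_InR_intro:
  assumes A: "valid_type \<Gamma> A" and b: "valid_term \<Gamma> b B"
  shows "valid_term \<Gamma> (InR b) (Plus A B)"
proof (rule valid_termI)
  note B = valid_term_type[OF b]
  show "valid_type \<Gamma> (Plus A B)" using A B by (rule valid_Plus_form)
  fix \<Theta> s assume g: "admissible \<Theta> s \<Gamma>"
  show "CC_ML \<rhd> \<Theta> \<turnstile> tm (subst s (InR b)) \<approx> subst (\<lambda>n. tm (s n)) (tm (InR b)) \<Colon> ty (subst s (Plus A B))"
    using InR_intro_eq[OF valid_typeD[OF A g] valid_typeD[OF B g] natural_termD[OF b g]] by simp
qed (simp add: coherent_def)

lemma valid_InR_intro_eq:
  assumes A: "valid_type \<Gamma> A" and b: "valid_term_eq \<Gamma> b b' B"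
  shows "valid_term_eq \<Gamma> (InR b) (InR b') (Plus A B)"
proof -
  note b' = valid_term_eqD[OF b]
  show ?thesis
    using valid_InR_intro[OF A b'(1)] valid_InR_intro[OF A b'(2)]
      InR_intro_eq[OF valid_typeD_id[OF A] valid_typeD_id[OF valid_term_type[OF b'(1)]] b'(3)]
    by (simp add: valid_term_eq_def)
qed

lemma subst_branch_Plus:
  "subst (up s) (inst 1 (InL (Var 0)) C) = inst 1 (InL (Var 0)) (subst (up s) C)"
  "subst (up s) (inst 1 (InR (Var 0)) C) = inst 1 (InR (Var 0)) (subst (up s) C)"
  unfolding inst_def subst_norm
  by (rule subst_ext_Suc; simp add: subst_rename flip: rename_subst)+

lemma inst_branch_Plus:
  "inst 0 a (inst 1 (InL (Var 0)) C) = inst 0 (InL a) C"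
  "inst 0 a (inst 1 (InR (Var 0)) C) = inst 0 (InR a) C"
  unfolding inst_def subst_norm by (rule subst_ext_Suc; simp)+

lemma ren_ok_Suc1: "CC_ML \<rhd> A # \<Theta> \<turnstile> Ctxt \<Longrightarrow> ren_ok CC_ML (A # \<Theta>) (\<lambda>n. n + 1) \<Theta>"
  using ren_ok_Suc by simp

lemma natural_branch_InL:
  assumes C: "valid_type (Plus A B # \<Gamma>) C" and A: "valid_type \<Gamma> A" and B: "valid_type \<Gamma> B"
    and g: "admissible \<Theta> s \<Gamma>"
  shows "CC_ML \<rhd> ty (subst s A) # \<Theta> \<turnstile> ty (subst (up s) (inst 1 (InL (Var 0)) C))
     \<approx> inst 1 (InL (Var 0)) (ty (subst (up s) C)) Type"
proof -
  have c: "CC_ML \<rhd> ty (subst s A) # \<Theta> \<turnstile> Ctxt" by (rule ctxt_ext[OF valid_typeD[OF A g]])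
  have "CC_ML \<rhd> ty (subst s A) # \<Theta> \<turnstile> InL (Var 0) \<Colon> Plus (lift (ty (subst s A))) (lift (ty (subst s B)))"
    using lift_ok(1)[OF c] valid_typeD[OF A g] valid_typeD[OF B g] var[OF c, of 0]
    by (intro InL_intro) simp_all
  then show ?thesis
    using natural_inst[OF C g ren_ok_Suc1[OF c], of "InL (Var 0)"]
    by (simp add: subst_branch_Plus[simplified] coherent_def tyeq_sym)
qed

lemma natural_branch_InR:
  assumes C: "valid_type (Plus A B # \<Gamma>) C" and A: "valid_type \<Gamma> A" and B: "valid_type \<Gamma> B"
    and g: "admissible \<Theta> s \<Gamma>"
  shows "CC_ML \<rhd> ty (subst s B) # \<Theta> \<turnstile> ty (subst (up s) (inst 1 (InR (Var 0)) C))
     \<approx> inst 1 (InR (Var 0)) (ty (subst (up s) C)) Type"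
proof -
  have c: "CC_ML \<rhd> ty (subst s B) # \<Theta> \<turnstile> Ctxt" by (rule ctxt_ext[OF valid_typeD[OF B g]])
  have "CC_ML \<rhd> ty (subst s B) # \<Theta> \<turnstile> InR (Var 0) \<Colon> Plus (lift (ty (subst s A))) (lift (ty (subst s B)))"
    using lift_ok(1)[OF c] valid_typeD[OF A g] valid_typeD[OF B g] var[OF c, of 0]
    by (intro InR_intro) simp_all
  then show ?thesis
    using natural_inst[OF C g ren_ok_Suc1[OF c], of "InR (Var 0)"]
    by (simp add: subst_branch_Plus[simplified] coherent_def tyeq_sym)
qed

lemma Plus_elim_cong:
  assumes C: "valid_type (Plus A B # \<Gamma>) C" and A: "valid_type \<Gamma> A" and B: "valid_type \<Gamma> B"
    and d: "valid_term \<Gamma> d (Plus A B)" and g: "admissible \<Theta> s \<Gamma>"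
    and d': "CC_ML \<rhd> \<Theta> \<turnstile> tm (subst s d) \<approx> d' \<Colon> ty (subst s (Plus A B))"
    and m: "CC_ML \<rhd> ty (subst s A) # \<Theta> \<turnstile> m \<approx> m' \<Colon> ty (subst (up s) (inst 1 (InL (Var 0)) C))"
    and n: "CC_ML \<rhd> ty (subst s B) # \<Theta> \<turnstile> n \<approx> n' \<Colon> ty (subst (up s) (inst 1 (InR (Var 0)) C))"
  shows "CC_ML \<rhd> \<Theta> \<turnstile> ElPlus (tm (subst s d)) m n \<approx> ElPlus d' m' n' \<Colon> ty (subst s (inst 0 d C))"
  using type_left[OF natural_up_type[OF g C]] d'
  by (intro tmeq_conv[OF Plus_elim_eq[OF _ _ tmeq_conv[OF m natural_branch_InL[OF C A B g]]
        tmeq_conv[OF n natural_branch_InR[OF C A B g]]] natural_inst0[OF C d g]]) simp_all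

lemma valid_Plus_elim:
  assumes C: "valid_type (Plus A B # \<Gamma>) C" and d: "valid_term \<Gamma> d (Plus A B)"
    and m: "valid_term (A # \<Gamma>) m (inst 1 (InL (Var 0)) C)"
    and n: "valid_term (B # \<Gamma>) n (inst 1 (InR (Var 0)) C)"
  shows "valid_term \<Gamma> (ElPlus d m n) (inst 0 d C)"
proof (rule valid_termI)
  show "valid_type \<Gamma> (inst 0 d C)" by (rule valid_inst_type[OF d C])
  fix \<Theta> s assume g: "admissible \<Theta> s \<Gamma>"
  show "CC_ML \<rhd> \<Theta> \<turnstile> tm (subst s (ElPlus d m n)) \<approx> subst (\<lambda>n. tm (s n)) (tm (ElPlus d m n)) \<Colon> ty (subst s (inst 0 d C))"
    using Plus_elim_cong[OF C valid_term_tail[OF m] valid_term_tail[OF n] d g natural_termD[OF d g]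
        natural_up_term[OF g m] natural_up_term[OF g n]] by simp
qed (simp add: coherent_def)

lemma valid_Plus_elim_eq:
  assumes C: "valid_type (Plus A B # \<Gamma>) C" and d: "valid_term_eq \<Gamma> d d' (Plus A B)"
    and m: "valid_term_eq (A # \<Gamma>) m m' (inst 1 (InL (Var 0)) C)"
    and n: "valid_term_eq (B # \<Gamma>) n n' (inst 1 (InR (Var 0)) C)"
  shows "valid_term_eq \<Gamma> (ElPlus d m n) (ElPlus d' m' n') (inst 0 d C)"
proof -
  note d' = valid_term_eqD[OF d] and m' = valid_term_eqD[OF m] and n' = valid_term_eqD[OF n]
  show ?thesis
    using Plus_elim_cong[OF C valid_term_tail[OF m'(1)] valid_term_tail[OF n'(1)] d'(1)
        admissible_id[OF valid_term_ctxt[OF d'(1)]], of "tm d'" "tm m" "tm m'" "tm n" "tm n'"] d'(3) m'(3) n'(3)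
    by (intro valid_term_eqI[OF valid_Plus_elim[OF C d'(1) m'(1) n'(1)]
          valid_Plus_elim[OF C d'(2) m'(2) n'(2)] valid_inst_eq[OF d C]]) simp
qed

lemma valid_Plus_beta:
  assumes C: "valid_type (Plus A B # \<Gamma>) C"
    and m: "valid_term (A # \<Gamma>) m (inst 1 (InL (Var 0)) C)"
    and n: "valid_term (B # \<Gamma>) n (inst 1 (InR (Var 0)) C)"
  shows valid_Plus_beta_InL: "valid_term \<Gamma> a A \<Longrightarrow>
      valid_term_eq \<Gamma> (ElPlus (InL a) m n) (inst 0 a m) (inst 0 (InL a) C)"
    and valid_Plus_beta_InR: "valid_term \<Gamma> b B \<Longrightarrow>
      valid_term_eq \<Gamma> (ElPlus (InR b) m n) (inst 0 b n) (inst 0 (InR b) C)"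
proof -
  note A = valid_term_tail[OF m] and B = valid_term_tail[OF n]
  note g = admissible_id[OF valid_type_ctxt[OF A]]
  have C': "CC_ML \<rhd> Plus (ty A) (ty B) # map ty \<Gamma> \<turnstile> ty C Type"
    using valid_typeD_id[OF C] by simp
  have m': "CC_ML \<rhd> ty A # map ty \<Gamma> \<turnstile> tm m \<Colon> inst 1 (InL (Var 0)) (ty C)"
    using natural_branch_InL[OF C A B g] valid_termD_id[OF m] by (simp add: tm_conv)
  have n': "CC_ML \<rhd> ty B # map ty \<Gamma> \<turnstile> tm n \<Colon> inst 1 (InR (Var 0)) (ty C)"
    using natural_branch_InR[OF C A B g] valid_termD_id[OF n] by (simp add: tm_conv)
  {
    assume a: "valid_term \<Gamma> a A"
    note L = valid_InL_intro[OF B a]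
    have "CC_ML \<rhd> map ty \<Gamma> \<turnstile> ElPlus (InL (tm a)) (tm m) (tm n) \<approx> inst 0 (tm a) (tm m) \<Colon> ty (inst 0 (InL a) C)"
      using tmeq_conv[OF Plus_beta_InL[OF C' valid_termD_id[OF a] m' n']] natural_inst0_id[OF C L] by simp
    then have "CC_ML \<rhd> map ty \<Gamma> \<turnstile> tm (ElPlus (InL a) m n) \<approx> tm (inst 0 a m) \<Colon> ty (inst 0 (InL a) C)"
      using tmeq_trans[OF _ tm_inst[OF a m]] by (simp add: inst_branch_Plus[simplified])
    then show "valid_term_eq \<Gamma> (ElPlus (InL a) m n) (inst 0 a m) (inst 0 (InL a) C)"
      using valid_Plus_elim[OF C L m n] valid_inst_term[OF a m] by (simp add: valid_term_eq_def inst_branch_Plus[simplified])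
  next
    assume b: "valid_term \<Gamma> b B"
    note R = valid_InR_intro[OF A b]
    have "CC_ML \<rhd> map ty \<Gamma> \<turnstile> ElPlus (InR (tm b)) (tm m) (tm n) \<approx> inst 0 (tm b) (tm n) \<Colon> ty (inst 0 (InR b) C)"
      using tmeq_conv[OF Plus_beta_InR[OF C' valid_termD_id[OF b] m' n']] natural_inst0_id[OF C R] by simp
    then have "CC_ML \<rhd> map ty \<Gamma> \<turnstile> tm (ElPlus (InR b) m n) \<approx> tm (inst 0 b n) \<Colon> ty (inst 0 (InR b) C)"
      using tmeq_trans[OF _ tm_inst[OF b n]] by (simp add: inst_branch_Plus[simplified])
    then show "valid_term_eq \<Gamma> (ElPlus (InR b) m n) (inst 0 b n) (inst 0 (InR b) C)"
      using valid_Plus_elim[OF C R m n] valid_inst_term[OF b n] by (simp add: valid_term_eq_def inst_branch_Plus[simplified])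
  }
qed

section \<open>Lists\<close>

lemma valid_List_form:
  assumes A: "valid_type \<Gamma> A"
  shows "valid_type \<Gamma> (ListT A)"
proof (rule valid_typeI[OF valid_type_ctxt[OF A]])
  fix \<Theta> s assume g: "admissible \<Theta> s \<Gamma>"
  show "CC_ML \<rhd> \<Theta> \<turnstile> ty (subst s (ListT A)) \<approx> subst (\<lambda>n. tm (s n)) (ty (ListT A)) Type"
    using List_form_eq[OF natural_typeD[OF A g]] by simp
qed

lemma valid_List_form_eq: "valid_type_eq \<Gamma> A A' \<Longrightarrow> valid_type_eq \<Gamma> (ListT A) (ListT A')"
  by (auto simp: valid_type_eq_def intro: valid_List_form List_form_eq)

lemma valid_Eps_intro:
  assumes A: "valid_type \<Gamma> A"
  shows "valid_term \<Gamma> Eps (ListT A)"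
proof (rule valid_termI[OF valid_List_form[OF A]])
  fix \<Theta> s assume g: "admissible \<Theta> s \<Gamma>"
  show "CC_ML \<rhd> \<Theta> \<turnstile> tm (subst s Eps) \<approx> subst (\<lambda>n. tm (s n)) (tm Eps) \<Colon> ty (subst s (ListT A))"
    using tmeq_refl[OF Eps_intro[OF valid_typeD[OF A g]]] by simp
qed (simp add: coherent_def)

lemma valid_Cons_intro:
  assumes a: "valid_term \<Gamma> a A" and l: "valid_term \<Gamma> l (ListT A)"
  shows "valid_term \<Gamma> (ConsT a l) (ListT A)"
proof (rule valid_termI[OF valid_term_type[OF l]])
  fix \<Theta> s assume g: "admissible \<Theta> s \<Gamma>"
  show "CC_ML \<rhd> \<Theta> \<turnstile> tm (subst s (ConsT a l)) \<approx> subst (\<lambda>n. tm (s n)) (tm (ConsT a l)) \<Colon> ty (subst s (ListT A))"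
    using Cons_intro_eq[OF valid_typeD[OF valid_term_type[OF a] g] natural_termD[OF a g]] natural_termD[OF l g] by simp
qed (simp add: coherent_def)

lemma valid_Cons_intro_eq:
  assumes a: "valid_term_eq \<Gamma> a a' A" and l: "valid_term_eq \<Gamma> l l' (ListT A)"
  shows "valid_term_eq \<Gamma> (ConsT a l) (ConsT a' l') (ListT A)"
proof -
  note a' = valid_term_eqD[OF a] and l' = valid_term_eqD[OF l]
  show ?thesis
    using valid_Cons_intro[OF a'(1) l'(1)] valid_Cons_intro[OF a'(2) l'(2)]
      Cons_intro_eq[OF valid_typeD_id[OF valid_term_type[OF a'(1)]] a'(3)] l'(3)
    by (simp add: valid_term_eq_def)
qed

lemma subst_branch_List:
  "subst (up (up s)) (inst 2 (Var 0) C) = inst 2 (Var 0) (subst (up s) C)"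
  "subst (up (up (up s))) (inst 3 (ConsT (Var 2) (Var 1)) C) = inst 3 (ConsT (Var 2) (Var 1)) (subst (up s) C)"
  unfolding inst_def subst_norm
  by (rule subst_ext_Suc; simp add: subst_rename rename_rename eval_nat_numeral flip: rename_subst)+

text \<open>
  The type of the recursive value is itself an instance of the motive. So both the context and
  the type of the step have to be converted, the type in the translated context first.
\<close>
lemma natural_branch_List:
  assumes C: "valid_type (ListT A # \<Gamma>) C" and A: "valid_type \<Gamma> A" and g: "admissible \<Theta> s \<Gamma>"
    and n: "CC_ML \<rhd> ty (subst (up (up s)) (inst 2 (Var 0) C)) # ListT (lift (ty (subst s A))) # ty (subst s A) # \<Theta> \<turnstile>
        n \<approx> n' \<Colon> ty (subst (up (up (up s))) (inst 3 (ConsT (Var 2) (Var 1)) C))"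
  shows "CC_ML \<rhd> inst 2 (Var 0) (ty (subst (up s) C)) # ListT (lift (ty (subst s A))) # ty (subst s A) # \<Theta> \<turnstile>
        n \<approx> n' \<Colon> inst 3 (ConsT (Var 2) (Var 1)) (ty (subst (up s) C))"
proof -
  let ?A = "ty (subst s A)" and ?C = "ty (subst (up s) C)"
  let ?\<Xi>2 = "ListT (lift ?A) # ?A # \<Theta>"
  let ?\<Xi>3 = "ty (subst (up (up s)) (inst 2 (Var 0) C)) # ?\<Xi>2"
  have c3: "CC_ML \<rhd> ?\<Xi>3 \<turnstile> Ctxt" using n by (rule judgement_ctxt)
  have c2: "CC_ML \<rhd> ?\<Xi>2 \<turnstile> Ctxt" using ctxt_ConsD[OF c3] by (rule judgement_ctxt)
  have v2: "CC_ML \<rhd> ?\<Xi>2 \<turnstile> Var 0 \<Colon> rename (\<lambda>n. n + 2) (ty (subst s (ListT A)))"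
    using var[OF c2, of 0] by (simp add: rename_rename)
  have "ren_ok CC_ML ?\<Xi>2 (\<lambda>n. n + 2) \<Theta>" using c2 by (rule ren_ok_shift) simp
  from natural_inst[OF C g this, of "Var 0"] v2
  have e2: "CC_ML \<rhd> ?\<Xi>2 \<turnstile> ty (subst (up (up s)) (inst 2 (Var 0) C)) \<approx> inst 2 (Var 0) ?C Type"
    by (simp only: subst_branch_List tm_simps coherent_Var simp_thms tyeq_sym)
  have v3: "CC_ML \<rhd> ?\<Xi>3 \<turnstile> Var 1 \<Colon> rename (\<lambda>n. n + 3) (ty (subst s (ListT A)))"
    "CC_ML \<rhd> ?\<Xi>3 \<turnstile> Var 2 \<Colon> rename (\<lambda>n. n + 3) ?A"
    using var[OF c3, of 1] var[OF c3, of 2] by (simp_all add: rename_rename eval_nat_numeral)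
  have "CC_ML \<rhd> ?\<Xi>3 \<turnstile> rename (\<lambda>n. n + 3) ?A Type" using v3(2) by (rule presuppositions)
  then have v3': "CC_ML \<rhd> ?\<Xi>3 \<turnstile> tm (ConsT (Var 2) (Var 1)) \<Colon> rename (\<lambda>n. n + 3) (ty (subst s (ListT A)))"
    using v3 Cons_intro by simp
  have "ren_ok CC_ML ?\<Xi>3 (\<lambda>n. n + 3) \<Theta>" using c3 by (rule ren_ok_shift) (simp add: eval_nat_numeral)
  from natural_inst[OF C g this v3']
  have "CC_ML \<rhd> ?\<Xi>3 \<turnstile> ty (subst (up (up (up s))) (inst 3 (ConsT (Var 2) (Var 1)) C))
     \<approx> inst 3 (ConsT (Var 2) (Var 1)) ?C Type"
    by (simp only: subst_branch_List tm_simps coherent_def ty_simps simp_thms tyeq_sym)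
  from ctxt_conv_term_eq[OF e2 type_right[OF e2] tmeq_conv[OF n this]] show ?thesis .
qed

lemma List_elim_cong:
  assumes C: "valid_type (ListT A # \<Gamma>) C" and A: "valid_type \<Gamma> A"
    and l: "valid_term \<Gamma> l (ListT A)" and g: "admissible \<Theta> s \<Gamma>"
    and l': "CC_ML \<rhd> \<Theta> \<turnstile> tm (subst s l) \<approx> l' \<Colon> ty (subst s (ListT A))"
    and m: "CC_ML \<rhd> \<Theta> \<turnstile> m \<approx> m' \<Colon> ty (subst s (inst 0 Eps C))"
    and n: "CC_ML \<rhd> ty (subst (up (up s)) (inst 2 (Var 0) C)) # ListT (lift (ty (subst s A))) # ty (subst s A) # \<Theta> \<turnstile>
        n \<approx> n' \<Colon> ty (subst (up (up (up s))) (inst 3 (ConsT (Var 2) (Var 1)) C))"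
  shows "CC_ML \<rhd> \<Theta> \<turnstile> ElList (tm (subst s l)) m n \<approx> ElList l' m' n' \<Colon> ty (subst s (inst 0 l C))"
proof -
  have "CC_ML \<rhd> \<Theta> \<turnstile> m \<approx> m' \<Colon> inst 0 Eps (ty (subst (up s) C))"
    using tmeq_conv[OF m tyeq_sym[OF natural_inst0[OF C valid_Eps_intro[OF A] g]]] by simp
  from tmeq_conv[OF List_elim_eq[OF _ _ this natural_branch_List[OF C A g n]] natural_inst0[OF C l g]]
  show ?thesis using type_left[OF natural_up_type[OF g C]] l' by simp
qed

lemma natural_step_List:
  assumes n: "valid_term (D # ListT (lift A) # A # \<Gamma>) n E" and g: "admissible \<Theta> s \<Gamma>"
  shows "CC_ML \<rhd> ty (subst (up (up s)) D) # ListT (lift (ty (subst s A))) # ty (subst s A) # \<Theta> \<turnstile>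
      tm (subst (up (up (up s))) n) \<approx> subst (up (up (up (\<lambda>n. tm (s n))))) (tm n) \<Colon> ty (subst (up (up (up s))) E)"
proof -
  have D: "valid_type (ListT (lift A) # A # \<Gamma>) D" using n by (rule valid_term_tail)
  note L = valid_type_tail[OF D] and A = valid_type_tail[OF valid_type_tail[OF D]]
  note gA = admissible_Cons[OF g valid_type_ctxt[OF L]]
  note gL = admissible_Cons[OF gA valid_type_ctxt[OF D]]
  show ?thesis using natural_up_term[OF gL n] by (simp add: tm_up subst_up_lift)
qed

lemma valid_List_elim:
  assumes C: "valid_type (ListT A # \<Gamma>) C" and l: "valid_term \<Gamma> l (ListT A)"
    and m: "valid_term \<Gamma> m (inst 0 Eps C)"
    and n: "valid_term (inst 2 (Var 0) C # ListT (lift A) # A # \<Gamma>) n (inst 3 (ConsT (Var 2) (Var 1)) C)"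
  shows "valid_term \<Gamma> (ElList l m n) (inst 0 l C)"
proof (rule valid_termI)
  have A: "valid_type \<Gamma> A" using valid_type_tail[OF valid_type_tail[OF valid_term_tail[OF n]]] .
  show "valid_type \<Gamma> (inst 0 l C)" by (rule valid_inst_type[OF l C])
  fix \<Theta> s assume g: "admissible \<Theta> s \<Gamma>"
  show "CC_ML \<rhd> \<Theta> \<turnstile> tm (subst s (ElList l m n)) \<approx> subst (\<lambda>n. tm (s n)) (tm (ElList l m n)) \<Colon> ty (subst s (inst 0 l C))"
    using List_elim_cong[OF C A l g natural_termD[OF l g] natural_termD[OF m g] natural_step_List[OF n g]] by simp
qed (simp add: coherent_def)

lemma valid_List_elim_eq:
  assumes C: "valid_type (ListT A # \<Gamma>) C" and l: "valid_term_eq \<Gamma> l l' (ListT A)"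
    and m: "valid_term_eq \<Gamma> m m' (inst 0 Eps C)"
    and n: "valid_term_eq (inst 2 (Var 0) C # ListT (lift A) # A # \<Gamma>) n n' (inst 3 (ConsT (Var 2) (Var 1)) C)"
  shows "valid_term_eq \<Gamma> (ElList l m n) (ElList l' m' n') (inst 0 l C)"
proof -
  note l' = valid_term_eqD[OF l] and m' = valid_term_eqD[OF m] and n' = valid_term_eqD[OF n]
  have A: "valid_type \<Gamma> A" using valid_type_tail[OF valid_type_tail[OF valid_term_tail[OF n'(1)]]] .
  show ?thesis
    using List_elim_cong[OF C A l'(1) admissible_id[OF valid_term_ctxt[OF l'(1)]], of "tm l'" "tm m" "tm m'" "tm n" "tm n'"]
      l'(3) m'(3) n'(3)
    by (intro valid_term_eqI[OF valid_List_elim[OF C l'(1) m'(1) n'(1)]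
          valid_List_elim[OF C l'(2) m'(2) n'(2)] valid_inst_eq[OF l C]]) simp
qed

lemma valid_List_beta_premises:
  assumes C: "valid_type (ListT A # \<Gamma>) C" and m: "valid_term \<Gamma> m (inst 0 Eps C)"
    and n: "valid_term (inst 2 (Var 0) C # ListT (lift A) # A # \<Gamma>) n (inst 3 (ConsT (Var 2) (Var 1)) C)"
  shows "valid_type \<Gamma> A" "CC_ML \<rhd> ListT (ty A) # map ty \<Gamma> \<turnstile> ty C Type"
    "CC_ML \<rhd> map ty \<Gamma> \<turnstile> tm m \<Colon> inst 0 Eps (ty C)"
    "CC_ML \<rhd> inst 2 (Var 0) (ty C) # ListT (lift (ty A)) # ty A # map ty \<Gamma> \<turnstile>
       tm n \<Colon> inst 3 (ConsT (Var 2) (Var 1)) (ty C)"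
proof -
  show A: "valid_type \<Gamma> A" using valid_type_tail[OF valid_type_tail[OF valid_term_tail[OF n]]] .
  show "CC_ML \<rhd> ListT (ty A) # map ty \<Gamma> \<turnstile> ty C Type" using valid_typeD_id[OF C] by simp
  show "CC_ML \<rhd> map ty \<Gamma> \<turnstile> tm m \<Colon> inst 0 Eps (ty C)"
    using tm_conv[OF valid_termD_id[OF m] tyeq_sym[OF natural_inst0_id[OF C valid_Eps_intro[OF A]]]] by simp
  show "CC_ML \<rhd> inst 2 (Var 0) (ty C) # ListT (lift (ty A)) # ty A # map ty \<Gamma> \<turnstile>
       tm n \<Colon> inst 3 (ConsT (Var 2) (Var 1)) (ty C)"
    using natural_branch_List[OF C A admissible_id[OF valid_type_ctxt[OF A]], of "tm n" "tm n"] tmeq_refl[OF valid_termD_id[OF n]]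
    by (auto dest: tm_left)
qed

lemma valid_List_beta_Eps:
  assumes C: "valid_type (ListT A # \<Gamma>) C" and m: "valid_term \<Gamma> m (inst 0 Eps C)"
    and n: "valid_term (inst 2 (Var 0) C # ListT (lift A) # A # \<Gamma>) n (inst 3 (ConsT (Var 2) (Var 1)) C)"
  shows "valid_term_eq \<Gamma> (ElList Eps m n) m (inst 0 Eps C)"
proof -
  note p = valid_List_beta_premises[OF C m n]
  note E = valid_Eps_intro[OF p(1)]
  show ?thesis
    using tmeq_conv[OF List_beta_Eps[OF p(2,3,4)]] natural_inst0_id[OF C E] valid_List_elim[OF C E m n] m
    by (simp add: valid_term_eq_def)
qed

lemma valid_List_beta_Cons:
  assumes C: "valid_type (ListT A # \<Gamma>) C" and a: "valid_term \<Gamma> a A" and l: "valid_term \<Gamma> l (ListT A)"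
    and m: "valid_term \<Gamma> m (inst 0 Eps C)"
    and n: "valid_term (inst 2 (Var 0) C # ListT (lift A) # A # \<Gamma>) n (inst 3 (ConsT (Var 2) (Var 1)) C)"
  shows "valid_term_eq \<Gamma> (ElList (ConsT a l) m n) (subst (ElList l m n \<cdot> l \<cdot> a \<cdot> Var) n) (inst 0 (ConsT a l) C)"
proof -
  note p = valid_List_beta_premises[OF C m n]
  note K = valid_Cons_intro[OF a l] and e = valid_List_elim[OF C l m n]
  let ?s = "ElList l m n \<cdot> l \<cdot> a \<cdot> Var"
  have 2: "subst (l \<cdot> a \<cdot> Var) (inst 2 (Var 0) C) = inst 0 l C"
    unfolding inst_def subst_norm by (rule subst_ext_Suc) simp_all
  have 3: "subst ?s (inst 3 (ConsT (Var 2) (Var 1)) C) = inst 0 (ConsT a l) C"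
    unfolding inst_def subst_norm by (rule subst_ext_Suc) (simp_all add: eval_nat_numeral)
  have s: "valid_subst \<Gamma> ?s (inst 2 (Var 0) C # ListT (lift A) # A # \<Gamma>)"
    using a l e by (intro valid_subst_scons valid_subst_id valid_term_ctxt[OF a]) (simp_all add: 2 subst_rename)
  have "CC_ML \<rhd> map ty \<Gamma> \<turnstile> tm (ElList (ConsT a l) m n) \<approx> subst (\<lambda>n. tm (?s n)) (tm n) \<Colon> ty (inst 0 (ConsT a l) C)"
    using tmeq_conv[OF List_beta_Cons[OF p(2) valid_termD_id[OF a] _ p(3,4)] natural_inst0_id[OF C K, simplified]] valid_termD_id[OF l] by simp
  moreover have "CC_ML \<rhd> map ty \<Gamma> \<turnstile> subst (\<lambda>n. tm (?s n)) (tm n) \<approx> tm (subst ?s n) \<Colon> ty (inst 0 (ConsT a l) C)"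
    using tmeq_sym[OF natural_termD[OF n valid_subst_good[OF s]]] unfolding 3 .
  ultimately show ?thesis
    using valid_List_elim[OF C K m n] valid_tm_subst[OF s n] unfolding 3 valid_term_eq_def
    by (blast intro: tmeq_trans)
qed

section \<open>Dependent sums\<close>

lemma valid_Sig_form:
  assumes B: "valid_type (A # \<Gamma>) B"
  shows "valid_type \<Gamma> (Sig A B)"
proof -
  note A = valid_type_tail[OF B]
  show ?thesis
  proof (rule valid_typeI[OF valid_type_ctxt[OF A]])
    fix \<Theta> s assume g: "admissible \<Theta> s \<Gamma>"
    show "CC_ML \<rhd> \<Theta> \<turnstile> ty (subst s (Sig A B)) \<approx> subst (\<lambda>n. tm (s n)) (ty (Sig A B)) Type"
      using Sig_form_eq[OF natural_typeD[OF A g] natural_up_type[OF g B]] by simp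
  qed
qed

lemma valid_Sig_form_eq:
  assumes "valid_type_eq \<Gamma> A A'" "valid_type_eq (A # \<Gamma>) B B'"
  shows "valid_type_eq \<Gamma> (Sig A B) (Sig A' B')"
  using valid_type_eqD[OF assms(1)] valid_type_eqD[OF assms(2)]
  unfolding valid_type_eq_def[of \<Gamma> "Sig A B"]
  by (auto intro: valid_Sig_form valid_ctxt_conv_type[OF assms(1)] Sig_form_eq)

lemma Sig_intro_cong:
  assumes B: "valid_type (A # \<Gamma>) B" and a: "valid_term \<Gamma> a A" and g: "admissible \<Theta> s \<Gamma>"
    and a': "CC_ML \<rhd> \<Theta> \<turnstile> tm (subst s a) \<approx> a' \<Colon> ty (subst s A)"
    and b: "CC_ML \<rhd> \<Theta> \<turnstile> b \<approx> b' \<Colon> ty (subst s (inst 0 a B))"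
  shows "CC_ML \<rhd> \<Theta> \<turnstile> PairT (tm (subst s a)) b \<approx> PairT a' b' \<Colon> ty (subst s (Sig A B))"
  using Sig_intro_eq[OF tm_type[OF a'] type_left[OF natural_up_type[OF g B]] a' tmeq_conv[OF b tyeq_sym[OF natural_inst0[OF B a g]]]]
  by simp

lemma valid_Sig_intro:
  assumes B: "valid_type (A # \<Gamma>) B" and a: "valid_term \<Gamma> a A" and b: "valid_term \<Gamma> b (inst 0 a B)"
  shows "valid_term \<Gamma> (PairT a b) (Sig A B)"
proof (rule valid_termI[OF valid_Sig_form[OF B]])
  fix \<Theta> s assume g: "admissible \<Theta> s \<Gamma>"
  show "CC_ML \<rhd> \<Theta> \<turnstile> tm (subst s (PairT a b)) \<approx> subst (\<lambda>n. tm (s n)) (tm (PairT a b)) \<Colon> ty (subst s (Sig A B))"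
    using Sig_intro_cong[OF B a g natural_termD[OF a g] natural_termD[OF b g]] by simp
qed (simp add: coherent_def)

lemma valid_Sig_intro_eq:
  assumes B: "valid_type (A # \<Gamma>) B" and a: "valid_term_eq \<Gamma> a a' A" and b: "valid_term_eq \<Gamma> b b' (inst 0 a B)"
  shows "valid_term_eq \<Gamma> (PairT a b) (PairT a' b') (Sig A B)"
proof -
  note a' = valid_term_eqD[OF a] and b' = valid_term_eqD[OF b]
  have "valid_term \<Gamma> b' (inst 0 a' B)"
    using b'(2) valid_type_eq_sym[OF valid_inst_eq[OF a B]] by (rule valid_tm_conv)
  then show ?thesis
    using valid_Sig_intro[OF B a'(1) b'(1)] valid_Sig_intro[OF B a'(2)] a'(3) b'(3)
      Sig_intro_cong[OF B a'(1) admissible_id[OF valid_term_ctxt[OF a'(1)]], of "tm a'" "tm b" "tm b'"]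
    by (simp add: valid_term_eq_def)
qed

lemma subst_branch_Sig:
  "subst (up (up s)) (inst 2 (PairT (Var 1) (Var 0)) C) = inst 2 (PairT (Var 1) (Var 0)) (subst (up s) C)"
  unfolding inst_def subst_norm
  by (rule subst_ext_Suc; simp add: subst_rename rename_rename eval_nat_numeral flip: rename_subst)

lemma natural_branch_Sig:
  assumes C: "valid_type (Sig A B # \<Gamma>) C" and B: "valid_type (A # \<Gamma>) B" and g: "admissible \<Theta> s \<Gamma>"
  shows "CC_ML \<rhd> ty (subst (up s) B) # ty (subst s A) # \<Theta> \<turnstile>
     ty (subst (up (up s)) (inst 2 (PairT (Var 1) (Var 0)) C))
     \<approx> inst 2 (PairT (Var 1) (Var 0)) (ty (subst (up s) C)) Type"
proof -
  let ?A = "ty (subst s A)" and ?B = "ty (subst (up s) B)"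
  let ?\<Xi> = "?B # ?A # \<Theta>"
  note gA = admissible_Cons[OF g valid_type_ctxt[OF B]]
  have cA: "CC_ML \<rhd> ?A # \<Theta> \<turnstile> Ctxt" using gA by (rule admissible_ctxt)
  have c: "CC_ML \<rhd> ?\<Xi> \<turnstile> Ctxt" using valid_typeD[OF B gA] by (rule ctxt_ext)
  have r: "ren_ok CC_ML ?\<Xi> (\<lambda>n. n + 2) \<Theta>" using c by (rule ren_ok_shift) simp
  have A2: "CC_ML \<rhd> ?\<Xi> \<turnstile> rename (\<lambda>n. n + 2) ?A Type"
    using rename_ok_type[OF r ctxt_ConsD[OF cA]] .
  have B2: "CC_ML \<rhd> rename (\<lambda>n. n + 2) ?A # ?\<Xi> \<turnstile> rename (up_ren (\<lambda>n. n + 2)) ?B Type"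
    using rename_ok_type[OF ren_ok_up[OF r ctxt_ext[OF A2]] valid_typeD[OF B gA]] .
  have v1: "CC_ML \<rhd> ?\<Xi> \<turnstile> Var 1 \<Colon> rename (\<lambda>n. n + 2) ?A"
    using var[OF c, of 1] by (simp add: rename_rename)
  have "inst 0 (Var 1) (rename (up_ren (\<lambda>n. n + 2)) ?B) = lift ?B"
    unfolding inst_def subst_rename rename_subst[of Suc] by (rule subst_ext_Suc) simp_all
  then have v0: "CC_ML \<rhd> ?\<Xi> \<turnstile> Var 0 \<Colon> inst 0 (Var 1) (rename (up_ren (\<lambda>n. n + 2)) ?B)"
    using var[OF c, of 0] by simp
  have "CC_ML \<rhd> ?\<Xi> \<turnstile> tm (PairT (Var 1) (Var 0)) \<Colon> rename (\<lambda>n. n + 2) (ty (subst s (Sig A B)))"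
    using Sig_intro[OF A2 B2 v1 v0] by simp
  from natural_inst[OF C g r this] show ?thesis
    by (simp only: subst_branch_Sig tm_simps ty_simps coherent_def simp_thms tyeq_sym)
qed

lemma Sig_elim_cong:
  assumes C: "valid_type (Sig A B # \<Gamma>) C" and B: "valid_type (A # \<Gamma>) B"
    and d: "valid_term \<Gamma> d (Sig A B)" and g: "admissible \<Theta> s \<Gamma>"
    and d': "CC_ML \<rhd> \<Theta> \<turnstile> tm (subst s d) \<approx> d' \<Colon> ty (subst s (Sig A B))"
    and m: "CC_ML \<rhd> ty (subst (up s) B) # ty (subst s A) # \<Theta> \<turnstile> m \<approx> m'
      \<Colon> ty (subst (up (up s)) (inst 2 (PairT (Var 1) (Var 0)) C))"
  shows "CC_ML \<rhd> \<Theta> \<turnstile> ElSig (tm (subst s d)) m \<approx> ElSig d' m' \<Colon> ty (subst s (inst 0 d C))"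
  using type_left[OF natural_up_type[OF g C]] d'
  by (intro tmeq_conv[OF Sig_elim_eq[OF _ _ tmeq_conv[OF m natural_branch_Sig[OF C B g]]] natural_inst0[OF C d g]])
    simp_all

lemma valid_Sig_elim:
  assumes C: "valid_type (Sig A B # \<Gamma>) C" and d: "valid_term \<Gamma> d (Sig A B)"
    and m: "valid_term (B # A # \<Gamma>) m (inst 2 (PairT (Var 1) (Var 0)) C)"
  shows "valid_term \<Gamma> (ElSig d m) (inst 0 d C)"
proof (rule valid_termI)
  note B = valid_term_tail[OF m]
  show "valid_type \<Gamma> (inst 0 d C)" by (rule valid_inst_type[OF d C])
  fix \<Theta> s assume g: "admissible \<Theta> s \<Gamma>"
  note gA = admissible_Cons[OF g valid_type_ctxt[OF B]]
  show "CC_ML \<rhd> \<Theta> \<turnstile> tm (subst s (ElSig d m)) \<approx> subst (\<lambda>n. tm (s n)) (tm (ElSig d m)) \<Colon> ty (subst s (inst 0 d C))"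
    using Sig_elim_cong[OF C B d g natural_termD[OF d g] natural_up_term[OF gA m]] by (simp add: tm_up)
qed (simp add: coherent_def)

lemma valid_Sig_elim_eq:
  assumes C: "valid_type (Sig A B # \<Gamma>) C" and d: "valid_term_eq \<Gamma> d d' (Sig A B)"
    and m: "valid_term_eq (B # A # \<Gamma>) m m' (inst 2 (PairT (Var 1) (Var 0)) C)"
  shows "valid_term_eq \<Gamma> (ElSig d m) (ElSig d' m') (inst 0 d C)"
proof -
  note d' = valid_term_eqD[OF d] and m' = valid_term_eqD[OF m]
  show ?thesis
    using Sig_elim_cong[OF C valid_term_tail[OF m'(1)] d'(1) admissible_id[OF valid_term_ctxt[OF d'(1)]], of "tm d'" "tm m" "tm m'"]
      d'(3) m'(3)
    by (intro valid_term_eqI[OF valid_Sig_elim[OF C d'(1) m'(1)] valid_Sig_elim[OF C d'(2) m'(2)] valid_inst_eq[OF d C]])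
      simp
qed

lemma valid_Sig_beta:
  assumes C: "valid_type (Sig A B # \<Gamma>) C" and a: "valid_term \<Gamma> a A" and b: "valid_term \<Gamma> b (inst 0 a B)"
    and m: "valid_term (B # A # \<Gamma>) m (inst 2 (PairT (Var 1) (Var 0)) C)"
  shows "valid_term_eq \<Gamma> (ElSig (PairT a b) m) (subst (b \<cdot> a \<cdot> Var) m) (inst 0 (PairT a b) C)"
proof -
  note B = valid_term_tail[OF m]
  note P = valid_Sig_intro[OF B a b] and g = admissible_id[OF valid_term_ctxt[OF a]]
  let ?s = "b \<cdot> a \<cdot> Var"
  have 3: "subst ?s (inst 2 (PairT (Var 1) (Var 0)) C) = inst 0 (PairT a b) C"
    unfolding inst_def subst_norm by (rule subst_ext_Suc) (simp_all add: eval_nat_numeral)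
  have s: "valid_subst \<Gamma> ?s (B # A # \<Gamma>)"
    using a b by (intro valid_subst_scons valid_subst_id valid_term_ctxt[OF a]) (simp_all add: inst0)
  have C': "CC_ML \<rhd> Sig (ty A) (ty B) # map ty \<Gamma> \<turnstile> ty C Type" using valid_typeD_id[OF C] by simp
  have b': "CC_ML \<rhd> map ty \<Gamma> \<turnstile> tm b \<Colon> inst 0 (tm a) (ty B)"
    using tm_conv[OF valid_termD_id[OF b] tyeq_sym[OF natural_inst0_id[OF B a]]] .
  have m': "CC_ML \<rhd> ty B # ty A # map ty \<Gamma> \<turnstile> tm m \<Colon> inst 2 (PairT (Var 1) (Var 0)) (ty C)"
    using natural_branch_Sig[OF C B g] valid_termD_id[OF m] by (simp add: tm_conv)
  have "CC_ML \<rhd> map ty \<Gamma> \<turnstile> tm (ElSig (PairT a b) m) \<approx> subst (\<lambda>n. tm (?s n)) (tm m) \<Colon> ty (inst 0 (PairT a b) C)"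
    using tmeq_conv[OF Sig_beta[OF C' valid_termD_id[OF a] b' m']] natural_inst0_id[OF C P] by simp
  moreover have "CC_ML \<rhd> map ty \<Gamma> \<turnstile> subst (\<lambda>n. tm (?s n)) (tm m) \<approx> tm (subst ?s m) \<Colon> ty (inst 0 (PairT a b) C)"
    using tmeq_sym[OF natural_termD[OF m valid_subst_good[OF s]]] unfolding 3 .
  ultimately show ?thesis
    using valid_Sig_elim[OF C P m] valid_tm_subst[OF s m] unfolding 3 valid_term_eq_def
    by (blast intro: tmeq_trans)
qed

section \<open>Soundness and equiconsistency\<close>

lemma LEM_closed: "subst s LEM = LEM"
  by (simp add: LEM_def Disj_def eval_nat_numeral subst_up_lift)

lemma valid_LEM:
  assumes "valid_ctxt \<Gamma>"
  shows "valid_type \<Gamma> LEM"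
proof (rule valid_typeI[OF assms])
  have E: "subst s EM = EM" for s by (simp add: EM_def)
  fix \<Theta> s assume g: "admissible \<Theta> s \<Gamma>"
  show "CC_ML \<rhd> \<Theta> \<turnstile> ty (subst s LEM) \<approx> subst (\<lambda>n. tm (s n)) (ty LEM) Type"
    unfolding LEM_closed E ty_LEM using em_type[OF admissible_ctxt[OF g]] by (intro tyeq_refl presuppositions)
qed

lemma valid_lem:
  assumes "valid_ctxt \<Gamma>"
  shows "valid_term \<Gamma> Lem LEM"
proof (rule valid_termI[OF valid_LEM[OF assms]])
  fix \<Theta> s assume g: "admissible \<Theta> s \<Gamma>"
  show "CC_ML \<rhd> \<Theta> \<turnstile> tm (subst s Lem) \<approx> subst (\<lambda>n. tm (s n)) (tm Lem) \<Colon> ty (subst s LEM)"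
    unfolding LEM_closed ty_LEM using em_type[OF admissible_ctxt[OF g]] by (simp add: tmeq_refl)
qed (simp add: coherent_def)

text \<open>
  The rule for \<open>Lem\<close> is sound by \<open>em_type\<close>, so one induction covers both theories.
\<close>
theorem soundness:
  "T \<rhd> \<Gamma> \<turnstile> Ctxt \<Longrightarrow> valid_ctxt \<Gamma>"
  "T \<rhd> \<Gamma> \<turnstile> A Type \<Longrightarrow> valid_type \<Gamma> A"
  "T \<rhd> \<Gamma> \<turnstile> A \<approx> B Type \<Longrightarrow> valid_type_eq \<Gamma> A B"
  "T \<rhd> \<Gamma> \<turnstile> a \<Colon> A \<Longrightarrow> valid_term \<Gamma> a A"
  "T \<rhd> \<Gamma> \<turnstile> a \<approx> b \<Colon> A \<Longrightarrow> valid_term_eq \<Gamma> a b A"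
proof (induction rule: is_ctxt_is_type_type_eq_has_type_term_eq.inducts)
  case (ty_subst \<Gamma> \<Delta> s A)
  then show ?case by (intro valid_ty_subst[where \<Delta> = \<Delta>]) (auto simp: valid_subst_def)
next
  case (tyeq_subst \<Gamma> \<Delta> s A B)
  then show ?case by (intro valid_tyeq_subst[where \<Delta> = \<Delta>]) (auto simp: valid_subst_def)
next
  case (tm_subst \<Gamma> \<Delta> s a A)
  then show ?case by (intro valid_tm_subst[where \<Delta> = \<Delta>]) (auto simp: valid_subst_def)
next
  case (tmeq_subst \<Gamma> \<Delta> s a b A)
  then show ?case by (intro valid_tmeq_subst[where \<Delta> = \<Delta>]) (auto simp: valid_subst_def)
next
  case (ty_subst_eq \<Gamma> \<Delta> s t A)
  then show ?case
    by (intro valid_ty_subst_eq[where \<Delta> = \<Delta>]) (auto simp: valid_subst_def valid_subst_eq_def)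
next
  case (tm_subst_eq \<Gamma> \<Delta> s t a A)
  then show ?case
    by (intro valid_tm_subst_eq[where \<Delta> = \<Delta>]) (auto simp: valid_subst_def valid_subst_eq_def)
next
  case (tyeq_trans \<Gamma> A B C)
  then show ?case
    unfolding valid_type_eq_def by (blast intro: is_ctxt_is_type_type_eq_has_type_term_eq.tyeq_trans)
next
  case (tmeq_sym \<Gamma> a b A)
  then show ?case
    unfolding valid_term_eq_def by (blast intro: is_ctxt_is_type_type_eq_has_type_term_eq.tmeq_sym)
next
  case (tmeq_trans \<Gamma> a b c A)
  then show ?case
    unfolding valid_term_eq_def by (blast intro: is_ctxt_is_type_type_eq_has_type_term_eq.tmeq_trans)
next
  case ctxt_empty
  show ?case by simp
next
  case (ctxt_ext \<Gamma> A)
  then show ?case by simp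
qed (rule valid_var valid_type_eq_refl valid_type_eq_sym valid_term_eq_refl
    valid_Prp_form valid_Prp_type valid_Prp_type_eq valid_Pi_form valid_Pi_form_eq
    valid_All_form valid_All_form_eq valid_Pi_intro valid_Pi_intro_eq
    valid_Pi_elim valid_Pi_elim_eq valid_Pi_beta
    valid_N0_form valid_N0_elim valid_N0_elim_eq
    valid_N1_form valid_N1_intro valid_N1_elim valid_N1_elim_eq valid_N1_beta
    valid_Plus_form valid_Plus_form_eq valid_InL_intro valid_InL_intro_eq
    valid_InR_intro valid_InR_intro_eq valid_Plus_elim valid_Plus_elim_eq
    valid_Plus_beta_InL valid_Plus_beta_InR
    valid_List_form valid_List_form_eq valid_Eps_intro valid_Cons_intro valid_Cons_intro_eq
    valid_List_elim valid_List_elim_eq valid_List_beta_Eps valid_List_beta_Cons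
    valid_Sig_form valid_Sig_form_eq valid_Sig_intro valid_Sig_intro_eq
    valid_Sig_elim valid_Sig_elim_eq valid_Sig_beta valid_lem valid_tm_conv valid_tmeq_conv;
  assumption)+

text \<open>
  From \<open>\<not>\<not>\<bottom>\<close> follows \<open>\<bottom>\<close> by applying the double negation to the identity.
\<close>
lemma Stab_Bot: "T \<rhd> [] \<turnstile> Lam (Neg (Neg Bot)) (App (Var 0) (Lam Bot (Var 0))) \<Colon> Stab Bot"
proof -
  have B: "T \<rhd> [] \<turnstile> Bot \<Colon> Prp" by (intro Bot_Prp ctxt_empty)
  have NN: "T \<rhd> [] \<turnstile> Neg (Neg Bot) Type"
    by (intro Prp_type[of _ _ "Neg _"] Neg_Prp) (rule Prp_type[OF B])
  have c1: "T \<rhd> [Neg (Neg Bot)] \<turnstile> Ctxt" using NN by (rule ctxt_ext)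
  have B1: "T \<rhd> [Neg (Neg Bot)] \<turnstile> Bot Type" by (intro Prp_type[of _ _ Bot] Bot_Prp c1)
  have "T \<rhd> [Bot, Neg (Neg Bot)] \<turnstile> Var 0 \<Colon> Bot"
    using var[OF ctxt_ext[OF B1], of 0] by simp
  then have "T \<rhd> [Neg (Neg Bot)] \<turnstile> Lam Bot (Var 0) \<Colon> Neg Bot" by (rule Neg_intro[OF B1])
  then have "T \<rhd> [Neg (Neg Bot)] \<turnstile> App (Var 0) (Lam Bot (Var 0)) \<Colon> Bot"
    using var[OF c1, of 0] by (intro Neg_elim[of _ _ _ "Neg Bot"]) simp_all
  then show ?thesis
    unfolding Stab_def by (intro Imp_intro NN) simp
qed

text \<open>
  Instantiating the translated falsity at the stable proposition \<open>Bot\<close> gives a term whose type is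
  the first projection of a pair with first component \<open>Bot\<close>.
\<close>
lemma BotS_elim:
  assumes "T \<rhd> [] \<turnstile> t \<Colon> BotS"
  shows "\<exists>u. T \<rhd> [] \<turnstile> u \<Colon> Bot"
proof -
  let ?b = "Lam (Neg (Neg Bot)) (App (Var 0) (Lam Bot (Var 0)))"
  have S: "T \<rhd> [] \<turnstile> SProp Type" by (intro SProp_type ctxt_empty)
  have B: "T \<rhd> [] \<turnstile> Bot \<Colon> Prp" by (intro Bot_Prp ctxt_empty)
  have P: "T \<rhd> [] \<turnstile> PairT Bot ?b \<Colon> SProp"
    using SProp_pair_eq[OF tmeq_refl[OF B] tmeq_refl[OF Stab_Bot]] by (rule tm_left)
  have p: "T \<rhd> [SProp] \<turnstile> proj1 (Var 0) Type"
    using var[OF ctxt_ext[OF S], of 0] by (intro Prp_type proj1_Prp) simp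
  have "T \<rhd> [] \<turnstile> App t (PairT Bot ?b) \<Colon> proj1 (PairT Bot ?b)"
    using Pi_elim[OF S p assms[unfolded BotS_def] P] by simp
  moreover have "T \<rhd> [] \<turnstile> proj1 (PairT Bot ?b) \<approx> Bot Type"
    using proj1_beta[OF B Stab_Bot] by (rule Prp_type_eq)
  ultimately show ?thesis by (blast intro: tm_conv)
qed

theorem corollary5:
  shows "consistent CC_ML \<longleftrightarrow> consistent CC_ML_c"
proof
  assume "consistent CC_ML_c"
  then show "consistent CC_ML"
    unfolding consistent_def using CC_ML_le(4)[OF refl] by blast
next
  assume c: "consistent CC_ML"
  show "consistent CC_ML_c"
    unfolding consistent_def
  proof
    assume "\<exists>t. CC_ML_c \<rhd> [] \<turnstile> t \<Colon> Bot"
    then obtain t where "CC_ML_c \<rhd> [] \<turnstile> t \<Colon> Bot" ..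
    then have "valid_term [] t Bot" by (rule soundness)
    then have "CC_ML \<rhd> [] \<turnstile> tm t \<Colon> BotS" using valid_termD_id by fastforce
    then show False using BotS_elim c unfolding consistent_def by blast
  qed
qed

end
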